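(* Suppose $\{q_n\}_{n\ge1}$ is a sequence with $q_n>0$ and $\lim_{n\to\infty}n(1-q_n)=\beta$, where $|\beta|<\ln 2$. Then for any sequence $\{k_n\}_{n\ge1}$ with $k_n\in[n]$ and $\lim_{n\to\infty}k_n=\infty$, and any $\epsilon>0$, $$\lim_{n\to\infty}\ \max_{\mathbf b\in Q(n,k_n)}\ \mu_{n,q_n}\left(\pi\in S_n:\ \frac{\mathrm{LIS}(\pi_{\mathbf b})}{\sqrt{k_n}}\notin\left(2e^{-|\beta|/2}-\epsilon,\ 2e^{|\beta|/2}+\epsilon\right)\right)=0.$$
   Context: $[n]=\{1,\dots,n\}$; $S_n$ is the set of permutations of $[n]$. For $\pi\in S_n$, $l(\pi)$ is the number of pairs $i<j$ with $\pi(i)>\pi(j)$. For $q>0$ the Mallows measure on $S_n$ is $\mu_{n,q}(\pi)=q^{l(\pi)}/Z_{n,q}$, with $Z_{n,q}$ the normalizing constant. For $m\in[n]$, $Q(n,m)=\{(b_1,\dots,b_m): b_i\in[n],\ b_i<b_{i+1}\text{ for all }i\}$. For $\pi\in S_n$ and $\mathbf b\in Q(n,m)$, $\pi_{\mathbf b}\in S_m$ is the permutation induced by $(\pi(b_1),\dots,\pi(b_m))$: $\pi_{\mathbf b}(i)=j$ if $\pi(b_i)$ is the $j$-th smallest among $\pi(b_1),\dots,\pi(b_m)$. For a permutation $\sigma$, $\mathrm{LIS}(\sigma)$ is the length of its longest increasing subsequence. *)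

theory Defs
  imports "HOL-Probability.Probability" "HOL-Combinatorics.Permutations"
begin

text \<open>The symmetric group \<open>S\<^sub>n\<close> is \<open>{p. p permutes {1..n}}\<close>: permutations of \<open>{1..n}\<close> extended by the
  identity to all of \<open>nat\<close>.\<close>

definition inv_number :: "nat \<Rightarrow> (nat \<Rightarrow> nat) \<Rightarrow> nat" where
  "inv_number n p = card {(i, j). i \<in> {1..n} \<and> j \<in> {1..n} \<and> i < j \<and> p i > p j}"

definition mallows_Z :: "nat \<Rightarrow> real \<Rightarrow> real" where
  "mallows_Z n q = (\<Sum>p | p permutes {1..n}. q ^ inv_number n p)"

definition mallows :: "nat \<Rightarrow> real \<Rightarrow> (nat \<Rightarrow> nat) measure" where
  "mallows n q = point_measure {p. p permutes {1..n}} (\<lambda>p. ennreal (q ^ inv_number n p / mallows_Z n q))"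

text \<open>A tuple \<open>(b\<^sub>1, \<dots>, b\<^sub>m)\<close> is an extensional function on \<open>{1..m}\<close>, so that distinct members of the
  set below are distinct tuples and the set is finite.\<close>

definition incr_tuples :: "nat \<Rightarrow> nat \<Rightarrow> (nat \<Rightarrow> nat) set" where
  "incr_tuples n m = {b \<in> {1..m} \<rightarrow>\<^sub>E {1..n}. strict_mono_on {1..m} b}"

text \<open>The value \<open>p (b i)\<close> is the \<open>j\<close>-th smallest among the distinct values \<open>p (b 1), \<dots>, p (b m)\<close> exactly
  if \<open>j\<close> of these values are at most \<open>p (b i)\<close>.\<close>

definition induced_perm :: "nat \<Rightarrow> (nat \<Rightarrow> nat) \<Rightarrow> (nat \<Rightarrow> nat) \<Rightarrow> nat \<Rightarrow> nat" where
  "induced_perm m p b i =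
     (if i \<in> {1..m} then card {k \<in> {1..m}. p (b k) \<le> p (b i)} else i)"

text \<open>An increasing subsequence is given by its set of positions.\<close>

definition LIS :: "nat \<Rightarrow> (nat \<Rightarrow> nat) \<Rightarrow> nat" where
  "LIS m s = Max {card A | A. A \<subseteq> {1..m} \<and> strict_mono_on A s}"

lemma mallows_Z_pos: "q > 0 \<Longrightarrow> mallows_Z n q > 0"
  unfolding mallows_Z_def
  by (intro sum_pos) (auto intro: finite_permutations exI[of _ id] permutes_id)

lemma space_mallows [simp]: "space (mallows n q) = {p. p permutes {1..n}}"
  by (simp add: mallows_def space_point_measure)

lemma measure_mallows_singleton:
  assumes "q > 0" "p permutes {1..n}"
  shows "measure (mallows n q) {p} = q ^ inv_number n p / mallows_Z n q"
  unfolding measure_def mallows_def using assms mallows_Z_pos[OF assms(1), of n]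
  by (subst emeasure_point_measure_finite) (auto simp: finite_permutations)

lemma prob_space_mallows:
  assumes "q > 0"
  shows "prob_space (mallows n q)"
proof
  have Z: "mallows_Z n q > 0" by (rule mallows_Z_pos[OF assms])
  have "emeasure (mallows n q) (space (mallows n q)) =
      (\<Sum>p | p permutes {1..n}. ennreal (q ^ inv_number n p / mallows_Z n q))"
    unfolding space_mallows unfolding mallows_def
    by (rule emeasure_point_measure_finite) (auto simp: finite_permutations)
  also have "\<dots> = ennreal (\<Sum>p | p permutes {1..n}. q ^ inv_number n p / mallows_Z n q)"
    using assms Z by (intro sum_ennreal) auto
  also have "\<dots> = 1"
    using Z by (simp add: mallows_Z_def flip: sum_divide_distrib)
  finally show "emeasure (mallows n q) (space (mallows n q)) = 1" .
qed

lemma finite_incr_tuples: "finite (incr_tuples n m)"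
  unfolding incr_tuples_def by (rule finite_subset[of _ "{1..m} \<rightarrow>\<^sub>E {1..n}"]) (auto intro: finite_PiE)

lemma incr_tuples_nonempty:
  assumes "m \<le> n"
  shows "incr_tuples n m \<noteq> {}"
proof -
  have "restrict id {1..m} \<in> incr_tuples n m"
    using assms by (auto simp: incr_tuples_def strict_mono_on_def)
  then show ?thesis by blast
qed

lemma induced_perm_less_iff:
  assumes "i \<in> {1..m}" "j \<in> {1..m}"
  shows "induced_perm m p b i < induced_perm m p b j \<longleftrightarrow> p (b i) < p (b j)"
proof -
  let ?R = "\<lambda>i. {k \<in> {1..m}. p (b k) \<le> p (b i)}"
  have eq: "induced_perm m p b i = card (?R i)" "induced_perm m p b j = card (?R j)"
    using assms by (simp_all add: induced_perm_def)
  show ?thesis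
  proof (cases "p (b i) < p (b j)")
    case True
    have "?R i \<subseteq> ?R j" using True by auto
    moreover have "j \<in> ?R j" "j \<notin> ?R i" using assms True by auto
    ultimately have "?R i \<subset> ?R j" by blast
    then have "card (?R i) < card (?R j)" by (intro psubset_card_mono) auto
    then show ?thesis using True eq by simp
  next
    case False
    then have "card (?R j) \<le> card (?R i)" by (intro card_mono) auto
    then show ?thesis using False eq by simp
  qed
qed

lemma induced_perm_permutes:
  assumes "p permutes {1..n}" "b \<in> incr_tuples n m"
  shows "induced_perm m p b permutes {1..m}"
proof -
  have inj_b: "inj_on b {1..m}"
    using assms(2) strict_mono_on_imp_inj_on by (auto simp: incr_tuples_def)
  have inj: "inj_on (induced_perm m p b) {1..m}"
  proof (rule inj_onI)
    fix i j assume ij: "i \<in> {1..m}" "j \<in> {1..m}" "induced_perm m p b i = induced_perm m p b j"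
    then have "\<not> p (b i) < p (b j)" "\<not> p (b j) < p (b i)"
      using induced_perm_less_iff[of i m j p b] induced_perm_less_iff[of j m i p b] by simp_all
    then have "p (b i) = p (b j)" by simp
    then have "b i = b j" using permutes_inj[OF assms(1)] by (simp add: inj_eq)
    then show "i = j" using inj_onD[OF inj_b] ij(1,2) by blast
  qed
  have "induced_perm m p b i \<in> {1..m}" if "i \<in> {1..m}" for i
  proof -
    let ?R = "{k \<in> {1..m}. p (b k) \<le> p (b i)}"
    have "card ?R \<le> card {1..m}" by (intro card_mono) auto
    moreover have "card {i} \<le> card ?R" using that by (intro card_mono) auto
    ultimately show ?thesis using that by (auto simp: induced_perm_def)
  qed
  then have "induced_perm m p b ` {1..m} \<subseteq> {1..m}" by blast
  then have "bij_betw (induced_perm m p b) {1..m} {1..m}"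
    unfolding bij_betw_def using inj endo_inj_surj[OF finite_atLeastAtMost] by blast
  then show ?thesis
    by (rule bij_imp_permutes) (auto simp: induced_perm_def)
qed

end

theory Submission
  imports Defs "HOL-Library.Sublist"
begin

text \<open>
The theorem combines a comparison of Mallows permutations with uniform sequences and the law
\<open>2 * sqrt k\<close> for the longest increasing subsequence of \<open>k\<close> uniform letters.

For the comparison, give every position in \<open>{1..n}\<close> a letter in \<open>{1..R}\<close> and weight each word by \<open>q\<close> to the number
of its inversions. Given that no letter repeats, the order pattern of the word is a Mallows permutation, and
for large \<open>R\<close> repetitions are rare (\<open>mallows_le_kernel_seq\<close>). Changing one letter changes the number of
inversions by at most \<open>n\<close>. So the conditional law of a letter, given any set of other letters, is within a
factor \<open>c = max q (1 / q) ^ n\<close> of the uniform law (\<open>letter_kernel_bounds\<close>), and \<open>c\<close> tends to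
\<open>exp \<bar>\<beta>\<bar>\<close>. This concerns the letters read along \<open>b\<close> in the same way for every \<open>b\<close>. Hence each of the \<open>m\<close>
letters read can be drawn by tossing a coin that shows heads with probability \<open>1 / c\<close>, and choosing a fresh
uniform letter on heads. The heads form a uniform sequence of about \<open>m / c\<close> letters. Conversely, a uniform
letter can be drawn from the conditional law of the next letter of the word with probability \<open>1 / c\<close>, so the
word is contained in a uniform sequence of about \<open>c * m\<close> letters (\<open>prob_kernel_domination\<close>). Increasing
subsequences survive insertions, so the longest one lies between about \<open>2 * sqrt (m / c)\<close> and
\<open>2 * sqrt (c * m)\<close> (\<open>lds_comparable\<close>), uniformly in \<open>b\<close>.

For uniform sequences, patience sorting of the letters is Hammersley's particle process. Adding sources at the
lower boundary, at the rate that balances a given particle density, makes Bernoulli configurations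
stationary (\<open>bits_stationary\<close>). In the stationary process, the longest chain that may also use sources and
initial particles has length equal to the number of sources plus the number of particles at the end
(\<open>chain_eq_particles\<close>). Both numbers are binomial, and in the balanced scaling each is close to \<open>sqrt k\<close>.
As boundary points can only help, this gives the upper bound \<open>2 * sqrt k\<close> (\<open>lds_uniform_upper\<close>).

For the lower bound, the optimal chain follows one of the two boundaries for a fraction \<open>z\<close> of its extent and
then leaves it for good (\<open>chain_exit\<close>). Along the boundary it collects about \<open>z * sqrt k\<close> points, and
afterwards, by the upper bound, at most about \<open>2 * sqrt (1 - z) * sqrt k\<close>. The sum \<open>z + 2 * sqrt (1 - z)\<close> is
smaller than \<open>2\<close> unless \<open>z = 0\<close> (\<open>exit_profile\<close>), whereas the chain has length close to \<open>2 * sqrt k\<close>. So the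
chain leaves the boundary almost at once, and nearly all of it is an increasing subsequence of the letters
(\<open>lds_uniform_lower\<close>).
\<close>

section \<open>Longest decreasing subsequences of lists\<close>

text \<open>Lists record sequences with the latest entry at the head, so an increasing subsequence of the
  sequence is a decreasing subsequence of the list.\<close>

definition lds :: "nat list \<Rightarrow> nat" where
  "lds xs = Max (length ` {ys. subseq ys xs \<and> sorted_wrt (>) ys})"

lemma finite_subseqs: "finite {ys. subseq ys xs \<and> P ys}"
  by (rule finite_subset[of _ "set (List.subseqs xs)"]) auto

lemma length_le_lds: "subseq ys xs \<Longrightarrow> sorted_wrt (>) ys \<Longrightarrow> length ys \<le> lds xs"
  unfolding lds_def by (rule Max_ge) (auto intro: finite_subseqs)

lemma lds_attained:
  obtains ys where "subseq ys xs" "sorted_wrt (>) ys" "length ys = lds xs"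
proof -
  have "lds xs \<in> length ` {ys. subseq ys xs \<and> sorted_wrt (>) ys}"
    unfolding lds_def
    by (rule Max_in) (auto intro!: finite_imageI finite_subseqs exI[of _ "[]"])
  then show ?thesis using that by auto
qed

lemma lds_mono: "subseq xs ys \<Longrightarrow> lds xs \<le> lds ys"
proof -
  assume "subseq xs ys"
  moreover obtain zs where "subseq zs xs" "sorted_wrt (>) zs" "length zs = lds xs"
    by (rule lds_attained)
  ultimately show ?thesis
    using length_le_lds[of zs ys] subseq_order.order_trans[of zs xs ys] by simp
qed

lemma lds_map:
  assumes "\<And>x y. x < y \<longleftrightarrow> f x < f y"
  shows "lds (map f xs) = lds xs"
proof -
  have sorted: "sorted_wrt (>) (map f ys) \<longleftrightarrow> sorted_wrt (>) ys" for ys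
    by (simp add: sorted_wrt_map flip: assms)
  have "{ys. subseq ys (map f xs) \<and> sorted_wrt (>) ys} =
      map f ` {ys. subseq ys xs \<and> sorted_wrt (>) ys}"
    by (auto simp: sorted subseq_map) (auto simp: sorted subseq_conv_nths nths_map)
  then show ?thesis
    by (simp add: lds_def image_image)
qed

text \<open>This is the recursion of the chain values of Hammersley's process below, restricted to values above
  \<open>t\<close>, so that the two can be compared entry by entry. Tracking
  the upper limit \<open>j\<close> of the values makes the recursion possible.\<close>

primrec lds_between :: "nat \<Rightarrow> nat list \<Rightarrow> nat \<Rightarrow> nat" where
  "lds_between t [] j = 0"
| "lds_between t (x # xs) j =
    (if t < x \<and> x \<le> j then max (lds_between t xs j) (Suc (lds_between t xs (x - 1)))
     else lds_between t xs j)"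

lemma length_le_lds_between:
  "subseq ys xs \<Longrightarrow> sorted_wrt (>) ys \<Longrightarrow> set ys \<subseteq> {t<..j} \<Longrightarrow> length ys \<le> lds_between t xs j"
proof (induction xs arbitrary: ys j)
  case (Cons x xs)
  show ?case
  proof (cases "subseq ys xs")
    case True
    then show ?thesis using Cons.IH[OF True Cons.prems(2,3)] by auto
  next
    case False
    then obtain ys' where ys: "ys = x # ys'" "subseq ys' xs"
      using Cons.prems(1) by (auto elim: list_emb.cases)
    then have "set ys' \<subseteq> {t<..x - 1}"
      using Cons.prems(2,3) by force
    then have "length ys' \<le> lds_between t xs (x - 1)"
      using Cons.IH[of ys' "x - 1"] ys Cons.prems(2) by auto
    then show ?thesis using ys Cons.prems(3) by auto
  qed
qed auto

lemma lds_between_attained: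
  "\<exists>ys. subseq ys xs \<and> sorted_wrt (>) ys \<and> set ys \<subseteq> {t<..j} \<and> length ys = lds_between t xs j"
proof (induction xs arbitrary: j)
  case (Cons x xs)
  obtain ys where ys: "subseq ys xs" "sorted_wrt (>) ys" "set ys \<subseteq> {t<..j}"
    "length ys = lds_between t xs j"
    using Cons.IH by blast
  show ?case
  proof (cases "t < x \<and> x \<le> j \<and> lds_between t xs j < Suc (lds_between t xs (x - 1))")
    case True
    obtain zs where zs: "subseq zs xs" "sorted_wrt (>) zs" "set zs \<subseteq> {t<..x - 1}"
      "length zs = lds_between t xs (x - 1)"
      using Cons.IH by blast
    have "subseq (x # zs) (x # xs)" "sorted_wrt (>) (x # zs)" "set (x # zs) \<subseteq> {t<..j}"
      using zs True by (auto simp: subset_iff)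
    moreover have "length (x # zs) = lds_between t (x # xs) j"
      using zs(4) True by auto
    ultimately show ?thesis by blast
  next
    case False
    then have "length ys = lds_between t (x # xs) j" using ys(4) by auto
    moreover have "subseq ys (x # xs)" using ys(1) by auto
    ultimately show ?thesis using ys(2,3) by blast
  qed
qed auto

lemma lds_between_eq: "lds_between t xs j = lds (filter (\<lambda>x. t < x \<and> x \<le> j) xs)"
proof (rule antisym)
  obtain ys where ys: "subseq ys xs" "sorted_wrt (>) ys" "set ys \<subseteq> {t<..j}"
    "length ys = lds_between t xs j"
    using lds_between_attained by blast
  have "subseq (filter (\<lambda>x. t < x \<and> x \<le> j) ys) (filter (\<lambda>x. t < x \<and> x \<le> j) xs)"
    using ys(1) by (rule subseq_filter)
  moreover have "filter (\<lambda>x. t < x \<and> x \<le> j) ys = ys"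
    using ys(3) by (intro filter_True) auto
  ultimately show "lds_between t xs j \<le> lds (filter (\<lambda>x. t < x \<and> x \<le> j) xs)"
    using length_le_lds[of ys] ys(2,4) by metis
next
  obtain ys where ys: "subseq ys (filter (\<lambda>x. t < x \<and> x \<le> j) xs)" "sorted_wrt (>) ys"
    "length ys = lds (filter (\<lambda>x. t < x \<and> x \<le> j) xs)"
    using lds_attained by blast
  have "set ys \<subseteq> {t<..j}"
    using ys(1) set_nths_subset by (fastforce simp: subseq_conv_nths)
  moreover have "subseq ys xs"
    by (rule subseq_order.order_trans[OF ys(1) subseq_filter_left])
  ultimately show "lds (filter (\<lambda>x. t < x \<and> x \<le> j) xs) \<le> lds_between t xs j"
    using length_le_lds_between[of ys xs t j] ys(2,3) by simp
qed

section \<open>Hammersley's process with sources\<close>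

text \<open>A configuration is the list of occupation numbers of the sites \<open>1, 2, \<dots>\<close>. In one step of
  Hammersley's process, the symbol \<open>t > 0\<close> makes the lowest particle at or above site \<open>t\<close> jump down to
  \<open>t\<close>, or creates a particle there if none exists; this is one insertion of patience sorting. The symbol
  \<open>0\<close> is a source on the boundary below site \<open>1\<close> and lets the lowest particle leave the system.\<close>

fun pop :: "bool list \<Rightarrow> bool list" where
  "pop [] = []"
| "pop (e # es) = False # (if e then es else pop es)"

fun push :: "nat \<Rightarrow> bool list \<Rightarrow> bool list" where
  "push 0 es = pop es"
| "push (Suc t) [] = []"
| "push (Suc 0) (e # es) = True # (if e then es else pop es)"
| "push (Suc (Suc t)) (e # es) = e # push (Suc t) es"

definition count_upto :: "nat \<Rightarrow> bool list \<Rightarrow> nat" where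
  "count_upto j es = length (filter id (take j es))"

lemma count_upto_simps [simp]:
  "count_upto 0 es = 0" "count_upto j [] = 0"
  "count_upto (Suc j) (e # es) = of_bool e + count_upto j es"
  by (auto simp: count_upto_def)

lemma count_upto_mono: "i \<le> j \<Longrightarrow> count_upto i es \<le> count_upto j es"
proof (induction es arbitrary: i j)
  case (Cons e es)
  then show ?case by (cases i; cases j) auto
qed simp

lemma count_upto_pop: "count_upto j (pop es) = count_upto j es - 1"
proof (induction es arbitrary: j)
  case (Cons e es)
  then show ?case by (cases j) auto
qed simp

text \<open>A jump from the next particle above down to \<open>t\<close> changes the counts exactly as one more symbol changes
  the chain values in \<open>chain\<close>.\<close>

lemma count_upto_push:
  assumes "0 < t" "t \<le> length es"
  shows "count_upto j (push t es) =
    (if t \<le> j then max (count_upto j es) (Suc (count_upto (t - 1) es)) else count_upto j es)"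
  using assms
proof (induction t es arbitrary: j rule: push.induct)
  case (3 e es)
  then show ?case by (cases j) (auto simp: count_upto_pop)
next
  case (4 t e es)
  then show ?case by (cases j) auto
qed auto

lemma length_pop [simp]: "length (pop es) = length es"
  by (induction es) auto

lemma length_push [simp]: "length (push t es) = length es"
  by (induction t es rule: push.induct) auto

lemma length_foldr_push [simp]: "length (foldr push xs es) = length es"
  by (induction xs) auto

text \<open>The length of the longest chain with values at most \<open>j\<close>, where a chain may start with boundary
  points, worth \<open>f i\<close> up to height \<open>i\<close>, or with sources, and then increases strictly. For the symbol
  \<open>0\<close> the truncated \<open>x - 1\<close> is \<open>0\<close>, so that any number of sources can be chained.\<close>

primrec chain :: "(nat \<Rightarrow> nat) \<Rightarrow> nat list \<Rightarrow> nat \<Rightarrow> nat" where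
  "chain f [] j = f j"
| "chain f (x # xs) j = (if x \<le> j then max (chain f xs j) (Suc (chain f xs (x - 1))) else chain f xs j)"

definition sources :: "nat list \<Rightarrow> nat" where
  "sources xs = length (filter (\<lambda>x. x = 0) xs)"

lemma sources_simps [simp]:
  "sources [] = 0" "sources (x # xs) = of_bool (x = 0) + sources xs"
  by (auto simp: sources_def)

text \<open>As a function of the height, the chain value grows by at most one per site. The sites where it grows
  are the particles, and its value at height \<open>0\<close> is the number of sources.\<close>

lemma chain_eq_particles:
  assumes "set xs \<subseteq> {..length es}"
  shows "chain (\<lambda>j. count_upto j es) xs j = sources xs + count_upto j (foldr push xs es)"
  using assms
proof (induction xs arbitrary: j)
  case (Cons x xs)
  then have IH: "chain (\<lambda>j. count_upto j es) xs j = sources xs + count_upto j (foldr push xs es)" for j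
    by simp
  show ?case
  proof (cases "x = 0")
    case True
    then show ?thesis by (simp add: IH count_upto_pop)
  next
    case False
    then show ?thesis using Cons.prems
      by (auto simp: IH count_upto_push max_def)
  qed
qed auto

lemma lds_between_le_chain: "lds_between 0 xs j \<le> chain f xs j"
proof (induction xs arbitrary: j)
  case (Cons x xs)
  show ?case using Cons.IH[of j] Cons.IH[of "x - 1"] by auto
qed simp

lemma chain_0: "f 0 = 0 \<Longrightarrow> chain f xs 0 = sources xs"
  by (induction xs) auto

text \<open>An optimal chain first runs along one of the two boundaries and then leaves it for good: it collects
  either the sources among the earliest \<open>length xs - i\<close> symbols, or the boundary points up to height \<open>t\<close>.\<close>

lemma chain_exit:
  assumes "f 0 = 0"
  shows "(\<exists>i\<le>length xs. chain f xs j \<le> sources (drop i xs) + lds_between 0 (take i xs) j) \<or>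
    (\<exists>t\<le>j. chain f xs j \<le> f t + lds_between t xs j)"
proof (induction xs arbitrary: j)
  case Nil
  then show ?case by auto
next
  case (Cons x xs)
  have keep: ?case if "chain f (x # xs) j = chain f xs j"
    using Cons.IH[of j]
  proof (elim disjE exE conjE)
    fix i assume "i \<le> length xs" "chain f xs j \<le> sources (drop i xs) + lds_between 0 (take i xs) j"
    then show ?case using that by (intro disjI1 exI[of _ "Suc i"]) (auto simp: le_max_iff_disj)
  next
    fix t assume "t \<le> j" "chain f xs j \<le> f t + lds_between t xs j"
    then show ?case using that by (intro disjI2 exI[of _ t]) (auto simp: le_max_iff_disj)
  qed
  show ?case
  proof (cases "x \<le> j \<and> chain f (x # xs) j = Suc (chain f xs (x - 1))")
    case False
    then have "chain f (x # xs) j = chain f xs j" by (auto simp: max_def)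
    then show ?thesis by (rule keep)
  next
    case True
    show ?thesis
    proof (cases "x = 0")
      case x0: True
      then have "chain f (x # xs) j = Suc (sources xs)" using True chain_0[of f xs, OF assms] by simp
      then show ?thesis using x0 by (intro disjI1 exI[of _ 0]) auto
    next
      case x: False
      show ?thesis
        using Cons.IH[of "x - 1"]
      proof (elim disjE exE conjE)
        fix i assume "i \<le> length xs"
          "chain f xs (x - 1) \<le> sources (drop i xs) + lds_between 0 (take i xs) (x - 1)"
        then show ?thesis using True x by (intro disjI1 exI[of _ "Suc i"]) (auto simp: le_max_iff_disj)
      next
        fix t assume "t \<le> x - 1" "chain f xs (x - 1) \<le> f t + lds_between t xs (x - 1)"
        then show ?thesis using True x by (intro disjI2 exI[of _ t]) (auto simp: le_max_iff_disj)
      qed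
    qed
  qed
qed

section \<open>Stationarity of Hammersley's process\<close>

abbreviation bits :: "nat \<Rightarrow> real \<Rightarrow> bool list pmf" where
  "bits R \<rho> \<equiv> replicate_pmf R (bernoulli_pmf \<rho>)"

definition symbol :: "real \<Rightarrow> nat \<Rightarrow> nat pmf" where
  "symbol s R = bernoulli_pmf s \<bind> (\<lambda>z. if z then return_pmf 0 else pmf_of_set {1..R})"

lemma replicate_pmf_Suc_map:
  "replicate_pmf (Suc n) p = p \<bind> (\<lambda>x. map_pmf (Cons x) (replicate_pmf n p))"
  by (simp add: map_pmf_def)

lemma finite_set_replicate_pmf: "finite (set_pmf p) \<Longrightarrow> finite (set_pmf (replicate_pmf n p))"
  using finite_lists_length_eq[of "set_pmf p" n]
  by (rule rev_finite_subset) (auto simp: set_replicate_pmf)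

lemma expectation_bits_Suc:
  fixes g :: "bool list \<Rightarrow> real"
  assumes "\<rho> \<in> {0..1}"
  shows "measure_pmf.expectation (bits (Suc R) \<rho>) g =
    \<rho> * measure_pmf.expectation (bits R \<rho>) (\<lambda>es. g (True # es)) +
    (1 - \<rho>) * measure_pmf.expectation (bits R \<rho>) (\<lambda>es. g (False # es))"
  unfolding replicate_pmf_Suc_map using assms
  by (subst pmf_expectation_bind[of UNIV])
     (auto simp: finite_set_replicate_pmf UNIV_bool)

text \<open>Enumerating the predecessors of a configuration is avoided by testing against an arbitrary function \<open>g\<close> and
  peeling off the lowest site: the induction hypothesis is used for \<open>g\<close> with the lowest site occupied
  and with the lowest site empty, and the two terms in which the lowest site is occupied and a further
  particle is removed cancel exactly if \<open>s * \<rho> = w * (1 - \<rho>)\<close>.\<close>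

lemma push_invariant_expectation:
  fixes g :: "bool list \<Rightarrow> real"
  assumes \<rho>: "\<rho> \<in> {0..1}" and balance: "s * \<rho> = w * (1 - \<rho>)"
  shows "s * measure_pmf.expectation (bits R \<rho>) (\<lambda>es. g (pop es)) +
    w * (\<Sum>t<R. measure_pmf.expectation (bits R \<rho>) (\<lambda>es. g (push (Suc t) es))) =
    (s + w * real R) * measure_pmf.expectation (bits R \<rho>) g"
proof (induction R arbitrary: g)
  case 0
  then show ?case by simp
next
  case (Suc R)
  define E where "E = (\<lambda>g::bool list \<Rightarrow> real. measure_pmf.expectation (bits R \<rho>) g)"
  note IH = Suc.IH[folded E_def]
  have Suc_E: "measure_pmf.expectation (bits (Suc R) \<rho>) g =
      \<rho> * E (\<lambda>es. g (True # es)) + (1 - \<rho>) * E (\<lambda>es. g (False # es))" for g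
    unfolding E_def by (rule expectation_bits_Suc[OF \<rho>])
  define a where "a = E (\<lambda>es. g (True # pop es))"
  define b where "b = E (\<lambda>es. g (True # es))"
  define c where "c = E (\<lambda>es. g (False # es))"
  define d where "d = E (\<lambda>es. g (False # pop es))"
  define S1 where "S1 = (\<Sum>t<R. E (\<lambda>es. g (True # push (Suc t) es)))"
  define S0 where "S0 = (\<Sum>t<R. E (\<lambda>es. g (False # push (Suc t) es)))"
  have 1: "w * S1 = (s + w * real R) * b - s * a"
    using IH[of "\<lambda>es. g (True # es)"] by (simp add: S1_def a_def b_def)
  have 0: "w * S0 = (s + w * real R) * c - s * d"
    using IH[of "\<lambda>es. g (False # es)"] by (simp add: S0_def c_def d_def)
  have "s * (\<rho> * c + (1 - \<rho>) * d) + w * ((\<rho> * b + (1 - \<rho>) * a) + (\<rho> * S1 + (1 - \<rho>) * S0)) =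
      s * \<rho> * c + s * (1 - \<rho>) * d + w * \<rho> * b + w * (1 - \<rho>) * a + \<rho> * (w * S1) + (1 - \<rho>) * (w * S0)"
    by (simp add: algebra_simps)
  also have "\<dots> = (s * \<rho>) * c + w * \<rho> * b + (w * (1 - \<rho>) - s * \<rho>) * a +
      \<rho> * ((s + w * real R) * b) + (1 - \<rho>) * ((s + w * real R) * c)"
    unfolding 0 1 by (simp add: algebra_simps)
  also have "\<dots> = w * (1 - \<rho>) * c + w * \<rho> * b +
      \<rho> * ((s + w * real R) * b) + (1 - \<rho>) * ((s + w * real R) * c)"
    by (simp add: balance)
  also have "\<dots> = (s + w * real (Suc R)) * (\<rho> * b + (1 - \<rho>) * c)"
    by (simp add: algebra_simps)
  finally show ?case
    by (simp add: Suc_E sum.lessThan_Suc_shift sum.distrib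
        flip: a_def b_def c_def d_def S0_def S1_def sum_distrib_left del: replicate_pmf.simps sum.lessThan_Suc)
      (simp add: algebra_simps)
qed

lemma set_symbol: "0 < R \<Longrightarrow> set_pmf (symbol s R) \<subseteq> {..R}"
  by (auto simp: symbol_def split: if_splits)

lemma pmf_symbol_0: "s \<in> {0..1} \<Longrightarrow> 0 < R \<Longrightarrow> pmf (symbol s R) 0 = s"
  unfolding symbol_def by (subst pmf_bind) simp

lemma pmf_symbol_Suc: "s \<in> {0..1} \<Longrightarrow> t < R \<Longrightarrow> pmf (symbol s R) (Suc t) = (1 - s) / real R"
  unfolding symbol_def by (subst pmf_bind) (simp add: indicator_def)

lemma bits_invariant:
  assumes "\<rho> \<in> {0..1}" "s \<in> {0..1}" "0 < R" and balance: "s * \<rho> = (1 - s) / real R * (1 - \<rho>)"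
  shows "bits R \<rho> \<bind> (\<lambda>es. map_pmf (\<lambda>x. push x es) (symbol s R)) = bits R \<rho>"
proof (rule pmf_eqI)
  fix fs :: "bool list"
  define g where "g = (indicator {fs} :: bool list \<Rightarrow> real)"
  have fin: "finite (set_pmf (map_pmf f (bits R \<rho>)))" for f :: "bool list \<Rightarrow> bool list"
    by (simp add: finite_set_replicate_pmf)
  have pmf_eq: "pmf p fs = measure_pmf.expectation p g" for p
    by (simp add: pmf.rep_eq g_def)
  have "bits R \<rho> \<bind> (\<lambda>es. map_pmf (\<lambda>x. push x es) (symbol s R)) =
      symbol s R \<bind> (\<lambda>x. map_pmf (push x) (bits R \<rho>))"
    unfolding map_pmf_def by (rule bind_commute_pmf)
  then have "pmf (bits R \<rho> \<bind> (\<lambda>es. map_pmf (\<lambda>x. push x es) (symbol s R))) fs =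
      measure_pmf.expectation (bind_pmf (symbol s R) (\<lambda>x. map_pmf (push x) (bits R \<rho>))) g"
    by (simp add: pmf_eq)
  also have "\<dots> = (\<Sum>x\<le>R. pmf (symbol s R) x *
      measure_pmf.expectation (bits R \<rho>) (\<lambda>es. g (push x es)))"
    using assms fin by (subst pmf_expectation_bind[of "{..R}"]) (auto simp: set_symbol)
  also have "\<dots> = s * measure_pmf.expectation (bits R \<rho>) (\<lambda>es. g (pop es)) +
      (1 - s) / real R * (\<Sum>t<R. measure_pmf.expectation (bits R \<rho>) (\<lambda>es. g (push (Suc t) es)))"
    using assms by (simp add: sum.atMost_shift pmf_symbol_0 pmf_symbol_Suc sum_distrib_left)
  also have "\<dots> = (s + (1 - s) / real R * real R) * measure_pmf.expectation (bits R \<rho>) g"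
    using assms by (intro push_invariant_expectation) auto
  also have "\<dots> = pmf (bits R \<rho>) fs"
    using assms(3) by (simp add: pmf_eq)
  finally show "pmf (bits R \<rho> \<bind> (\<lambda>es. map_pmf (\<lambda>x. push x es) (symbol s R))) fs = pmf (bits R \<rho>) fs" .
qed

lemma bits_stationary:
  assumes "\<rho> \<in> {0..1}" "s \<in> {0..1}" "0 < R" "s * \<rho> = (1 - s) / real R * (1 - \<rho>)"
  shows "bits R \<rho> \<bind> (\<lambda>es. map_pmf (\<lambda>xs. foldr push xs es) (replicate_pmf k (symbol s R))) = bits R \<rho>"
proof (induction k)
  case 0
  then show ?case by (simp add: bind_return_pmf')
next
  case (Suc k)
  have "bits R \<rho> \<bind> (\<lambda>es. map_pmf (\<lambda>xs. foldr push xs es) (replicate_pmf (Suc k) (symbol s R))) =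
     bits R \<rho> \<bind> (\<lambda>es. replicate_pmf k (symbol s R) \<bind> (\<lambda>xs. symbol s R \<bind>
        (\<lambda>x. return_pmf (push x (foldr push xs es)))))"
    by (subst bind_commute_pmf) (simp add: map_pmf_def bind_assoc_pmf bind_return_pmf)
  also have "\<dots> = (bits R \<rho> \<bind> (\<lambda>es. map_pmf (\<lambda>xs. foldr push xs es) (replicate_pmf k (symbol s R))))
      \<bind> (\<lambda>es. map_pmf (\<lambda>x. push x es) (symbol s R))"
    by (simp add: map_pmf_def bind_assoc_pmf bind_return_pmf)
  finally show ?case
    by (simp add: Suc.IH bits_invariant[OF assms] del: replicate_pmf.simps)
qed

section \<open>Binomial laws\<close>

lemma expectation_binomial_Suc:
  fixes f :: "nat \<Rightarrow> real"
  assumes "p \<in> {0..1}"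
  shows "measure_pmf.expectation (binomial_pmf (Suc n) p) f =
    p * measure_pmf.expectation (binomial_pmf n p) (\<lambda>x. f (Suc x)) +
    (1 - p) * measure_pmf.expectation (binomial_pmf n p) f"
proof -
  have "binomial_pmf (Suc n) p =
      bernoulli_pmf p \<bind> (\<lambda>b. map_pmf (if b then Suc else id) (binomial_pmf n p))"
    using assms by (auto simp: binomial_pmf_Suc map_pmf_def intro!: bind_pmf_cong)
  then have "measure_pmf.expectation (binomial_pmf (Suc n) p) f =
      measure_pmf.expectation
        (bind_pmf (bernoulli_pmf p) (\<lambda>b. map_pmf (if b then Suc else id) (binomial_pmf n p))) f"
    by simp
  also have "\<dots> = p * measure_pmf.expectation (binomial_pmf n p) (\<lambda>x. f (Suc x)) +
      (1 - p) * measure_pmf.expectation (binomial_pmf n p) f"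
    using assms finite_set_pmf_binomial_pmf[OF assms, of n]
    by (subst pmf_expectation_bind[of UNIV]) (auto simp: UNIV_bool)
  finally show ?thesis .
qed

lemma binomial_moments:
  assumes p: "p \<in> {0..1}"
  shows expectation_binomial: "measure_pmf.expectation (binomial_pmf n p) real = real n * p"
    and second_moment_binomial:
      "measure_pmf.expectation (binomial_pmf n p) (\<lambda>x. (real x)\<^sup>2) = real n * p * (1 - p) + (real n * p)\<^sup>2"
proof -
  have [simp]: "integrable (binomial_pmf n p) f" for n and f :: "nat \<Rightarrow> real"
    using p by simp
  have 1: "measure_pmf.expectation (binomial_pmf n p) real = real n * p" for n
  proof (induction n)
    case (Suc n)
    then show ?case
      by (simp add: expectation_binomial_Suc[OF p] algebra_simps)
  qed (use p in \<open>simp add: binomial_pmf_0\<close>)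
  show "measure_pmf.expectation (binomial_pmf n p) real = real n * p" by (rule 1)
  show "measure_pmf.expectation (binomial_pmf n p) (\<lambda>x. (real x)\<^sup>2) = real n * p * (1 - p) + (real n * p)\<^sup>2"
  proof (induction n)
    case (Suc n)
    have step: "measure_pmf.expectation (binomial_pmf n p) (\<lambda>x. (real (Suc x))\<^sup>2) =
        measure_pmf.expectation (binomial_pmf n p) (\<lambda>x. (real x)\<^sup>2) + 2 * (real n * p) + 1"
    proof -
      have "measure_pmf.expectation (binomial_pmf n p) (\<lambda>x. (real (Suc x))\<^sup>2) =
        measure_pmf.expectation (binomial_pmf n p) (\<lambda>x. (real x)\<^sup>2 + 2 * real x + 1)"
      by (simp add: power2_eq_square algebra_simps)
    also have "\<dots> = measure_pmf.expectation (binomial_pmf n p) (\<lambda>x. (real x)\<^sup>2) + 2 * (real n * p) + 1"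
        by (simp add: 1)
      finally show ?thesis .
    qed
    show ?case
      unfolding expectation_binomial_Suc[OF p] step Suc.IH
      by (simp add: power2_eq_square algebra_simps)
  qed (use p in \<open>simp add: binomial_pmf_0\<close>)
qed

lemma binomial_Chebyshev:
  assumes p: "p \<in> {0..1}" and "a > 0"
  shows "measure_pmf.prob (binomial_pmf n p) {x. a \<le> \<bar>real x - real n * p\<bar>} \<le> real n * p / a\<^sup>2"
proof -
  have "measure_pmf.prob (binomial_pmf n p) {x. a \<le> \<bar>real x - real n * p\<bar>} \<le>
      measure_pmf.variance (binomial_pmf n p) real / a\<^sup>2"
    using measure_pmf.Chebyshev_inequality[of real "binomial_pmf n p" a] p \<open>a > 0\<close>
    by (simp add: expectation_binomial)
  also have "measure_pmf.variance (binomial_pmf n p) real = real n * p * (1 - p)"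
    using p by (subst measure_pmf.variance_eq) (auto simp: binomial_moments)
  also have "\<dots> / a\<^sup>2 \<le> real n * p / a\<^sup>2"
    using p by (intro divide_right_mono) (auto simp: mult_left_le)
  finally show ?thesis .
qed

text \<open>The independent decisions which entries satisfy \<open>P\<close> can be made first. Given them, the entries in
  \<open>P\<close> are still i.i.d., and their number is binomial.\<close>

lemma filter_replicate_pmf:
  assumes \<theta>: "\<theta> = measure_pmf.prob p {x. P x}" "0 < \<theta>" "\<theta> < 1"
  shows "map_pmf (filter P) (replicate_pmf k p) =
    binomial_pmf k \<theta> \<bind> (\<lambda>j. replicate_pmf j (cond_pmf p {x. P x}))"
proof -
  have compl: "measure_pmf.prob p {x. \<not> P x} = 1 - \<theta>"
    using measure_pmf.prob_compl[of "{x. P x}" p] by (simp add: \<theta>(1) Compl_eq flip: Compl_eq_Diff_UNIV)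
  have ne: "set_pmf p \<inter> {x. P x} \<noteq> {}"
    using \<theta>(1,2) measure_pmf_zero_iff[of p "{x. P x}"] by auto
  have nec: "set_pmf p \<inter> {x. \<not> P x} \<noteq> {}"
    using \<theta>(3) compl measure_pmf_zero_iff[of p "{x. \<not> P x}"] by auto
  have prob: "measure_pmf.prob p {x. b = P x} = measure_pmf.prob (bernoulli_pmf \<theta>) {c. c = P y}"
    if "b = P y" for b y
  proof (cases b)
    case True
    have "{c. c} = {True}" by auto
    then show ?thesis using that True \<theta> by (simp add: measure_pmf_single)
  next
    case False
    have "{c. \<not> c} = {False}" by auto
    then show ?thesis using that False \<theta> compl by (simp add: measure_pmf_single)
  qed
  have mix: "bernoulli_pmf \<theta> \<bind> (\<lambda>b. cond_pmf p {x. b = P x}) = p"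
  proof (rule bind_cond_pmf_cancel)
    fix b assume "b \<in> set_pmf (bernoulli_pmf \<theta>)"
    show "set_pmf p \<inter> {x. b = P x} \<noteq> {}" using ne nec by (cases b) auto
  qed (use \<theta> prob in auto)
  show ?thesis
  proof (induction k)
    case 0
    then show ?case using \<theta> by (simp add: binomial_pmf_0 bind_return_pmf)
  next
    case (Suc k)
    define B where "B = binomial_pmf k \<theta>"
    define C where "C = (\<lambda>b. cond_pmf p {x. b = P x})"
    have C: "x \<in> set_pmf (C b) \<Longrightarrow> P x = b" for x b
      using ne nec by (cases b) (auto simp: C_def)
    have "map_pmf (filter P) (replicate_pmf (Suc k) p) =
        p \<bind> (\<lambda>x. map_pmf (\<lambda>ys. if P x then x # ys else ys) (map_pmf (filter P) (replicate_pmf k p)))"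
      unfolding replicate_pmf_Suc_map map_bind_pmf map_pmf_comp
      by (intro bind_pmf_cong refl map_pmf_cong) auto
    also have "\<dots> = (bernoulli_pmf \<theta> \<bind> C) \<bind> (\<lambda>x. map_pmf (\<lambda>ys. if P x then x # ys else ys)
        (B \<bind> (\<lambda>j. replicate_pmf j (C True))))"
      unfolding Suc.IH by (simp add: mix C_def B_def)
    also have "\<dots> = bernoulli_pmf \<theta> \<bind> (\<lambda>b. C b \<bind> (\<lambda>x. map_pmf (\<lambda>ys. if b then x # ys else ys)
        (B \<bind> (\<lambda>j. replicate_pmf j (C True)))))"
      unfolding bind_assoc_pmf by (intro bind_pmf_cong refl) (auto dest: C)
    also have "\<dots> = bernoulli_pmf \<theta> \<bind> (\<lambda>b. B \<bind> (\<lambda>j. replicate_pmf (of_bool b + j) (C True)))"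
    proof (intro bind_pmf_cong refl)
      fix b
      show "C b \<bind> (\<lambda>x. map_pmf (\<lambda>ys. if b then x # ys else ys) (B \<bind> (\<lambda>j. replicate_pmf j (C True)))) =
          B \<bind> (\<lambda>j. replicate_pmf (of_bool b + j) (C True))"
      proof (cases b)
        case True
        then show ?thesis
          using bind_commute_pmf[of "C True" B "\<lambda>x j. map_pmf (Cons x) (replicate_pmf j (C True))"]
          by (simp add: map_bind_pmf replicate_pmf_Suc_map del: replicate_pmf.simps)
      qed (simp add: map_pmf_ident[unfolded id_def] )
    qed
    also have "\<dots> = binomial_pmf (Suc k) \<theta> \<bind> (\<lambda>j. replicate_pmf j (C True))"
      using \<theta>(2,3) by (simp add: binomial_pmf_Suc bind_assoc_pmf bind_return_pmf B_def of_bool_def)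
    finally show ?case by (simp add: C_def)
  qed
qed

lemma length_filter_replicate_pmf:
  assumes \<theta>: "\<theta> = measure_pmf.prob p {x. P x}" "0 < \<theta>" "\<theta> < 1"
  shows "map_pmf (\<lambda>xs. length (filter P xs)) (replicate_pmf k p) = binomial_pmf k \<theta>"
proof -
  have len: "map_pmf length (replicate_pmf j q) = return_pmf j" for j and q :: "'a pmf"
    using map_pmf_cong[of "replicate_pmf j q" _ length "\<lambda>_. j"] by (simp add: set_replicate_pmf)
  have "map_pmf (\<lambda>xs. length (filter P xs)) (replicate_pmf k p) =
      map_pmf length (map_pmf (filter P) (replicate_pmf k p))"
    by (simp add: map_pmf_comp)
  also have "\<dots> = binomial_pmf k \<theta>"
    unfolding filter_replicate_pmf[OF assms] by (simp add: map_bind_pmf len bind_return_pmf')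
  finally show ?thesis .
qed

lemma map_drop_replicate_pmf: "map_pmf (drop i) (replicate_pmf k p) = replicate_pmf (k - i) p"
proof (induction k arbitrary: i)
  case (Suc k)
  show ?case
  proof (cases i)
    case (Suc i')
    then show ?thesis
      using Suc.IH[of i'] by (simp add: replicate_pmf_Suc_map map_bind_pmf map_pmf_comp del: replicate_pmf.simps)
  qed (simp add: map_pmf_ident[unfolded id_def] del: replicate_pmf.simps)
qed simp

lemma map_take_replicate_pmf: "i \<le> k \<Longrightarrow> map_pmf (take i) (replicate_pmf k p) = replicate_pmf i p"
proof (induction k arbitrary: i)
  case (Suc k)
  show ?case
  proof (cases i)
    case 0
    then show ?thesis by simp
  next
    case (Suc i')
    then show ?thesis
      using Suc.IH[of i', symmetric] Suc.prems
      by (simp add: replicate_pmf_Suc_map map_bind_pmf map_pmf_comp del: replicate_pmf.simps)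
  qed
qed simp

section \<open>Longest increasing subsequences of uniform sequences\<close>

definition lds_tail :: "nat \<Rightarrow> nat \<Rightarrow> real \<Rightarrow> real" where
  "lds_tail k R a = measure_pmf.prob (replicate_pmf k (pmf_of_set {1..R})) {xs. a < real (lds xs)}"

lemma prob_bind_pmf:
  "measure_pmf.prob (bind_pmf p f) A = measure_pmf.expectation p (\<lambda>x. measure_pmf.prob (f x) A)"
proof -
  have "ennreal (measure_pmf.prob (bind_pmf p f) A) = (\<integral>\<^sup>+x. ennreal (measure_pmf.prob (f x) A) \<partial>p)"
    by (simp add: measure_pmf.emeasure_eq_measure[symmetric] emeasure_bind_pmf)
  also have "\<dots> = ennreal (measure_pmf.expectation p (\<lambda>x. measure_pmf.prob (f x) A))"
    by (intro nn_integral_eq_integral measure_pmf.integrable_const_bound[where B = 1]) auto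
  finally show ?thesis by (simp add: integral_nonneg_AE)
qed

lemma integrable_prob_pmf [simp]: "integrable (measure_pmf p) (\<lambda>x. measure_pmf.prob (f x) A)"
  by (intro measure_pmf.integrable_const_bound[where B = 1]) auto

lemma prob_bind_pmf_le:
  assumes "0 \<le> c" "\<And>x. x \<in> S \<Longrightarrow> measure_pmf.prob (f x) A \<le> c"
  shows "measure_pmf.prob (bind_pmf p f) A \<le> measure_pmf.prob p (- S) + c"
proof -
  have int: "integrable (measure_pmf p) (\<lambda>x. indicator (- S) x + c)"
    by (rule measure_pmf.integrable_const_bound[where B = "1 + \<bar>c\<bar>"]) (auto simp: indicator_def)
  have "measure_pmf.prob (bind_pmf p f) A \<le> measure_pmf.expectation p (\<lambda>x. indicator (- S) x + c)"
    unfolding prob_bind_pmf using assms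
    by (intro integral_mono integrable_prob_pmf int) (auto simp: indicator_def intro: add_increasing2)
  also have "\<dots> = measure_pmf.prob p (- S) + c"
  proof -
    have "integrable (measure_pmf p) (indicator (- S) :: _ \<Rightarrow> real)"
      by (rule integrable_real_indicator) (auto simp: measure_pmf.emeasure_eq_measure)
    then show ?thesis by (subst Bochner_Integration.integral_add) auto
  qed
  finally show ?thesis .
qed

lemma prob_bind_pmf_ge:
  assumes "\<And>x. x \<in> S \<Longrightarrow> c \<le> measure_pmf.prob (f x) A"
  shows "measure_pmf.prob p S * c \<le> measure_pmf.prob (bind_pmf p f) A"
proof -
  have int: "integrable (measure_pmf p) (\<lambda>x. indicator S x * c)"
    by (rule measure_pmf.integrable_const_bound[where B = "\<bar>c\<bar>"]) (auto simp: indicator_def)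
  have "measure_pmf.expectation p (\<lambda>x. indicator S x * c) \<le> measure_pmf.prob (bind_pmf p f) A"
    unfolding prob_bind_pmf using assms
    by (intro integral_mono integrable_prob_pmf int) (auto simp: indicator_def)
  then show ?thesis by simp
qed

lemma lds_tail_bounds [simp]: "0 \<le> lds_tail k R a" "lds_tail k R a \<le> 1"
  by (simp_all add: lds_tail_def)

lemma lds_tail_antimono: "a \<le> b \<Longrightarrow> lds_tail k R b \<le> lds_tail k R a"
  unfolding lds_tail_def by (intro measure_pmf.finite_measure_mono) auto

lemma lds_tail_mono:
  assumes "j \<le> k"
  shows "lds_tail j R a \<le> lds_tail k R a"
proof -
  have "lds_tail j R a = measure_pmf.prob (map_pmf (drop (k - j)) (replicate_pmf k (pmf_of_set {1..R})))
      {xs. a < real (lds xs)}"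
    using assms by (simp add: map_drop_replicate_pmf lds_tail_def)
  also have "\<dots> = measure_pmf.prob (replicate_pmf k (pmf_of_set {1..R})) {xs. a < real (lds (drop (k - j) xs))}"
    by (simp add: vimage_def)
  also have "\<dots> \<le> lds_tail k R a"
    unfolding lds_tail_def
  proof (intro measure_pmf.finite_measure_mono subsetI)
    fix xs assume "xs \<in> {xs. a < real (lds (drop (k - j) xs))}"
    moreover have "lds (drop (k - j) xs) \<le> lds xs"
      by (intro lds_mono suffix_imp_subseq suffix_drop)
    ultimately show "xs \<in> {xs. a < real (lds xs)}" by simp
  qed auto
  finally show ?thesis .
qed

lemma replicate_map_pmf: "replicate_pmf k (map_pmf f p) = map_pmf (map f) (replicate_pmf k p)"
  by (induction k) (simp_all add: map_pmf_def bind_assoc_pmf bind_return_pmf)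

lemma lds_tail_window:
  assumes "t < R"
  shows "measure_pmf.prob (replicate_pmf k (pmf_of_set {t<..R})) {xs. a < real (lds xs)} = lds_tail k (R - t) a"
proof -
  have "(+) t ` {1..R - t} = {t<..R}"
  proof (intro equalityI subsetI)
    fix x assume "x \<in> {t<..R}"
    then show "x \<in> (+) t ` {1..R - t}" by (intro image_eqI[of _ _ "x - t"]) auto
  qed auto
  then have "pmf_of_set {t<..R} = map_pmf ((+) t) (pmf_of_set {1..R - t})"
    using assms by (subst map_pmf_of_set_inj) auto
  then show ?thesis
    by (simp add: replicate_map_pmf lds_tail_def vimage_def lds_map)
qed

lemma prob_symbol_greater:
  assumes "s \<in> {0..1}" "t < R"
  shows "measure_pmf.prob (symbol s R) {x. t < x} = (1 - s) * real (R - t) / real R"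
proof -
  have "measure_pmf.prob (symbol s R) {x. t < x} = measure_pmf.prob (symbol s R) {t<..R}"
    using set_symbol[of R s] assms(2)
    by (intro measure_pmf.finite_measure_eq_AE) (auto simp: AE_measure_pmf_iff)
  also have "\<dots> = (\<Sum>x\<in>{t<..R}. (1 - s) / real R)"
  proof (subst measure_measure_pmf_finite, simp, rule sum.cong[OF refl])
    fix x assume "x \<in> {t<..R}"
    then show "pmf (symbol s R) x = (1 - s) / real R"
      using assms pmf_symbol_Suc[of s "x - 1" R] by auto
  qed
  finally show ?thesis by simp
qed

lemma cond_symbol:
  assumes "s \<in> {0..<1}" "t < R"
  shows "cond_pmf (symbol s R) {x. t < x} = pmf_of_set {t<..R}"
proof -
  have prob: "measure_pmf.prob (symbol s R) {x. t < x} = (1 - s) * real (R - t) / real R"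
    using assms by (intro prob_symbol_greater) auto
  then have "measure_pmf.prob (symbol s R) {x. t < x} \<noteq> 0"
    using assms by auto
  then have ne: "set_pmf (symbol s R) \<inter> {x. t < x} \<noteq> {}"
    using measure_pmf_zero_iff by blast
  show ?thesis
  proof (rule pmf_eqI)
    fix x
    have "pmf (symbol s R) x = (if x \<le> R then (1 - s) / real R else 0)" if "t < x"
      using assms that pmf_symbol_Suc[of s "x - 1" R] set_symbol[of R s] by (auto simp: pmf_eq_0_set_pmf)
    then show "pmf (cond_pmf (symbol s R) {x. t < x}) x = pmf (pmf_of_set {t<..R}) x"
      using assms unfolding pmf_cond[OF ne] prob by (auto simp: of_nat_diff)
  qed
qed

lemma filter_symbols:
  assumes "s \<in> {0<..<1}" "t < R"
  shows "map_pmf (filter (\<lambda>x. t < x)) (replicate_pmf k (symbol s R)) =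
    binomial_pmf k ((1 - s) * real (R - t) / real R) \<bind> (\<lambda>j. replicate_pmf j (pmf_of_set {t<..R}))"
proof -
  have "(1 - s) * (real (R - t) / real R) \<le> (1 - s) * 1"
    using assms by (intro mult_left_mono) auto
  also have "(1 - s) * 1 < 1" using assms by simp
  finally have "(1 - s) * real (R - t) / real R < 1" by simp
  moreover have "0 < (1 - s) * real (R - t) / real R" using assms by auto
  ultimately show ?thesis
    using assms prob_symbol_greater[of s t R] cond_symbol[of s t R]
    by (subst filter_replicate_pmf[where \<theta> = "(1 - s) * real (R - t) / real R"]) auto
qed

text \<open>Of the symbols above \<open>t\<close>, a binomial number occurs, and given that number they are uniform. Since the
  longest subsequence only grows with more symbols, a quantile \<open>m\<close> of the binomial law suffices.\<close>

lemma prob_lds_filter_le: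
  assumes "s \<in> {0<..<1}" "t < R"
  shows "measure_pmf.prob (replicate_pmf k (symbol s R)) {xs. a < real (lds (filter (\<lambda>x. t < x) xs))} \<le>
    measure_pmf.prob (binomial_pmf k ((1 - s) * real (R - t) / real R)) {j. m < j} + lds_tail m (R - t) a"
proof -
  have "measure_pmf.prob (replicate_pmf k (symbol s R)) {xs. a < real (lds (filter (\<lambda>x. t < x) xs))} =
      measure_pmf.prob (map_pmf (filter (\<lambda>x. t < x)) (replicate_pmf k (symbol s R))) {xs. a < real (lds xs)}"
    by (simp add: vimage_def)
  also have "\<dots> \<le> measure_pmf.prob (binomial_pmf k ((1 - s) * real (R - t) / real R)) (- {..m}) + lds_tail m (R - t) a"
    unfolding filter_symbols[OF assms]
    by (rule prob_bind_pmf_le) (auto simp: lds_tail_window[OF assms(2)] lds_tail_mono)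
  also have "- {..m} = {j. m < j}" by auto
  finally show ?thesis .
qed

lemma prob_lds_filter_le_tail:
  assumes "s \<in> {0<..<1}" "0 < R"
  shows "measure_pmf.prob (replicate_pmf k (symbol s R)) {xs. a < real (lds (filter (\<lambda>x. 0 < x) xs))} \<le> lds_tail k R a"
proof -
  have "set_pmf (binomial_pmf k (1 - s)) \<inter> {j. k < j} = {}"
    using assms by auto
  then show ?thesis
    using prob_lds_filter_le[of s 0 R k a k] assms by (simp add: measure_pmf_zero_iff[symmetric])
qed

lemma prob_lds_filter_ge:
  assumes "s \<in> {0<..<1}" "0 < R"
  shows "measure_pmf.prob (binomial_pmf k (1 - s)) {j. m \<le> j} * lds_tail m R a \<le>
    measure_pmf.prob (replicate_pmf k (symbol s R)) {xs. a < real (lds (filter (\<lambda>x. 0 < x) xs))}"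
proof -
  have "measure_pmf.prob (binomial_pmf k (1 - s)) {j. m \<le> j} * lds_tail m R a \<le>
      measure_pmf.prob (map_pmf (filter (\<lambda>x. 0 < x)) (replicate_pmf k (symbol s R))) {xs. a < real (lds xs)}"
    unfolding filter_symbols[OF assms] using assms lds_tail_window[OF assms(2)]
    by (simp, intro prob_bind_pmf_ge) (auto simp: lds_tail_mono)
  then show ?thesis by (simp add: vimage_def)
qed

text \<open>The solution \<open>\<rho>\<close> of the balance equation \<open>s * \<rho> = (1 - s) / R * (1 - \<rho>)\<close>. For large \<open>R\<close>, the
  number of particles is about \<open>(1 - s) / s\<close>.\<close>

definition particle_density :: "real \<Rightarrow> nat \<Rightarrow> real" where
  "particle_density s R = (1 - s) / (real R * s + 1 - s)"

lemma particle_density_balance: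
  assumes "s \<in> {0<..<1}" "0 < R"
  shows "particle_density s R \<in> {0..1}" "s * particle_density s R = (1 - s) / real R * (1 - particle_density s R)"
proof -
  have pos: "real R * s + 1 - s > 0" using assms by (simp add: add_pos_pos algebra_simps add_strict_increasing)
  then show "particle_density s R \<in> {0..1}" using assms by (auto simp: particle_density_def field_simps)
  have "1 - particle_density s R = real R * s / (real R * s + 1 - s)"
    using pos by (simp add: particle_density_def field_simps)
  then show "s * particle_density s R = (1 - s) / real R * (1 - particle_density s R)"
    using assms by (simp add: particle_density_def)
qed

definition stationary :: "real \<Rightarrow> nat \<Rightarrow> nat \<Rightarrow> (bool list \<times> nat list) pmf" where
  "stationary s R k = pair_pmf (bits R (particle_density s R)) (replicate_pmf k (symbol s R))"

lemma set_stationary: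
  assumes "(es, xs) \<in> set_pmf (stationary s R k)" "0 < R"
  shows "length es = R" "length xs = k" "set xs \<subseteq> {..R}"
  using assms set_symbol[of R s] by (auto simp: stationary_def set_replicate_pmf)

lemma count_upto_law:
  assumes "\<rho> \<in> {0..1}" "j \<le> R"
  shows "map_pmf (count_upto j) (bits R \<rho>) = binomial_pmf j \<rho>"
proof -
  have "map_pmf (count_upto j) (bits R \<rho>) = map_pmf (length \<circ> filter id) (map_pmf (take j) (bits R \<rho>))"
    by (auto simp: map_pmf_comp count_upto_def intro!: map_pmf_cong)
  then show ?thesis
    using assms by (simp add: map_take_replicate_pmf binomial_pmf_altdef)
qed

lemma stationary_count_law:
  assumes "s \<in> {0<..<1}" "0 < R" "j \<le> R"
  shows "map_pmf (\<lambda>(es, xs). count_upto j es) (stationary s R k) = binomial_pmf j (particle_density s R)"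
proof -
  have "map_pmf (\<lambda>(es, xs). count_upto j es) (stationary s R k) =
      map_pmf (count_upto j) (map_pmf fst (stationary s R k))"
    by (simp add: map_pmf_comp case_prod_unfold)
  then show ?thesis
    using assms particle_density_balance(1)[OF assms(1,2)] by (simp add: stationary_def map_fst_pair_pmf count_upto_law)
qed

lemma stationary_particles_law:
  assumes "s \<in> {0<..<1}" "0 < R"
  shows "map_pmf (\<lambda>(es, xs). count_upto R (foldr push xs es)) (stationary s R k) = binomial_pmf R (particle_density s R)"
proof -
  have "map_pmf (\<lambda>(es, xs). count_upto R (foldr push xs es)) (stationary s R k) =
      map_pmf (count_upto R) (bits R (particle_density s R) \<bind> (\<lambda>es. map_pmf (\<lambda>xs. foldr push xs es) (replicate_pmf k (symbol s R))))"
    by (simp add: stationary_def pair_pmf_def map_pmf_def bind_assoc_pmf bind_return_pmf)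
  then show ?thesis
    using assms particle_density_balance[OF assms] by (simp add: bits_stationary count_upto_law)
qed

lemma sources_law:
  assumes "s \<in> {0<..<1}" "0 < R"
  shows "map_pmf sources (replicate_pmf k (symbol s R)) = binomial_pmf k s"
proof -
  have "{x::nat. x = 0} = {0}" by auto
  then show ?thesis
    using assms pmf_symbol_0[of s R] unfolding sources_def
    by (intro length_filter_replicate_pmf) (auto simp: measure_pmf_single)
qed

lemma stationary_sources_law:
  assumes "s \<in> {0<..<1}" "0 < R"
  shows "map_pmf (\<lambda>(es, xs). sources (drop i xs)) (stationary s R k) = binomial_pmf (k - i) s"
proof -
  have "map_pmf (\<lambda>(es, xs). sources (drop i xs)) (stationary s R k) =
      map_pmf sources (map_pmf (drop i) (map_pmf snd (stationary s R k)))"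
    by (simp add: map_pmf_comp case_prod_unfold)
  then show ?thesis
    using sources_law[OF assms] by (simp add: stationary_def map_snd_pair_pmf map_drop_replicate_pmf)
qed

lemma prob_stationary_snd:
  "measure_pmf.prob (stationary s R k) {(es, xs). P xs} = measure_pmf.prob (replicate_pmf k (symbol s R)) {xs. P xs}"
proof -
  have "replicate_pmf k (symbol s R) = map_pmf snd (stationary s R k)"
    by (simp add: stationary_def map_snd_pair_pmf)
  then have "measure_pmf.prob (replicate_pmf k (symbol s R)) {xs. P xs} =
      measure_pmf.prob (map_pmf snd (stationary s R k)) {xs. P xs}"
    by simp
  then show ?thesis by (simp add: vimage_def case_prod_unfold)
qed

lemma prob_binomial_deviation:
  assumes "map_pmf X p = binomial_pmf n \<theta>" "\<theta> \<in> {0..1}" "a > 0"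
  shows "measure_pmf.prob p {\<omega>. a \<le> \<bar>real (X \<omega>) - real n * \<theta>\<bar>} \<le> real n * \<theta> / a\<^sup>2"
proof -
  have "measure_pmf.prob p {\<omega>. a \<le> \<bar>real (X \<omega>) - real n * \<theta>\<bar>} =
      measure_pmf.prob (map_pmf X p) {x. a \<le> \<bar>real x - real n * \<theta>\<bar>}"
    by (simp add: vimage_def)
  then show ?thesis using assms binomial_Chebyshev[of \<theta> a n] by simp
qed

text \<open>With the source probability \<open>1 / sqrt k\<close>, sources and particles both number about \<open>sqrt k\<close>, the choice
  that minimises their sum.\<close>

lemma stationary_mean_bounds:
  assumes "2 \<le> k" "0 < R"
  defines "s \<equiv> 1 / sqrt (real k)"
  shows "s \<in> {0<..<1}" "real k * s = sqrt (real k)"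
    and "real R * particle_density s R \<le> sqrt (real k)"
    and "k \<le> R \<Longrightarrow> sqrt (real k) - 2 \<le> real R * particle_density s R"
proof -
  have sq: "1 < sqrt (real k)" using assms(1) by (simp add: real_less_rsqrt)
  show s: "s \<in> {0<..<1}" using sq by (auto simp: s_def)
  show "real k * s = sqrt (real k)" using assms(1) by (simp add: s_def real_div_sqrt)
  have inv: "1 / s = sqrt (real k)" by (simp add: s_def)
  have Rs: "0 < real R * s" using s assms(2) by simp
  have "real R * particle_density s R \<le> real R * (1 / (real R * s))"
    unfolding particle_density_def using s Rs by (intro mult_left_mono frac_le) auto
  also have "\<dots> = 1 / s" using assms(2) by simp
  finally show "real R * particle_density s R \<le> sqrt (real k)" by (simp add: inv)
  show "sqrt (real k) - 2 \<le> real R * particle_density s R" if "k \<le> R"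
  proof -
    have pos: "0 < real R * s + 1 - s" using Rs s by auto
    have "1 \<le> real R * s\<^sup>2"
      using that assms(1) by (simp add: s_def power_divide)
    then have "1 / s \<le> real R * s" using s by (simp add: field_simps power2_eq_square)
    moreover have "(1 / s - 2) * (real R * s + 1 - s) \<le> real R * (1 - s) + (1 / s - real R * s)"
      using s by (simp add: field_simps power2_eq_square)
    ultimately have "(1 / s - 2) * (real R * s + 1 - s) \<le> real R * (1 - s)" by linarith
    then have "1 / s - 2 \<le> real R * (1 - s) / (real R * s + 1 - s)"
      using pos by (simp add: pos_le_divide_eq)
    then show ?thesis by (simp add: inv particle_density_def)
  qed
qed

lemma prob_sources_deviation:
  assumes "2 \<le> k" "0 < R" "0 < \<eta>"
  defines "s \<equiv> 1 / sqrt (real k)"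
  shows "measure_pmf.prob (stationary s R k)
    {(es, xs). \<eta> * sqrt (real k) \<le> \<bar>real (sources (drop i xs)) - real (k - i) * s\<bar>} \<le> 1 / (\<eta>\<^sup>2 * sqrt (real k))"
proof -
  note st = stationary_mean_bounds[OF assms(1,2), folded s_def]
  have "measure_pmf.prob (stationary s R k) {\<omega>. \<eta> * sqrt (real k) \<le>
      \<bar>real ((\<lambda>(es, xs). sources (drop i xs)) \<omega>) - real (k - i) * s\<bar>} \<le> real (k - i) * s / (\<eta> * sqrt (real k))\<^sup>2"
    using st(1) assms by (intro prob_binomial_deviation stationary_sources_law) auto
  also have "\<dots> \<le> sqrt (real k) / (\<eta> * sqrt (real k))\<^sup>2"
  proof (rule divide_right_mono)
    have "real (k - i) * s \<le> real k * s" using st(1) by (intro mult_right_mono) auto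
    then show "real (k - i) * s \<le> sqrt (real k)" using st(2) by simp
  qed simp
  also have "\<dots> = 1 / (\<eta>\<^sup>2 * sqrt (real k))"
    using assms by (simp add: power_mult_distrib power2_eq_square field_simps)
  finally show ?thesis by (simp add: case_prod_unfold)
qed

lemma prob_count_deviation:
  assumes "2 \<le> k" "0 < R" "0 < \<eta>" "j \<le> R"
  defines "s \<equiv> 1 / sqrt (real k)"
  assumes law: "map_pmf (\<lambda>(es, xs). X es xs) (stationary s R k) = binomial_pmf j (particle_density s R)"
  shows "measure_pmf.prob (stationary s R k)
    {(es, xs). \<eta> * sqrt (real k) \<le> \<bar>real (X es xs) - real j * particle_density s R\<bar>} \<le> 1 / (\<eta>\<^sup>2 * sqrt (real k))"
proof -
  note st = stationary_mean_bounds[OF assms(1,2), folded s_def]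
  have d: "particle_density s R \<in> {0..1}" using particle_density_balance(1) st(1) assms(2) by blast
  have "measure_pmf.prob (stationary s R k) {\<omega>. \<eta> * sqrt (real k) \<le>
      \<bar>real ((\<lambda>(es, xs). X es xs) \<omega>) - real j * particle_density s R\<bar>} \<le> real j * particle_density s R / (\<eta> * sqrt (real k))\<^sup>2"
    using d assms by (intro prob_binomial_deviation law) auto
  also have "\<dots> \<le> sqrt (real k) / (\<eta> * sqrt (real k))\<^sup>2"
  proof (rule divide_right_mono)
    have "real j * particle_density s R \<le> real R * particle_density s R" using d assms by (intro mult_right_mono) auto
    then show "real j * particle_density s R \<le> sqrt (real k)" using st(3) by simp
  qed simp
  also have "\<dots> = 1 / (\<eta>\<^sup>2 * sqrt (real k))"
    using assms by (simp add: power_mult_distrib power2_eq_square field_simps)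
  finally show ?thesis by (simp add: case_prod_unfold)
qed

lemma lds_filter_le_particles:
  assumes "length es = R" "set xs \<subseteq> {..R}"
  shows "lds (filter (\<lambda>x. 0 < x) xs) \<le> sources xs + count_upto R (foldr push xs es)"
proof -
  have "lds (filter (\<lambda>x. 0 < x) xs) = lds_between 0 xs R"
    unfolding lds_between_eq using assms(2)
    by (intro arg_cong[where f = lds] filter_cong) auto
  also have "\<dots> \<le> chain (\<lambda>j. count_upto j es) xs R" by (rule lds_between_le_chain)
  finally show ?thesis using assms by (simp add: chain_eq_particles)
qed

text \<open>Boundary points can only lengthen a chain. The chain value of the stationary process is the number of
  sources plus the number of particles, both of which concentrate at \<open>sqrt k\<close>.\<close>

lemma prob_lds_filter_large:
  assumes "2 \<le> k" "0 < R" "0 < \<eta>"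
  defines "s \<equiv> 1 / sqrt (real k)"
  shows "measure_pmf.prob (replicate_pmf k (symbol s R))
    {xs. (2 + 2 * \<eta>) * sqrt (real k) \<le> real (lds (filter (\<lambda>x. 0 < x) xs))} \<le> 2 / (\<eta>\<^sup>2 * sqrt (real k))"
proof -
  note st = stationary_mean_bounds[OF assms(1,2), folded s_def]
  define A where "A = {(es::bool list, xs). \<eta> * sqrt (real k) \<le> \<bar>real (sources (drop 0 xs)) - real (k - 0) * s\<bar>}"
  define B where "B = {(es, xs). \<eta> * sqrt (real k) \<le> \<bar>real (count_upto R (foldr push xs es)) - real R * particle_density s R\<bar>}"
  have "measure_pmf.prob (replicate_pmf k (symbol s R))
      {xs. (2 + 2 * \<eta>) * sqrt (real k) \<le> real (lds (filter (\<lambda>x. 0 < x) xs))} =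
      measure_pmf.prob (stationary s R k)
      {(es, xs). (2 + 2 * \<eta>) * sqrt (real k) \<le> real (lds (filter (\<lambda>x. 0 < x) xs))}"
    by (rule prob_stationary_snd[symmetric])
  also have "\<dots> \<le> measure_pmf.prob (stationary s R k) (A \<union> B)"
  proof (rule measure_pmf.finite_measure_mono_AE)
    show "AE \<omega> in stationary s R k. \<omega> \<in> {(es, xs). (2 + 2 * \<eta>) * sqrt (real k) \<le> real (lds (filter (\<lambda>x. 0 < x) xs))}
        \<longrightarrow> \<omega> \<in> A \<union> B"
      unfolding AE_measure_pmf_iff
    proof (safe)
      fix es xs
      assume supp: "(es, xs) \<in> set_pmf (stationary s R k)" and nB: "(es, xs) \<notin> B"
        and big: "(2 + 2 * \<eta>) * sqrt (real k) \<le> real (lds (filter (\<lambda>x. 0 < x) xs))"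
      have "real (lds (filter (\<lambda>x. 0 < x) xs)) \<le> real (sources xs) + real (count_upto R (foldr push xs es))"
        using lds_filter_le_particles[of es R xs] set_stationary[OF supp assms(2)]
        by (simp flip: of_nat_add)
      then show "(es, xs) \<in> A"
        using nB big st(2,3) by (simp add: A_def B_def algebra_simps abs_le_iff not_le abs_less_iff)
    qed
  qed simp
  also have "\<dots> \<le> measure_pmf.prob (stationary s R k) A + measure_pmf.prob (stationary s R k) B"
    by (rule measure_Un_le) auto
  also have "\<dots> \<le> 1 / (\<eta>\<^sup>2 * sqrt (real k)) + 1 / (\<eta>\<^sup>2 * sqrt (real k))"
    unfolding A_def B_def s_def using assms st(1)
    by (intro add_mono prob_sources_deviation prob_count_deviation stationary_particles_law) (auto simp: s_def)
  finally show ?thesis by (simp add: mult.commute)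
qed

text \<open>The sources occupy a negligible part of the sequence, so a uniform sequence of length \<open>m\<close> is
  embedded in the source-free part of a slightly longer one.\<close>

lemma lds_tail_le_stationary:
  assumes c: "0 < c" "c \<le> 1" and m: "24 / c\<^sup>2 \<le> real m" and "0 < R"
  shows "lds_tail m R ((2 + 6 * c) * sqrt (real m)) \<le> 4 / (c\<^sup>2 * sqrt (real m))"
proof -
  have c2: "c\<^sup>2 \<le> c" "c\<^sup>2 \<le> 1" using c by (simp_all add: power2_eq_square mult_left_le mult_le_one)
  have "24 \<le> real m * c\<^sup>2" using m c by (simp add: field_simps)
  also have "real m * c\<^sup>2 \<le> real m * c" using c2(1) by (intro mult_left_mono) auto
  finally have mc: "24 \<le> real m * c" .
  also have "real m * c \<le> real m * 1" using c by (intro mult_left_mono) auto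
  finally have m24: "24 \<le> real m" by simp
  \<comment> \<open>Among \<open>k\<close> symbols about \<open>sqrt k\<close> are sources, far fewer than the surplus \<open>c * m\<close>.\<close>
  define k where "k = m + nat \<lceil>c * real m\<rceil>"
  have k: "real m + c * real m \<le> real k" "real k \<le> real m + c * real m + 1"
    using c by (auto simp: k_def)
  have cm: "c * real m \<le> real m" using c m24 by (simp add: mult_left_le_one_le)
  have k3: "real k \<le> 3 * real m" using k(2) cm m24 by linarith
  have k2: "real k \<le> (1 + 2 * c) * real m" using k(2) mc by (simp add: algebra_simps)
  have kge: "2 \<le> k" "m \<le> k" using m24 k_def by auto
  define s where "s = 1 / sqrt (real k)"
  note st = stationary_mean_bounds[OF kge(1) assms(4), folded s_def]
  define a where "a = (2 + 6 * c) * sqrt (real m)"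
  have sqk: "sqrt (real k) \<le> (1 + c) * sqrt (real m)"
  proof -
    have "real k \<le> (1 + c)\<^sup>2 * real m"
      by (rule order_trans[OF k2]) (intro mult_right_mono, auto simp: power2_eq_square algebra_simps)
    then have "sqrt (real k) \<le> sqrt ((1 + c)\<^sup>2 * real m)" by (rule real_sqrt_le_mono)
    then show ?thesis using c by (simp add: real_sqrt_mult)
  qed
  have half: "1 / 2 \<le> measure_pmf.prob (binomial_pmf k (1 - s)) {j. m \<le> j}"
  proof -
    have "24 * real m \<le> (real m * c\<^sup>2) * real m"
      using \<open>24 \<le> real m * c\<^sup>2\<close> by (intro mult_right_mono) auto
    then have "sqrt (real k) \<le> sqrt ((c * real m / 2)\<^sup>2)"
      using k3 by (intro real_sqrt_le_mono) (simp add: power2_eq_square algebra_simps)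
    then have sq: "sqrt (real k) \<le> c * real m / 2" using c by simp
    have "measure_pmf.prob (binomial_pmf k (1 - s)) (- {j. m \<le> j}) \<le>
        measure_pmf.prob (binomial_pmf k (1 - s)) {x. c * real m / 2 \<le> \<bar>real x - real k * (1 - s)\<bar>}"
    proof (intro measure_pmf.finite_measure_mono subsetI)
      fix j assume "j \<in> - {j. m \<le> j}"
      then have "real j \<le> real m" by simp
      then show "j \<in> {x. c * real m / 2 \<le> \<bar>real x - real k * (1 - s)\<bar>}"
        using st(2) sq k(1) abs_ge_minus_self[of "real j - real k * (1 - s)"]
        by (simp only: mem_Collect_eq right_diff_distrib)
    qed simp
    also have "\<dots> \<le> real k * (1 - s) / (c * real m / 2)\<^sup>2"
      using st(1) c m24 by (intro binomial_Chebyshev) auto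
    also have "\<dots> \<le> (3 * real m) / (c * real m / 2)\<^sup>2"
    proof (rule divide_right_mono)
      have "real k * (1 - s) \<le> real k * 1" using st(1) by (intro mult_left_mono) auto
      then show "real k * (1 - s) \<le> 3 * real m" using k3 by simp
    qed simp
    also have "\<dots> \<le> 1 / 2"
      using \<open>24 \<le> real m * c\<^sup>2\<close> m24 c by (simp add: field_simps power2_eq_square)
    finally show ?thesis
      using measure_pmf.prob_compl[of "{j. m \<le> j}" "binomial_pmf k (1 - s)"]
      by (simp add: Compl_eq_Diff_UNIV)
  qed
  have "1 / 2 * lds_tail m R a \<le> measure_pmf.prob (binomial_pmf k (1 - s)) {j. m \<le> j} * lds_tail m R a"
    using half by (intro mult_right_mono) auto
  also have "\<dots> \<le> measure_pmf.prob (replicate_pmf k (symbol s R)) {xs. a < real (lds (filter (\<lambda>x. 0 < x) xs))}"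
    by (rule prob_lds_filter_ge[OF st(1) assms(4)])
  also have "\<dots> \<le> measure_pmf.prob (replicate_pmf k (symbol s R))
      {xs. (2 + 2 * c) * sqrt (real k) \<le> real (lds (filter (\<lambda>x. 0 < x) xs))}"
  proof (intro measure_pmf.finite_measure_mono subsetI)
    fix xs assume "xs \<in> {xs. a < real (lds (filter (\<lambda>x. 0 < x) xs))}"
    moreover have "(2 + 2 * c) * sqrt (real k) \<le> (2 + 2 * c) * ((1 + c) * sqrt (real m))"
      using sqk c by (intro mult_left_mono) auto
    moreover have "(2 + 2 * c) * ((1 + c) * sqrt (real m)) = (2 + 4 * c + 2 * c\<^sup>2) * sqrt (real m)"
      by (simp add: algebra_simps power2_eq_square)
    moreover have "\<dots> \<le> a" unfolding a_def using c2(1) by (intro mult_right_mono) auto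
    ultimately show "xs \<in> {xs. (2 + 2 * c) * sqrt (real k) \<le> real (lds (filter (\<lambda>x. 0 < x) xs))}" by simp
  qed simp
  also have "\<dots> \<le> 2 / (c\<^sup>2 * sqrt (real k))"
    unfolding s_def by (rule prob_lds_filter_large[OF kge(1) assms(4) c(1)])
  also have "\<dots> \<le> 2 / (c\<^sup>2 * sqrt (real m))"
    using c m24 kge(2) by (intro divide_left_mono mult_left_mono) auto
  finally show ?thesis by (simp add: a_def)
qed

lemma eventually_ge_real: "\<forall>\<^sub>F k in sequentially. a \<le> real k"
  using filterlim_real_sequentially by (simp add: filterlim_at_top)

lemma eventually_ge_sqrt: "\<forall>\<^sub>F k in sequentially. a \<le> sqrt (real k)"
  using filterlim_compose[OF sqrt_at_top filterlim_real_sequentially] by (simp add: filterlim_at_top)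

text \<open>One half of the law \<open>2 * sqrt m\<close> for uniform sequences. It is uniform in \<open>R\<close>, as ties only help.\<close>

proposition lds_uniform_upper:
  assumes "0 < \<epsilon>" "0 < \<delta>"
  shows "\<forall>\<^sub>F m in sequentially. \<forall>R>0. lds_tail m R ((2 + \<epsilon>) * sqrt (real m)) \<le> \<delta>"
proof -
  define c where "c = min 1 (\<epsilon> / 6)"
  have c: "0 < c" "c \<le> 1" "6 * c \<le> \<epsilon>" using assms by (auto simp: c_def)
  show ?thesis
    using eventually_ge_real[of "24 / c\<^sup>2"] eventually_ge_sqrt[of "4 / (c\<^sup>2 * \<delta>)"]
  proof eventually_elim
    case (elim m)
    show ?case
    proof (intro allI impI)
      fix R :: nat assume "0 < R"
      have "0 < 24 / c\<^sup>2" using c by simp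
      then have m: "0 < real m" using elim(1) by linarith
      have "lds_tail m R ((2 + \<epsilon>) * sqrt (real m)) \<le> lds_tail m R ((2 + 6 * c) * sqrt (real m))"
        using c by (intro lds_tail_antimono mult_right_mono) auto
      also have "\<dots> \<le> 4 / (c\<^sup>2 * sqrt (real m))"
        using c elim \<open>0 < R\<close> by (intro lds_tail_le_stationary) auto
      also have "\<dots> \<le> \<delta>"
        using elim(2) c m assms by (simp add: field_simps)
      finally show "lds_tail m R ((2 + \<epsilon>) * sqrt (real m)) \<le> \<delta>" .
    qed
  qed
qed

section \<open>Where long chains leave the boundary\<close>

text \<open>A chain that follows a boundary for a fraction \<open>z\<close> of its length and then leaves it reaches
  at most about \<open>z + 2 * sqrt (1 - z)\<close> in units of \<open>sqrt k\<close>. The only maximum is at \<open>z = 0\<close>.\<close>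

lemma exit_profile:
  assumes "0 \<le> z" "z \<le> (1::real)"
  shows "z + 2 * sqrt (1 - z) \<le> 2 - z\<^sup>2 / 4"
proof -
  have "z\<^sup>2 \<le> 1" using assms by (simp add: power_le_one)
  then have "0 \<le> 1 - z / 2 - z\<^sup>2 / 8" using assms by simp
  moreover have "(1 - z / 2 - z\<^sup>2 / 8)\<^sup>2 = 1 - z + z ^ 3 / 8 + z ^ 4 / 64"
    by (simp add: power2_eq_square power3_eq_cube power4_eq_xxxx algebra_simps)
  then have "1 - z \<le> (1 - z / 2 - z\<^sup>2 / 8)\<^sup>2" using assms by simp
  ultimately have "sqrt (1 - z) \<le> 1 - z / 2 - z\<^sup>2 / 8" by (rule real_le_lsqrt)
  then show ?thesis by simp
qed

text \<open>Rounds an exit point to a grid of \<open>K\<close> blocks, so that finitely many events control all exit points.\<close>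

lemma block_exists:
  fixes f :: "nat \<Rightarrow> nat"
  assumes "f 0 = 0" "0 < K" "e \<le> f K"
  shows "\<exists>a<K. f a \<le> e \<and> e \<le> f (Suc a)"
  using assms(2,3)
proof (induction K)
  case (Suc K)
  show ?case
  proof (cases "0 < K \<and> e \<le> f K")
    case True
    then show ?thesis using Suc.IH less_Suc_eq by blast
  next
    case False
    then show ?thesis using Suc.prems assms(1) by (intro exI[of _ K]) auto
  qed
qed simp

text \<open>Here \<open>p\<close> is what a chain collects along a boundary and \<open>l\<close> what it collects afterwards, in a situation
  where both obey their typical upper bounds with error \<open>\<eta>\<close> and \<open>d\<close> is the mesh of the grid. A chain
  of nearly maximal value then has \<open>z\<^sup>2 < 24 * \<eta>\<close>, which the choice of \<open>\<eta>\<close> turns into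
  \<open>z < \<epsilon> / 2\<close>, so almost all of it is collected after leaving the boundary.\<close>

lemma early_exit:
  fixes L l l' p z :: real
  assumes \<epsilon>: "0 < \<epsilon>" "\<epsilon> \<le> 1" and \<eta>: "\<eta> = \<epsilon>\<^sup>2 / 100" and "0 < L" and z: "0 \<le> z" "z \<le> 1" and d: "d \<le> \<eta>"
    and V: "(2 - 3 * \<eta>) * L < p + l" and p: "p < (z + d + \<eta>) * L"
    and l: "l \<le> (2 * sqrt (1 - z) + \<eta>) * L" "l \<le> l'"
  shows "(2 - \<epsilon>) * L < l'"
proof -
  have "(2 - 3 * \<eta>) * L < (z + d + \<eta> + (2 * sqrt (1 - z) + \<eta>)) * L"
    using V p l(1) by (simp add: algebra_simps)
  then have "2 - 3 * \<eta> < z + d + \<eta> + (2 * sqrt (1 - z) + \<eta>)"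
    using \<open>0 < L\<close> by simp
  then have "z\<^sup>2 < 24 * \<eta>" using exit_profile[OF z] d by simp
  also have "24 * \<eta> \<le> (\<epsilon> / 2)\<^sup>2" by (simp add: \<eta> power2_eq_square)
  finally have "z < \<epsilon> / 2" using \<epsilon> by (intro power_less_imp_less_base[of z 2]) auto
  moreover have "5 * \<eta> \<le> \<epsilon> / 20" using \<epsilon> by (simp add: \<eta> power2_eq_square mult_left_le)
  ultimately have "2 - \<epsilon> \<le> 2 - 3 * \<eta> - (z + d + \<eta>)" using d \<epsilon> by linarith
  then have "(2 - \<epsilon>) * L \<le> (2 - 3 * \<eta> - (z + d + \<eta>)) * L"
    using \<open>0 < L\<close> by (intro mult_right_mono) auto
  also have "\<dots> < l" using V p by (simp add: algebra_simps)
  finally show ?thesis using l(2) by simp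
qed

lemma sources_drop_le: "i \<le> j \<Longrightarrow> sources (drop j xs) \<le> sources (drop i xs)"
proof -
  assume "i \<le> j"
  have "sources ys = sources (take n ys) + sources (drop n ys)" for n ys
    unfolding sources_def by (metis append_take_drop_id filter_append length_append)
  from this[of "drop i xs" "j - i"] \<open>i \<le> j\<close> show ?thesis by simp
qed

lemma lds_filter_mono:
  "t' \<le> t \<Longrightarrow> subseq xs ys \<Longrightarrow> lds (filter (\<lambda>x. t < x) xs) \<le> lds (filter (\<lambda>x. t' < x) ys)"
proof -
  assume a: "t' \<le> t" "subseq xs ys"
  have "filter (\<lambda>x. t < x) xs = filter (\<lambda>x. t < x) (filter (\<lambda>x. t' < x) xs)"
    using a(1) by (auto simp: filter_filter intro!: filter_cong)
  then have "subseq (filter (\<lambda>x. t < x) xs) (filter (\<lambda>x. t' < x) ys)"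
    using subseq_order.order_trans[OF subseq_filter_left subseq_filter[OF a(2)]] by metis
  then show ?thesis by (rule lds_mono)
qed

lemma lds_between_le_filter: "lds_between t xs j \<le> lds (filter (\<lambda>x. t < x) xs)"
proof -
  have "filter (\<lambda>x. t < x \<and> x \<le> j) xs = filter (\<lambda>x. x \<le> j) (filter (\<lambda>x. t < x) xs)"
    by (auto simp: filter_filter intro!: filter_cong)
  then show ?thesis
    unfolding lds_between_eq using lds_mono[OF subseq_filter_left] by metis
qed

text \<open>The deterministic core of the lower bound. The hypotheses on \<open>V\<close>, sources, boundary counts and partial
  subsequences are the typical events. The sources of block \<open>a\<close> are counted up to the end of the block and
  the subsequences after leaving are measured from its beginning, which covers every exit point in the block.\<close>

lemma long_subsequence_of_long_chain:
  fixes L :: real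
  assumes \<epsilon>: "0 < \<epsilon>" "\<epsilon> \<le> 1" and \<eta>: "\<eta> = \<epsilon>\<^sup>2 / 100" and L: "0 < L"
    and K: "0 < K" "1 / real K \<le> \<eta>"
    and len: "length es = R" "length xs = k" "set xs \<subseteq> {..R}"
    and V: "(2 - 3 * \<eta>) * L < real (sources xs + count_upto R (foldr push xs es))"
    and S: "\<And>a. a < K \<Longrightarrow> real (sources (drop (k - Suc a * k div K) xs)) < (real (Suc a) / real K + \<eta>) * L"
    and C: "\<And>a. a < K \<Longrightarrow> real (count_upto (Suc a * R div K) es) < (real (Suc a) / real K + \<eta>) * L"
    and T: "\<And>a. a < K \<Longrightarrow> real (lds (filter (\<lambda>x. 0 < x) (take (k - a * k div K) xs)))
      \<le> (2 * sqrt (1 - real a / real K) + \<eta>) * L"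
    and W: "\<And>a. a < K \<Longrightarrow> real (lds (filter (\<lambda>x. a * R div K < x) xs))
      \<le> (2 * sqrt (1 - real a / real K) + \<eta>) * L"
  shows "(2 - \<epsilon>) * L < real (lds (filter (\<lambda>x. 0 < x) xs))"
proof -
  define f where "f = (\<lambda>j. count_upto j es)"
  have chain: "sources xs + count_upto R (foldr push xs es) = chain f xs R"
    using len chain_eq_particles[of xs es R] by (simp add: f_def)
  have z: "0 \<le> real a / real K" "real a / real K \<le> 1" if "a < K" for a using that by auto
  have Suc_a: "real (Suc a) / real K = real a / real K + 1 / real K" for a
    by (simp add: add_divide_distrib)
  have "f 0 = 0" by (simp add: f_def)
  from chain_exit[of f xs R, OF this] show ?thesis
  proof (elim disjE exE conjE)
    fix i assume i: "i \<le> length xs" "chain f xs R \<le> sources (drop i xs) + lds_between 0 (take i xs) R"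
    have "\<exists>a<K. a * k div K \<le> k - i \<and> k - i \<le> Suc a * k div K"
      using K(1) by (intro block_exists[of "\<lambda>a. a * k div K"]) auto
    then obtain a where a: "a < K" "a * k div K \<le> k - i" "k - i \<le> Suc a * k div K" by blast
    define p where "p = sources (drop (k - Suc a * k div K) xs)"
    define l where "l = lds_between 0 (take i xs) R"
    have "k - Suc a * k div K \<le> i" using a(3) by linarith
    then have "chain f xs R \<le> p + l"
      using i(2) sources_drop_le[of "k - Suc a * k div K" i xs] unfolding p_def l_def by linarith
    then have 1: "(2 - 3 * \<eta>) * L < real p + real l"
      using V unfolding chain by (simp flip: of_nat_add)
    have "i \<le> k - a * k div K" using a(2) i(1) len by linarith
    then have "subseq (take i xs) (take (k - a * k div K) xs)"
      by (intro prefix_imp_subseq) (metis min.absorb1 take_is_prefix take_take)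
    then have "l \<le> lds (filter (\<lambda>x. 0 < x) (take (k - a * k div K) xs))"
      unfolding l_def by (intro order_trans[OF lds_between_le_filter] lds_filter_mono) auto
    then have 2: "real l \<le> (2 * sqrt (1 - real a / real K) + \<eta>) * L"
      using T[OF a(1)] by linarith
    have "subseq (take i xs) xs" by (intro prefix_imp_subseq take_is_prefix)
    then have 3: "l \<le> lds (filter (\<lambda>x. 0 < x) xs)"
      unfolding l_def by (intro order_trans[OF lds_between_le_filter] lds_filter_mono) auto
    show ?thesis
      using early_exit[OF \<epsilon> \<eta> L z[OF a(1)] K(2) 1 _ 2] S[OF a(1)] 3 unfolding p_def Suc_a by simp
  next
    fix t assume t: "t \<le> R" "chain f xs R \<le> f t + lds_between t xs R"
    have "\<exists>a<K. a * R div K \<le> t \<and> t \<le> Suc a * R div K"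
      using K(1) t(1) by (intro block_exists[of "\<lambda>a. a * R div K"]) auto
    then obtain a where a: "a < K" "a * R div K \<le> t" "t \<le> Suc a * R div K" by blast
    define p where "p = count_upto (Suc a * R div K) es"
    define l where "l = lds_between t xs R"
    have "chain f xs R \<le> p + l"
      using t(2) count_upto_mono[OF a(3), of es] by (simp add: p_def l_def f_def)
    then have 1: "(2 - 3 * \<eta>) * L < real p + real l"
      using V unfolding chain by (simp flip: of_nat_add)
    have "l \<le> lds (filter (\<lambda>x. a * R div K < x) xs)"
      unfolding l_def by (intro order_trans[OF lds_between_le_filter] lds_filter_mono a(2)) auto
    then have 2: "real l \<le> (2 * sqrt (1 - real a / real K) + \<eta>) * L"
      using W[OF a(1)] by linarith
    have 3: "l \<le> lds (filter (\<lambda>x. 0 < x) xs)"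
      unfolding l_def by (intro order_trans[OF lds_between_le_filter] lds_filter_mono) auto
    show ?thesis
      using early_exit[OF \<epsilon> \<eta> L z[OF a(1)] K(2) 1 _ 2] C[OF a(1)] 3 unfolding p_def Suc_a by simp
  qed
qed

text \<open>The upper bound for uniform sequences, applied to the part of the square that remains after the exit: it
  holds about \<open>(1 - z) * k\<close> points, and the slack \<open>\<eta>\<^sup>2 / 128\<close> absorbs rounding and random fluctuation.\<close>

lemma segment_tail:
  assumes \<eta>: "0 < \<eta>" "\<eta> \<le> 1" and z: "0 \<le> z" "z \<le> 1" and "0 < \<delta>"
  shows "\<forall>\<^sub>F k in sequentially. \<forall>R>0.
    lds_tail (nat \<lceil>(1 - z + \<eta>\<^sup>2 / 128) * real k\<rceil>) R ((2 * sqrt (1 - z) + \<eta>) * sqrt (real k)) \<le> \<delta>"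
proof -
  define y where "y = 1 - z + \<eta>\<^sup>2 / 128"
  have y: "0 < y" using z \<eta> by (simp add: y_def add_nonneg_pos)
  have "filterlim (\<lambda>k. nat \<lceil>y * real k\<rceil>) at_top sequentially"
    unfolding filterlim_at_top
  proof
    fix m :: nat
    show "\<forall>\<^sub>F k in sequentially. m \<le> nat \<lceil>y * real k\<rceil>"
      using eventually_ge_real[of "real m / y"]
    proof eventually_elim
      case (elim k)
      then have "real m \<le> y * real k" using y by (simp add: field_simps)
      then show ?case by linarith
    qed
  qed
  moreover have "\<forall>\<^sub>F m in sequentially. \<forall>R>0. lds_tail m R ((2 + \<eta> / 4) * sqrt (real m)) \<le> \<delta>"
    using \<eta> \<open>0 < \<delta>\<close> by (intro lds_uniform_upper) auto
  ultimately have "\<forall>\<^sub>F k in sequentially. \<forall>R>0.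
      lds_tail (nat \<lceil>y * real k\<rceil>) R ((2 + \<eta> / 4) * sqrt (real (nat \<lceil>y * real k\<rceil>))) \<le> \<delta>"
    by (rule eventually_compose_filterlim[rotated])
  then show ?thesis
    using eventually_ge_real[of "128 / \<eta>\<^sup>2"]
  proof eventually_elim
    case (elim k)
    define m where "m = nat \<lceil>y * real k\<rceil>"
    have k1: "1 \<le> real k * (\<eta>\<^sup>2 / 128)" using elim(2) \<eta> by (simp add: field_simps)
    have "real m \<le> y * real k + 1" using y by (simp add: m_def) 
    also have "\<dots> \<le> (1 - z + (\<eta> / 8)\<^sup>2) * real k" using k1 by (simp add: y_def power2_eq_square algebra_simps)
    finally have "sqrt (real m) \<le> sqrt (1 - z + (\<eta> / 8)\<^sup>2) * sqrt (real k)"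
      by (simp flip: real_sqrt_mult)
    also have "\<dots> \<le> (sqrt (1 - z) + \<eta> / 8) * sqrt (real k)"
      using sqrt_add_le_add_sqrt[of "1 - z" "(\<eta> / 8)\<^sup>2"] z \<eta> by (intro mult_right_mono) auto
    finally have "(2 + \<eta> / 4) * sqrt (real m) \<le> (2 + \<eta> / 4) * ((sqrt (1 - z) + \<eta> / 8) * sqrt (real k))"
      using \<eta> by (intro mult_left_mono) auto
    also have "\<dots> = (2 * sqrt (1 - z) + (\<eta> / 4 + \<eta> / 4 * sqrt (1 - z) + \<eta> * \<eta> / 32)) * sqrt (real k)"
      by (simp add: algebra_simps)
    also have "\<dots> \<le> (2 * sqrt (1 - z) + \<eta>) * sqrt (real k)"
    proof -
      have "\<eta> / 4 * sqrt (1 - z) \<le> \<eta> / 4 * 1" using z \<eta> by (intro mult_left_mono) auto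
      moreover have "\<eta> * \<eta> \<le> \<eta> * 1" using \<eta> by (intro mult_left_mono) auto
      ultimately have "\<eta> / 4 + \<eta> / 4 * sqrt (1 - z) + \<eta> * \<eta> / 32 \<le> \<eta>" using \<eta> by linarith
      then show ?thesis by (intro mult_right_mono) auto
    qed
    finally have "lds_tail m R ((2 * sqrt (1 - z) + \<eta>) * sqrt (real k)) \<le> lds_tail m R ((2 + \<eta> / 4) * sqrt (real m))" for R
      by (rule lds_tail_antimono)
    then show ?case using elim(1) unfolding m_def y_def using order_trans by blast
  qed
qed

lemma real_div_nat_ge: "real n / real d - 1 \<le> real (n div d)"
proof -
  have "real (n div d) = of_int \<lfloor>real n / real d\<rfloor>" by (simp add: floor_divide_of_nat_eq)
  then show ?thesis by linarith
qed

lemma real_mult_div_nat_le: "real (a * n div d) \<le> real a / real d * real n"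
  using of_nat_div_le_of_nat[where ?'a = real, of "a * n" d] by simp

text \<open>Exit from the boundary of sites: the remaining symbols lie above the exit height.\<close>

lemma prob_window_large:
  assumes k: "2 \<le> k" and R: "256 / \<eta>\<^sup>2 \<le> real R" and \<eta>: "0 < \<eta>" "\<eta> \<le> 1" and a: "a < K"
  defines "s \<equiv> 1 / sqrt (real k)" and "z \<equiv> real a / real K"
  shows "measure_pmf.prob (replicate_pmf k (symbol s R)) {xs. b < real (lds (filter (\<lambda>x. a * R div K < x) xs))} \<le>
    65536 / (\<eta> ^ 4 * real k) + lds_tail (nat \<lceil>(1 - z + \<eta>\<^sup>2 / 128) * real k\<rceil>) (R - a * R div K) b"
proof -
  define m where "m = nat \<lceil>(1 - z + \<eta>\<^sup>2 / 128) * real k\<rceil>"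
  define t where "t = a * R div K"
  define \<theta> where "\<theta> = (1 - s) * real (R - t) / real R"
  have "0 < 256 / \<eta>\<^sup>2" using \<eta> by simp
  then have R0: "0 < R" using R by (cases R) auto
  note st = stationary_mean_bounds[OF k R0, folded s_def]
  have K0: "0 < K" using a by simp
  have "a * R < K * R" using a R0 by simp
  then have t: "t < R" unfolding t_def using K0 by (simp add: div_less_iff_less_mult mult.commute)
  have t_ge: "z * real R - 1 \<le> real t"
  proof -
    have "real (a * R) / real K - 1 \<le> real (a * R div K)"
      by (rule real_div_nat_ge)
    then show ?thesis by (simp add: t_def z_def)
  qed
  have \<theta>: "0 \<le> \<theta>" "\<theta> \<le> 1 - z + \<eta>\<^sup>2 / 256"
  proof -
    show "0 \<le> \<theta>" using st(1) by (simp add: \<theta>_def)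
    have "\<theta> = (1 - s) * (real (R - t) / real R)" by (simp add: \<theta>_def)
    also have "\<dots> \<le> 1 * (real (R - t) / real R)" using st(1) by (intro mult_right_mono) auto
    also have "\<dots> \<le> (real R - (z * real R - 1)) / real R"
      using t t_ge by (simp add: divide_right_mono)
    also have "\<dots> = 1 - z + 1 / real R" using R0 by (simp add: field_simps)
    also have "1 / real R \<le> \<eta>\<^sup>2 / 256" using R R0 \<eta> by (simp add: field_simps)
    finally show "\<theta> \<le> 1 - z + \<eta>\<^sup>2 / 256" by simp
  qed
  have \<theta>1: "\<theta> \<le> 1"
  proof -
    have "(1 - s) * (real (R - t) / real R) \<le> 1 * 1" using st(1) R0 by (intro mult_mono) auto
    then show ?thesis by (simp add: \<theta>_def)
  qed
  have "measure_pmf.prob (binomial_pmf k \<theta>) {j. m < j} \<le>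
      measure_pmf.prob (binomial_pmf k \<theta>) {j. \<eta>\<^sup>2 / 256 * real k \<le> \<bar>real j - real k * \<theta>\<bar>}"
  proof (intro measure_pmf.finite_measure_mono subsetI)
    fix j assume "j \<in> {j. m < j}"
    then have "(1 - z + \<eta>\<^sup>2 / 128) * real k \<le> real j" unfolding m_def by simp linarith
    moreover have "real k * \<theta> \<le> real k * (1 - z + \<eta>\<^sup>2 / 256)" using \<theta>(2) by (intro mult_left_mono) auto
    moreover have "(1 - z + \<eta>\<^sup>2 / 128) * real k - real k * (1 - z + \<eta>\<^sup>2 / 256) = \<eta>\<^sup>2 / 256 * real k"
      by (simp add: algebra_simps)
    ultimately have "\<eta>\<^sup>2 / 256 * real k \<le> real j - real k * \<theta>" by linarith
    then show "j \<in> {j. \<eta>\<^sup>2 / 256 * real k \<le> \<bar>real j - real k * \<theta>\<bar>}"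
      using abs_ge_self order_trans by blast
  qed simp
  also have "\<dots> \<le> real k * \<theta> / (\<eta>\<^sup>2 / 256 * real k)\<^sup>2"
    using \<theta>(1) \<theta>1 \<eta> k by (intro binomial_Chebyshev) auto
  also have "\<dots> \<le> real k * 1 / (\<eta>\<^sup>2 / 256 * real k)\<^sup>2"
    using \<theta>1 by (intro divide_right_mono mult_left_mono) auto
  also have "\<dots> = 65536 / (\<eta> ^ 4 * real k)"
    using k \<eta> by (simp add: field_simps power2_eq_square power4_eq_xxxx)
  finally show ?thesis
    using prob_lds_filter_le[OF st(1) t, of k b m] by (simp add: \<theta>_def m_def t_def)
qed

text \<open>Exit from the boundary of sources: the remaining symbols are the latest ones.\<close>

lemma prob_segment_large:
  assumes k: "2 \<le> k" "128 / \<eta>\<^sup>2 \<le> real k" and "0 < R" and \<eta>: "0 < \<eta>" and a: "a < K"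
  defines "s \<equiv> 1 / sqrt (real k)" and "z \<equiv> real a / real K"
  shows "measure_pmf.prob (replicate_pmf k (symbol s R))
      {xs. b < real (lds (filter (\<lambda>x. 0 < x) (take (k - a * k div K) xs)))} \<le>
    lds_tail (nat \<lceil>(1 - z + \<eta>\<^sup>2 / 128) * real k\<rceil>) R b"
proof -
  define n where "n = k - a * k div K"
  note st = stationary_mean_bounds[OF k(1) assms(3), folded s_def]
  have n_le: "real n \<le> (1 - z + \<eta>\<^sup>2 / 128) * real k"
  proof -
    have "real (a * k) / real K - 1 \<le> real (a * k div K)"
      by (rule real_div_nat_ge)
    moreover have "a * k div K \<le> k"
    proof -
      have "a * k \<le> K * k" using a by simp
      then show ?thesis using a by (metis div_le_mono nonzero_mult_div_cancel_left not_less0)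
    qed
    ultimately have "real n \<le> real k - real (a * k) / real K + 1" by (simp add: n_def of_nat_diff)
    also have "\<dots> = (1 - z) * real k + 1" by (simp add: z_def algebra_simps)
    also have "\<dots> \<le> (1 - z) * real k + \<eta>\<^sup>2 / 128 * real k" using k(2) \<eta> by (simp add: field_simps)
    finally show ?thesis by (simp add: algebra_simps)
  qed
  then have n_le': "n \<le> nat \<lceil>(1 - z + \<eta>\<^sup>2 / 128) * real k\<rceil>" by linarith
  have "measure_pmf.prob (replicate_pmf k (symbol s R)) {xs. b < real (lds (filter (\<lambda>x. 0 < x) (take n xs)))} =
      measure_pmf.prob (map_pmf (take n) (replicate_pmf k (symbol s R))) {xs. b < real (lds (filter (\<lambda>x. 0 < x) xs))}"
    by (simp add: vimage_def)
  also have "\<dots> \<le> lds_tail n R b"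
    using prob_lds_filter_le_tail[OF st(1) assms(3)] by (simp add: map_take_replicate_pmf n_def del: measure_map_pmf)
  also have "\<dots> \<le> lds_tail (nat \<lceil>(1 - z + \<eta>\<^sup>2 / 128) * real k\<rceil>) R b"
    by (rule lds_tail_mono[OF n_le'])
  finally show ?thesis by (simp add: n_def)
qed

text \<open>The nested quantifiers reflect that the number \<open>R\<close> of values must be large in terms of \<open>k\<close>; otherwise ties
  would shorten the increasing subsequences.\<close>

proposition lds_uniform_lower:
  assumes "0 < \<epsilon>" "\<epsilon> \<le> 1"
  shows "\<forall>\<^sub>F k in sequentially. \<forall>\<^sub>F R in sequentially. 1 - \<epsilon> \<le> lds_tail k R ((2 - \<epsilon>) * sqrt (real k))"
proof -
  define \<eta> where "\<eta> = \<epsilon>\<^sup>2 / 100"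
  have \<eta>: "0 < \<eta>" "\<eta> \<le> 1" using assms power_le_one[of \<epsilon> 2] by (auto simp: \<eta>_def)
  define K where "K = nat \<lceil>1 / \<eta>\<rceil>"
  have K: "0 < K" "1 / real K \<le> \<eta>"
  proof -
    have "1 / \<eta> \<le> real K" by (simp add: K_def real_nat_ceiling_ge)
    moreover have "0 < 1 / \<eta>" using \<eta> by simp
    ultimately have "0 < real K" by linarith
    then show "0 < K" by simp
    then show "1 / real K \<le> \<eta>" using \<open>1 / \<eta> \<le> real K\<close> \<eta> by (simp add: field_simps)
  qed
  \<comment> \<open>The exceptional events cost \<open>5 * \<delta>\<close> per block and \<open>2 * \<delta>\<close> for the chain value.\<close>
  define \<delta> where "\<delta> = \<epsilon> / (8 * real K)"
  have \<delta>: "0 < \<delta>" using assms K by (simp add: \<delta>_def)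
  define thr where "thr = (\<lambda>a k. (2 * sqrt (1 - real a / real K) + \<eta>) * sqrt (real k))"
  define len where "len = (\<lambda>a k. nat \<lceil>(1 - real a / real K + \<eta>\<^sup>2 / 128) * real k\<rceil>)"
  have "\<forall>\<^sub>F k in sequentially. \<forall>a\<in>{..<K}. \<forall>R>0. lds_tail (len a k) R (thr a k) \<le> \<delta>"
    unfolding len_def thr_def using \<eta> \<delta>
    by (intro eventually_ball_finite ballI segment_tail) auto
  then show ?thesis
    using eventually_ge_real[of "max 2 (128 / \<eta>\<^sup>2)"] eventually_ge_sqrt[of "2 / \<eta>"]
      eventually_ge_sqrt[of "1 / (\<eta>\<^sup>2 * \<delta>)"] eventually_ge_real[of "65536 / (\<eta> ^ 4 * \<delta>)"]
  proof eventually_elim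
    case k: (elim k)
    have k2: "2 \<le> k" "128 / \<eta>\<^sup>2 \<le> real k" using k(2) by auto
    have sq: "0 < sqrt (real k)" using k2 by simp
    define s where "s = 1 / sqrt (real k)"
    have dev: "1 / (\<eta>\<^sup>2 * sqrt (real k)) \<le> \<delta>" using k(4) \<eta> \<delta> sq by (simp add: field_simps)
    have dev': "65536 / (\<eta> ^ 4 * real k) \<le> \<delta>" using k(5) \<eta> \<delta> k2 by (simp add: field_simps)
    show ?case
      using eventually_ge_at_top[of k] eventually_ge_real[of "256 / \<eta>\<^sup>2"]
    proof eventually_elim
      case R: (elim R)
      have R0: "0 < R" using R(1) k2 by simp
      note st = stationary_mean_bounds[OF k2(1) R0, folded s_def]
      have d: "particle_density s R \<in> {0..1}" using particle_density_balance(1) st(1) R0 by blast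
      \<comment> \<open>The exceptional events: \<open>A\<close> and \<open>B\<close> for the chain value, and for each block \<open>A\<close> and \<open>C\<close> for
        the gain along a boundary, \<open>T\<close> and \<open>W\<close> for the subsequence after leaving it.\<close>
      define M where "M = stationary s R k"
      define Q where "Q = (\<lambda>A. measure_pmf.prob M A)"
      define e where "e = (\<lambda>a. a * k div K)"
      define r where "r = (\<lambda>a. a * R div K)"
      define A where "A = (\<lambda>i. {(es::bool list, xs). \<eta> * sqrt (real k) \<le> \<bar>real (sources (drop i xs)) - real (k - i) * s\<bar>})"
      define B where "B = {(es, xs). \<eta> * sqrt (real k) \<le> \<bar>real (count_upto R (foldr push xs es)) - real R * particle_density s R\<bar>}"
      define C where "C = (\<lambda>j. {(es, xs::nat list). \<eta> * sqrt (real k) \<le> \<bar>real (count_upto j es) - real j * particle_density s R\<bar>})"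
      define T where "T = (\<lambda>a. {(es::bool list, xs). thr a k < real (lds (filter (\<lambda>x. 0 < x) (take (k - e a) xs)))})"
      define W where "W = (\<lambda>a. {(es::bool list, xs). thr a k < real (lds (filter (\<lambda>x. r a < x) xs))})"
      define G where "G = {(es::bool list, xs). (2 - \<epsilon>) * sqrt (real k) < real (lds (filter (\<lambda>x. 0 < x) xs))}"
      define bad where "bad = (A 0 \<union> B) \<union> (\<Union>a<K. A (k - e (Suc a)) \<union> C (r (Suc a)) \<union> T a \<union> W a)"
      have A: "Q (A i) \<le> \<delta>" for i
        unfolding Q_def A_def M_def s_def by (rule order_trans[OF prob_sources_deviation[OF k2(1) R0 \<eta>(1)] dev])
      have B: "Q B \<le> \<delta>"
        unfolding Q_def B_def M_def s_def
        by (rule order_trans[OF prob_count_deviation[OF k2(1) R0 \<eta>(1) order_refl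
            stationary_particles_law[OF st(1)[unfolded s_def] R0]] dev])
      have r_le: "r (Suc a) \<le> R" and e_le: "e (Suc a) \<le> k" if "a < K" for a
      proof -
        have "Suc a * n div K \<le> n" for n
        proof -
          have "Suc a * n \<le> K * n" using that by (intro mult_le_mono1) simp
          then show ?thesis using K(1) by (metis div_le_mono nonzero_mult_div_cancel_left not_less0)
        qed
        then show "r (Suc a) \<le> R" "e (Suc a) \<le> k" unfolding r_def e_def by auto
      qed
      have C: "Q (C (r (Suc a))) \<le> \<delta>" if "a < K" for a
        unfolding Q_def C_def M_def s_def
        by (rule order_trans[OF prob_count_deviation[OF k2(1) R0 \<eta>(1) r_le[OF that]
            stationary_count_law[OF st(1)[unfolded s_def] R0 r_le[OF that]]] dev])
      have T: "Q (T a) \<le> \<delta>" if "a < K" for a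
      proof -
        have "lds_tail (len a k) R (thr a k) \<le> \<delta>" using k(1) that R0 by auto
        then show ?thesis
          using prob_segment_large[OF k2 R0 \<eta>(1) that, of "thr a k", folded s_def]
          unfolding Q_def T_def M_def e_def prob_stationary_snd len_def by linarith
      qed
      have W: "Q (W a) \<le> 2 * \<delta>" if "a < K" for a
      proof -
        have "r a < R"
        proof -
          have "a * R < K * R" using that R0 by simp
          then show ?thesis unfolding r_def using K by (simp add: div_less_iff_less_mult mult.commute)
        qed
        then have "lds_tail (len a k) (R - r a) (thr a k) \<le> \<delta>" using k(1) that by auto
        then show ?thesis
          using prob_window_large[OF k2(1) R(2) \<eta> that, of "thr a k", folded s_def] dev'
          unfolding Q_def W_def M_def r_def prob_stationary_snd len_def by linarith
      qed
      have bad: "Q bad \<le> \<epsilon>"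
      proof -
        have Un: "Q (X \<union> Y) \<le> Q X + Q Y" for X Y
          unfolding Q_def by (rule measure_Un_le) auto
        have "Q (\<Union>a<K. A (k - e (Suc a)) \<union> C (r (Suc a)) \<union> T a \<union> W a) \<le>
            (\<Sum>a<K. Q (A (k - e (Suc a)) \<union> C (r (Suc a)) \<union> T a \<union> W a))"
          unfolding Q_def by (rule measure_UNION_le) auto
        also have "\<dots> \<le> (\<Sum>a<K. 5 * \<delta>)"
        proof (rule sum_mono)
          fix a assume "a \<in> {..<K}"
          then have "a < K" by simp
          have "Q (A (k - e (Suc a)) \<union> C (r (Suc a)) \<union> T a \<union> W a) \<le>
              Q (A (k - e (Suc a)) \<union> C (r (Suc a)) \<union> T a) + Q (W a)" by (rule Un)
          also have "Q (A (k - e (Suc a)) \<union> C (r (Suc a)) \<union> T a) \<le>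
              Q (A (k - e (Suc a)) \<union> C (r (Suc a))) + Q (T a)" by (rule Un)
          also have "Q (A (k - e (Suc a)) \<union> C (r (Suc a))) \<le>
              Q (A (k - e (Suc a))) + Q (C (r (Suc a)))" by (rule Un)
          finally show "Q (A (k - e (Suc a)) \<union> C (r (Suc a)) \<union> T a \<union> W a) \<le> 5 * \<delta>"
            using A[of "k - e (Suc a)"] C[OF \<open>a < K\<close>] T[OF \<open>a < K\<close>] W[OF \<open>a < K\<close>] by linarith
        qed
        finally have "Q (\<Union>a<K. A (k - e (Suc a)) \<union> C (r (Suc a)) \<union> T a \<union> W a) \<le> 5 * (real K * \<delta>)" by simp
        moreover have "Q (A 0 \<union> B) \<le> 2 * \<delta>" using Un[of "A 0" B] A[of 0] B by linarith
        moreover have "Q bad \<le> Q (A 0 \<union> B) + Q (\<Union>a<K. A (k - e (Suc a)) \<union> C (r (Suc a)) \<union> T a \<union> W a)"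
          unfolding bad_def by (rule Un)
        moreover have "1 * \<delta> \<le> real K * \<delta>" using K \<delta> by (intro mult_right_mono) auto
        moreover have "8 * (real K * \<delta>) = \<epsilon>" using K by (simp add: \<delta>_def)
        ultimately show ?thesis using \<delta> by linarith
      qed
      have good: "\<omega> \<in> G" if supp: "\<omega> \<in> set_pmf M" and nbad: "\<omega> \<notin> bad" for \<omega>
      proof -
        obtain es xs where \<omega>: "\<omega> = (es, xs)" by force
        note supp' = set_stationary[OF supp[unfolded \<omega> M_def] R0]
        have nA0: "(es, xs) \<notin> A 0" and nB: "(es, xs) \<notin> B" using nbad \<omega> by (auto simp: bad_def)
        have nblock: "(es, xs) \<notin> A (k - e (Suc a))" "(es, xs) \<notin> C (r (Suc a))" "(es, xs) \<notin> T a" "(es, xs) \<notin> W a"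
          if "a < K" for a using nbad \<omega> that by (auto simp: bad_def)
        have V: "(2 - 3 * \<eta>) * sqrt (real k) < real (sources xs + count_upto R (foldr push xs es))"
        proof -
          have "2 \<le> \<eta> * sqrt (real k)" using k(3) \<eta> by (simp add: field_simps)
          moreover have "(1 - \<eta>) * sqrt (real k) < real (sources xs)"
            using nA0 st(2) by (simp add: A_def algebra_simps abs_less_iff not_le)
          moreover have "real R * particle_density s R - \<eta> * sqrt (real k) < real (count_upto R (foldr push xs es))"
            using nB by (simp add: B_def abs_less_iff not_le)
          ultimately show ?thesis using st(4)[OF R(1)] by (simp add: algebra_simps)
        qed
        have S': "real (sources (drop (k - Suc a * k div K) xs)) < (real (Suc a) / real K + \<eta>) * sqrt (real k)"
          if "a < K" for a
        proof -
          have "real (sources (drop (k - e (Suc a)) xs)) < real (k - (k - e (Suc a))) * s + \<eta> * sqrt (real k)"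
            using nblock(1)[OF that] by (simp add: A_def abs_less_iff not_le)
          also have "k - (k - e (Suc a)) = e (Suc a)" using e_le[OF that] by simp
          also have "real (e (Suc a)) * s \<le> (real (Suc a) / real K * real k) * s"
            using st(1) real_mult_div_nat_le by (intro mult_right_mono) (auto simp: e_def simp del: mult_Suc of_nat_Suc)
          also have "\<dots> = real (Suc a) / real K * sqrt (real k)" by (simp add: mult.assoc st(2))
          finally show ?thesis by (simp add: e_def algebra_simps)
        qed
        have C': "real (count_upto (Suc a * R div K) es) < (real (Suc a) / real K + \<eta>) * sqrt (real k)"
          if "a < K" for a
        proof -
          have "real (count_upto (r (Suc a)) es) < real (r (Suc a)) * particle_density s R + \<eta> * sqrt (real k)"
            using nblock(2)[OF that] by (simp add: C_def abs_less_iff not_le)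
          also have "real (r (Suc a)) * particle_density s R \<le> (real (Suc a) / real K * real R) * particle_density s R"
            using d real_mult_div_nat_le by (intro mult_right_mono) (auto simp: r_def simp del: mult_Suc of_nat_Suc)
          also have "\<dots> = real (Suc a) / real K * (real R * particle_density s R)" by simp
          also have "\<dots> \<le> real (Suc a) / real K * sqrt (real k)" by (intro mult_left_mono st(3)) auto
          finally show ?thesis by (simp add: r_def algebra_simps)
        qed
        have "(2 - \<epsilon>) * sqrt (real k) < real (lds (filter (\<lambda>x. 0 < x) xs))"
          using V S' C' nblock(3,4)
          by (intro long_subsequence_of_long_chain[OF assms \<eta>_def sq K supp'])
             (auto simp: T_def W_def thr_def e_def r_def not_less)
        then show ?thesis by (simp add: G_def \<omega>)
      qed
      have "1 - Q bad = Q (- bad)"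
        unfolding Q_def using measure_pmf.prob_compl[of bad M] by (simp add: Compl_eq_Diff_UNIV)
      also have "\<dots> \<le> Q G"
        unfolding Q_def using good
        by (intro measure_pmf.finite_measure_mono_AE) (auto simp: AE_measure_pmf_iff)
      also have "\<dots> \<le> lds_tail k R ((2 - \<epsilon>) * sqrt (real k))"
        unfolding Q_def G_def M_def prob_stationary_snd by (rule prob_lds_filter_le_tail[OF st(1) R0])
      finally show ?case using bad by simp
    qed
  qed
qed

section \<open>Sequences with bounded conditional densities\<close>

text \<open>The last argument is the history, again with the latest entry at the head. Recursing on it, rather
  than appending to the result, lets two histories be compared along the recursion.\<close>

primrec kernel_seq :: "nat \<Rightarrow> (nat list \<Rightarrow> nat pmf) \<Rightarrow> nat list \<Rightarrow> nat list pmf" where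
  "kernel_seq 0 K ys = return_pmf ys"
| "kernel_seq (Suc k) K ys = K ys \<bind> (\<lambda>t. kernel_seq k K (t # ys))"

primrec thinned_seq :: "real \<Rightarrow> nat \<Rightarrow> (nat list \<Rightarrow> nat pmf) \<Rightarrow> nat list \<Rightarrow> nat list pmf" where
  "thinned_seq \<theta> 0 K ys = return_pmf ys"
| "thinned_seq \<theta> (Suc k) K ys =
    bernoulli_pmf \<theta> \<bind> (\<lambda>z. if z then K ys \<bind> (\<lambda>t. thinned_seq \<theta> k K (t # ys)) else thinned_seq \<theta> k K ys)"

lemma kernel_seq_Suc_last:
  "kernel_seq (Suc k) K ys = kernel_seq k K ys \<bind> (\<lambda>zs. map_pmf (\<lambda>t. t # zs) (K zs))"
proof (induction k arbitrary: ys)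
  case 0
  then show ?case by (simp add: bind_return_pmf map_pmf_def)
next
  case (Suc k)
  have "kernel_seq (Suc (Suc k)) K ys = K ys \<bind> (\<lambda>t. kernel_seq (Suc k) K (t # ys))" by simp
  also have "\<dots> = K ys \<bind> (\<lambda>t. kernel_seq k K (t # ys) \<bind> (\<lambda>zs. map_pmf (\<lambda>t. t # zs) (K zs)))"
    unfolding Suc.IH ..
  also have "\<dots> = kernel_seq (Suc k) K ys \<bind> (\<lambda>zs. map_pmf (\<lambda>t. t # zs) (K zs))"
    by (simp add: bind_assoc_pmf)
  finally show ?case .
qed

lemma kernel_seq_const: "kernel_seq k (\<lambda>_. p) [] = replicate_pmf k p"
proof (induction k)
  case (Suc k)
  then show ?case
    unfolding kernel_seq_Suc_last replicate_pmf_Suc_map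
    using bind_commute_pmf[of "replicate_pmf k p" p "\<lambda>zs t. return_pmf (t # zs)"]
    by (simp add: map_pmf_def del: replicate_pmf.simps)
qed simp

lemma thinned_seq_eq:
  assumes "\<theta> \<in> {0..1}"
  shows "thinned_seq \<theta> k K ys = binomial_pmf k \<theta> \<bind> (\<lambda>j. kernel_seq j K ys)"
proof (induction k arbitrary: ys)
  case 0
  then show ?case using assms by (simp add: binomial_pmf_0 bind_return_pmf)
next
  case (Suc k)
  have "thinned_seq \<theta> (Suc k) K ys = bernoulli_pmf \<theta> \<bind>
      (\<lambda>z. binomial_pmf k \<theta> \<bind> (\<lambda>j. kernel_seq (of_bool z + j) K ys))"
    unfolding thinned_seq.simps Suc.IH
  proof (intro bind_pmf_cong refl)
    fix z
    show "(if z then K ys \<bind> (\<lambda>t. binomial_pmf k \<theta> \<bind> (\<lambda>j. kernel_seq j K (t # ys)))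
        else binomial_pmf k \<theta> \<bind> (\<lambda>j. kernel_seq j K ys)) =
        binomial_pmf k \<theta> \<bind> (\<lambda>j. kernel_seq (of_bool z + j) K ys)"
      using bind_commute_pmf[of "K ys" "binomial_pmf k \<theta>" "\<lambda>t j. kernel_seq j K (t # ys)"] by simp
  qed
  also have "\<dots> = binomial_pmf (Suc k) \<theta> \<bind> (\<lambda>j. kernel_seq j K ys)"
    using assms by (simp add: binomial_pmf_Suc bind_assoc_pmf bind_return_pmf of_bool_def)
  finally show ?case .
qed

text \<open>If \<open>K\<close> dominates \<open>\<theta>\<close> times \<open>\<Lambda>\<close>, whatever the two histories are, then a draw from \<open>K\<close> can be
  realised by drawing from \<open>\<Lambda>\<close> with probability \<open>\<theta>\<close> and from some remainder law otherwise. Since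
  membership in \<open>H\<close> survives insertions, the remainder draws may be discarded.\<close>

lemma prob_thinned_le_kernel:
  assumes \<theta>: "\<theta> \<in> {0..1}" and X: "finite X" "\<And>ys. set_pmf (K ys) \<subseteq> X" "\<And>ys. set_pmf (\<Lambda> ys) \<subseteq> X"
    and dom: "\<And>ys zs t. \<theta> * pmf (\<Lambda> zs) t \<le> pmf (K ys) t"
    and H: "\<And>xs ys. subseq xs ys \<Longrightarrow> xs \<in> H \<Longrightarrow> ys \<in> H"
  shows "subseq zs ys \<Longrightarrow>
    measure_pmf.prob (thinned_seq \<theta> k \<Lambda> zs) H \<le> measure_pmf.prob (kernel_seq k K ys) H"
proof (induction k arbitrary: zs ys)
  case 0
  then show ?case using H[OF 0] by (auto simp: indicator_def)
next
  case (Suc k)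
  define p where "p = measure_pmf.prob (thinned_seq \<theta> k \<Lambda> zs) H"
  define g where "g = (\<lambda>t. measure_pmf.prob (thinned_seq \<theta> k \<Lambda> (t # zs)) H)"
  define F where "F = (\<lambda>t. measure_pmf.prob (kernel_seq k K (t # ys)) H)"
  have F: "p \<le> F t" "g t \<le> F t" for t
    using Suc.IH[of zs "t # ys"] Suc.IH[of "t # zs" "t # ys"] Suc.prems by (auto simp: p_def g_def F_def)
  have "measure_pmf.prob (thinned_seq \<theta> (Suc k) \<Lambda> zs) H =
      \<theta> * measure_pmf.prob (\<Lambda> zs \<bind> (\<lambda>t. thinned_seq \<theta> k \<Lambda> (t # zs))) H + (1 - \<theta>) * p"
    using \<theta> unfolding thinned_seq.simps by (subst prob_bind_pmf) (simp add: p_def mult.commute)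
  also have "measure_pmf.prob (\<Lambda> zs \<bind> (\<lambda>t. thinned_seq \<theta> k \<Lambda> (t # zs))) H = (\<Sum>t\<in>X. g t * pmf (\<Lambda> zs) t)"
    unfolding prob_bind_pmf g_def using X by (subst integral_measure_pmf_real[of X]) auto
  also have "\<theta> * (\<Sum>t\<in>X. g t * pmf (\<Lambda> zs) t) + (1 - \<theta>) * p =
      \<theta> * (\<Sum>t\<in>X. g t * pmf (\<Lambda> zs) t) + ((\<Sum>t\<in>X. pmf (K ys) t) - \<theta> * (\<Sum>t\<in>X. pmf (\<Lambda> zs) t)) * p"
    using X by (simp add: sum_pmf_eq_1)
  also have "\<dots> = (\<Sum>t\<in>X. \<theta> * pmf (\<Lambda> zs) t * g t + (pmf (K ys) t - \<theta> * pmf (\<Lambda> zs) t) * p)"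
    by (simp add: sum.distrib sum_distrib_left sum_distrib_right sum_subtractf algebra_simps)
  also have "\<dots> \<le> (\<Sum>t\<in>X. F t * pmf (K ys) t)"
  proof (rule sum_mono)
    fix t
    have "\<theta> * pmf (\<Lambda> zs) t * g t + (pmf (K ys) t - \<theta> * pmf (\<Lambda> zs) t) * p \<le>
        \<theta> * pmf (\<Lambda> zs) t * F t + (pmf (K ys) t - \<theta> * pmf (\<Lambda> zs) t) * F t"
      using \<theta> dom[of zs t ys] F[of t] by (intro add_mono mult_left_mono) auto
    then show "\<theta> * pmf (\<Lambda> zs) t * g t + (pmf (K ys) t - \<theta> * pmf (\<Lambda> zs) t) * p \<le> F t * pmf (K ys) t"
      by (simp add: algebra_simps)
  qed
  also have "\<dots> = measure_pmf.prob (kernel_seq (Suc k) K ys) H"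
    unfolding kernel_seq.simps prob_bind_pmf F_def using X by (subst integral_measure_pmf_real[of X]) auto
  finally show ?case .
qed

lemma prob_kernel_seq_mono:
  assumes H: "\<And>xs ys. subseq xs ys \<Longrightarrow> xs \<in> H \<Longrightarrow> ys \<in> H" and "m \<le> j"
  shows "measure_pmf.prob (kernel_seq m K ys) H \<le> measure_pmf.prob (kernel_seq j K ys) H"
  using \<open>m \<le> j\<close>
proof (induction j rule: dec_induct)
  case (step j)
  have "1 \<le> measure_pmf.prob (map_pmf (\<lambda>t. t # zs) (K zs)) H" if "zs \<in> H" for zs
  proof -
    have "(\<lambda>t. t # zs) -` H = UNIV" using H[of zs] that by auto
    then show ?thesis by simp
  qed
  then have "measure_pmf.prob (kernel_seq j K ys) H * 1 \<le> measure_pmf.prob (kernel_seq (Suc j) K ys) H"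
    unfolding kernel_seq_Suc_last by (rule prob_bind_pmf_ge)
  then show ?case using step.IH by simp
qed simp

lemma prob_kernel_domination:
  assumes \<theta>: "\<theta> \<in> {0..1}" and X: "finite X" "\<And>ys. set_pmf (K ys) \<subseteq> X" "\<And>ys. set_pmf (\<Lambda> ys) \<subseteq> X"
    and dom: "\<And>ys zs t. \<theta> * pmf (\<Lambda> zs) t \<le> pmf (K ys) t"
    and H: "\<And>xs ys. subseq xs ys \<Longrightarrow> xs \<in> H \<Longrightarrow> ys \<in> H"
  shows "measure_pmf.prob (binomial_pmf k \<theta>) {j. m \<le> j} * measure_pmf.prob (kernel_seq m \<Lambda> []) H \<le>
    measure_pmf.prob (kernel_seq k K []) H"
proof -
  have "measure_pmf.prob (binomial_pmf k \<theta>) {j. m \<le> j} * measure_pmf.prob (kernel_seq m \<Lambda> []) H \<le>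
      measure_pmf.prob (thinned_seq \<theta> k \<Lambda> []) H"
    unfolding thinned_seq_eq[OF \<theta>] using prob_kernel_seq_mono[OF H] by (intro prob_bind_pmf_ge) auto
  also have "\<dots> \<le> measure_pmf.prob (kernel_seq k K []) H"
    by (rule prob_thinned_le_kernel[OF \<theta> X dom H]) auto
  finally show ?thesis .
qed

lemma long_lists_closed: "subseq xs ys \<Longrightarrow> xs \<in> {xs. a < real (lds xs)} \<Longrightarrow> ys \<in> {xs. a < real (lds xs)}"
  using lds_mono[of xs ys] by auto

text \<open>One notion serves both bounds: the first inequality embeds a uniform sequence into one with kernel
  \<open>K\<close>, the second embeds a sequence with kernel \<open>K\<close> into a uniform one.\<close>

definition comparable :: "real \<Rightarrow> nat \<Rightarrow> (nat list \<Rightarrow> nat pmf) \<Rightarrow> bool" where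
  "comparable \<theta> R K \<longleftrightarrow> (\<forall>ys. set_pmf (K ys) \<subseteq> {1..R}) \<and>
    (\<forall>ys t. \<theta> * pmf (pmf_of_set {1..R}) t \<le> pmf (K ys) t \<and> \<theta> * pmf (K ys) t \<le> pmf (pmf_of_set {1..R}) t)"

lemma comparable_lower:
  assumes "comparable \<theta> R K" "\<theta> \<in> {0..1}" "0 < R"
  shows "measure_pmf.prob (binomial_pmf k \<theta>) {j. m \<le> j} * lds_tail m R a \<le>
    measure_pmf.prob (kernel_seq k K []) {xs. a < real (lds xs)}"
  using prob_kernel_domination[OF assms(2), of "{1..R}" K "\<lambda>_. pmf_of_set {1..R}" "{xs. a < real (lds xs)}" k m]
    assms(1,3) long_lists_closed[of _ _ a]
  by (simp add: comparable_def kernel_seq_const lds_tail_def)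

lemma comparable_upper:
  assumes "comparable \<theta> R K" "\<theta> \<in> {0..1}" "0 < R"
  shows "measure_pmf.prob (binomial_pmf k \<theta>) {j. m \<le> j} *
    measure_pmf.prob (kernel_seq m K []) {xs. a < real (lds xs)} \<le> lds_tail k R a"
  using prob_kernel_domination[OF assms(2), of "{1..R}" "\<lambda>_. pmf_of_set {1..R}" K "{xs. a < real (lds xs)}" k m]
    assms(1,3) long_lists_closed[of _ _ a]
  by (simp add: comparable_def kernel_seq_const lds_tail_def)

lemma prob_binomial_ge:
  assumes "0 < k" "0 < g" "x + g \<le> \<zeta>" "0 \<le> \<zeta>" "\<zeta> \<le> 1" "real l \<le> x * real k"
  shows "1 - 1 / (real k * g\<^sup>2) \<le> measure_pmf.prob (binomial_pmf k \<zeta>) {j. l \<le> j}"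
proof -
  have "measure_pmf.prob (binomial_pmf k \<zeta>) (- {j. l \<le> j}) \<le>
      measure_pmf.prob (binomial_pmf k \<zeta>) {j. g * real k \<le> \<bar>real j - real k * \<zeta>\<bar>}"
  proof (intro measure_pmf.finite_measure_mono subsetI)
    fix j assume "j \<in> - {j. l \<le> j}"
    then have "real j \<le> x * real k" using assms(6) by simp
    moreover have "(x + g) * real k \<le> \<zeta> * real k" using assms(3) by (intro mult_right_mono) auto
    ultimately have "g * real k \<le> - (real j - real k * \<zeta>)" by (simp add: algebra_simps)
    then show "j \<in> {j. g * real k \<le> \<bar>real j - real k * \<zeta>\<bar>}" using abs_ge_minus_self order_trans by blast
  qed simp
  also have "\<dots> \<le> real k * \<zeta> / (g * real k)\<^sup>2"
    using assms by (intro binomial_Chebyshev) auto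
  also have "\<dots> \<le> real k * 1 / (g * real k)\<^sup>2"
    using assms by (intro divide_right_mono mult_left_mono) auto
  also have "\<dots> = 1 / (real k * g\<^sup>2)"
    using assms by (simp add: field_simps power2_eq_square)
  finally show ?thesis
    using measure_pmf.prob_compl[of "{j. l \<le> j}" "binomial_pmf k \<zeta>"] by (simp add: Compl_eq_Diff_UNIV)
qed

text \<open>By the law of large numbers for the binomial length, a sequence of length \<open>m\<close> contains a uniform one of
  length about \<open>\<zeta> * m\<close> and is contained in a uniform one of length about \<open>m / \<zeta>\<close>. The bounds do not
  depend on the kernel, and they allow \<open>\<zeta>\<close> to approach \<open>\<theta>\<close> from below.\<close>

proposition lds_comparable:
  assumes \<theta>: "0 < \<theta>" "\<theta> \<le> 1" and "0 < \<epsilon>" "0 < \<delta>"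
  shows "\<exists>\<theta>'<\<theta>. \<forall>\<^sub>F m in sequentially. \<forall>\<^sub>F R in sequentially. \<forall>\<zeta> K.
    \<theta>' \<le> \<zeta> \<and> \<zeta> \<le> 1 \<and> comparable \<zeta> R K \<longrightarrow>
    measure_pmf.prob (kernel_seq m K []) {xs. real (lds xs) \<le> (2 * sqrt \<theta> - \<epsilon>) * sqrt (real m)} \<le> \<delta> \<and>
    measure_pmf.prob (kernel_seq m K []) {xs. (2 / sqrt \<theta> + \<epsilon>) * sqrt (real m) \<le> real (lds xs)} \<le> \<delta>"
proof -
  \<comment> \<open>The ratio \<open>x\<close> lies below \<open>\<theta>\<close>, so that the law of large numbers leaves room, and so close to it
    that \<open>sqrt x\<close> and \<open>1 / sqrt x\<close> are within \<open>\<epsilon> / 8\<close> of \<open>sqrt \<theta>\<close> and \<open>1 / sqrt \<theta>\<close>.\<close>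
  define r where "r = sqrt \<theta>"
  have r: "0 < r" "r \<le> 1" using \<theta> by (auto simp: r_def)
  define h where "h = min (1 / 2) (\<epsilon> * r / 16)"
  have h: "0 < h" "h \<le> 1 / 2" "h \<le> \<epsilon> * r / 16" using assms r by (auto simp: h_def)
  define x where "x = (r * (1 - h))\<^sup>2"
  have sx: "sqrt x = r * (1 - h)" using r h by (simp add: x_def)
  have x0: "0 < x" using r h by (simp add: x_def)
  have x\<theta>: "x < \<theta>"
  proof -
    have "r * (1 - h) < r * 1" using r h by (intro mult_strict_left_mono) auto
    then have "x < r\<^sup>2" using r h unfolding x_def by (intro power_strict_mono) auto
    then show ?thesis using \<theta> by (simp add: r_def)
  qed
  have sx_ge: "r - \<epsilon> / 16 \<le> sqrt x"
  proof -
    have "r * h \<le> 1 * h" using r h by (intro mult_right_mono) auto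
    moreover have "\<epsilon> * r \<le> \<epsilon> * 1" using r assms by (intro mult_left_mono) auto
    ultimately show ?thesis using h(3) by (simp add: sx algebra_simps)
  qed
  have inv_sx: "1 / sqrt x \<le> 1 / r + \<epsilon> / 8"
  proof -
    have "1 / (1 - h) \<le> 1 + 2 * h"
    proof -
      have "h * h \<le> h * (1 / 2)" using h by (intro mult_left_mono) auto
      then have "1 \<le> (1 + 2 * h) * (1 - h)" by (simp add: algebra_simps)
      then show ?thesis using h by (simp add: pos_divide_le_eq)
    qed
    then have "1 / r * (1 / (1 - h)) \<le> 1 / r * (1 + 2 * h)" using r by (intro mult_left_mono) auto
    moreover have "1 / r * (2 * h) \<le> \<epsilon> / 8" using h(3) r by (simp add: field_simps)
    moreover have "1 / sqrt x = 1 / r * (1 / (1 - h))" by (simp add: sx)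
    moreover have "1 / r * (1 + 2 * h) = 1 / r + 1 / r * (2 * h)" by (simp only: distrib_left mult_1_right)
    ultimately show ?thesis by linarith
  qed
  define \<theta>' where "\<theta>' = (x + \<theta>) / 2"
  define g where "g = \<theta>' - x"
  have "x + g \<le> \<theta>'" by (simp add: g_def)
  moreover have "0 < g" "\<theta>' < \<theta>" using x\<theta> by (auto simp: g_def \<theta>'_def)
  ultimately have g: "0 < g" "\<theta>' < \<theta>" "x + g \<le> \<theta>'" by auto
  define k0 where "k0 = (\<lambda>m. nat \<lfloor>x * real m\<rfloor>)"
  define k1 where "k1 = (\<lambda>m. nat \<lceil>real m / x\<rceil>)"
  have k0: "real (k0 m) \<le> x * real m" "x * real m - 1 \<le> real (k0 m)" for m
    using x0 by (auto simp: k0_def)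
  have k1: "real m / x \<le> real (k1 m)" "real (k1 m) \<le> real m / x + 1" for m
    using x0 by (auto simp: k1_def)
  have lim0: "filterlim k0 at_top sequentially"
    unfolding filterlim_at_top
  proof
    fix N
    show "\<forall>\<^sub>F m in sequentially. N \<le> k0 m"
      using eventually_ge_real[of "(real N + 1) / x"]
    proof eventually_elim
      case (elim m)
      then have "real N + 1 \<le> x * real m" using x0 by (simp add: field_simps)
      then have "real N \<le> real (k0 m)" using k0(2)[of m] by linarith
      then show ?case by simp
    qed
  qed
  have k1_ge: "m \<le> k1 m" for m
  proof -
    have "real m * x \<le> real m * 1" using x\<theta> \<theta> by (intro mult_left_mono) auto
    then have "real m \<le> real m / x" using x0 by (simp add: field_simps)
    then have "real m \<le> real (k1 m)" using k1(1)[of m] by linarith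
    then show ?thesis by simp
  qed
  then have lim1: "filterlim k1 at_top sequentially"
    by (intro filterlim_at_top_mono[OF filterlim_ident]) auto
  define \<epsilon>0 where "\<epsilon>0 = min 1 (min (\<epsilon> / 2) (\<delta> / 4))"
  have \<epsilon>0: "0 < \<epsilon>0" "\<epsilon>0 \<le> 1" "\<epsilon>0 \<le> \<epsilon> / 2" "\<epsilon>0 \<le> \<delta> / 4" using assms by (auto simp: \<epsilon>0_def)
  define \<epsilon>1 where "\<epsilon>1 = min 1 (\<epsilon> * sqrt x / 8)"
  have \<epsilon>1: "0 < \<epsilon>1" "\<epsilon>1 \<le> 1" "\<epsilon>1 / sqrt x \<le> \<epsilon> / 8" using assms x0 by (auto simp: \<epsilon>1_def field_simps)
  have low: "\<forall>\<^sub>F m in sequentially. \<forall>\<^sub>F R in sequentially.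
      1 - \<epsilon>0 \<le> lds_tail (k0 m) R ((2 - \<epsilon>0) * sqrt (real (k0 m)))"
    by (rule eventually_compose_filterlim[OF lds_uniform_lower[OF \<epsilon>0(1,2)] lim0])
  have high: "\<forall>\<^sub>F m in sequentially. \<forall>R>0. lds_tail (k1 m) R ((2 + \<epsilon>1) * sqrt (real (k1 m))) \<le> \<delta> / 2"
    using \<open>0 < \<delta>\<close> by (intro eventually_compose_filterlim[OF lds_uniform_upper[OF \<epsilon>1(1)] lim1]) auto
  have "\<forall>\<^sub>F m in sequentially. \<forall>\<^sub>F R in sequentially. \<forall>\<zeta> K.
    \<theta>' \<le> \<zeta> \<and> \<zeta> \<le> 1 \<and> comparable \<zeta> R K \<longrightarrow>
    measure_pmf.prob (kernel_seq m K []) {xs. real (lds xs) \<le> (2 * sqrt \<theta> - \<epsilon>) * sqrt (real m)} \<le> \<delta> \<and>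
    measure_pmf.prob (kernel_seq m K []) {xs. (2 / sqrt \<theta> + \<epsilon>) * sqrt (real m) \<le> real (lds xs)} \<le> \<delta>"
    using low high eventually_ge_real[of "max (1 / x) (max (2 / g\<^sup>2) (2 / (\<delta> * g\<^sup>2)))"] eventually_ge_sqrt[of "8 / \<epsilon>"]
  proof eventually_elim
    case m: (elim m)
    have xm: "1 \<le> x * real m" using m(3) x0 by (simp add: field_simps)
    then have m0: "0 < real m" using x0 by (metis mult_eq_0_iff not_one_le_zero of_nat_0_less_iff of_nat_eq_0_iff zero_less_iff_neq_zero)
    have mg: "1 / (real m * g\<^sup>2) \<le> 1 / 2" "1 / (real m * g\<^sup>2) \<le> \<delta> / 2"
      using m(3) g m0 \<open>0 < \<delta>\<close> by (simp_all add: field_simps)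
    have s8: "8 \<le> \<epsilon> * sqrt (real m)" using m(4) assms by (simp add: field_simps)
    have thr0: "(2 * sqrt \<theta> - \<epsilon>) * sqrt (real m) \<le> (2 - \<epsilon>0) * sqrt (real (k0 m))"
    proof -
      have "sqrt x * sqrt (real m) = sqrt (x * real m)" by (simp add: real_sqrt_mult)
      also have "\<dots> \<le> sqrt (real (k0 m) + 1)" using k0(2)[of m] by (intro real_sqrt_le_mono) simp
      also have "\<dots> \<le> sqrt (real (k0 m)) + sqrt 1" by (rule sqrt_add_le_add_sqrt) auto
      finally have *: "sqrt x * sqrt (real m) - 1 \<le> sqrt (real (k0 m))" by simp
      have "(2 - \<epsilon>0) * (sqrt x * sqrt (real m) - 1) \<le> (2 - \<epsilon>0) * sqrt (real (k0 m))"
        using * \<epsilon>0 by (intro mult_left_mono) auto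
      moreover have "(2 - \<epsilon>0) * (sqrt x * sqrt (real m) - 1) =
          2 * (sqrt x * sqrt (real m)) - \<epsilon>0 * (sqrt x * sqrt (real m)) - 2 + \<epsilon>0"
        by (simp add: algebra_simps)
      moreover have "(r - \<epsilon> / 16) * sqrt (real m) \<le> sqrt x * sqrt (real m)"
        using sx_ge by (intro mult_right_mono) auto
      moreover have "\<epsilon>0 * (sqrt x * sqrt (real m)) \<le> \<epsilon> / 2 * (1 * sqrt (real m))"
        using \<epsilon>0 x0 x\<theta> \<theta> assms by (intro mult_mono) auto
      ultimately have "2 * ((r - \<epsilon> / 16) * sqrt (real m)) - \<epsilon> / 2 * sqrt (real m) - 2 \<le> (2 - \<epsilon>0) * sqrt (real (k0 m))"
        using \<epsilon>0 by linarith
      moreover have "(2 * r - \<epsilon>) * sqrt (real m) \<le>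
          2 * ((r - \<epsilon> / 16) * sqrt (real m)) - \<epsilon> / 2 * sqrt (real m) - 2"
        using s8 by (simp add: algebra_simps)
      ultimately show ?thesis by (simp add: r_def)
    qed
    have thr1: "(2 + \<epsilon>1) * sqrt (real (k1 m)) < (2 / sqrt \<theta> + \<epsilon>) * sqrt (real m)"
    proof -
      have "sqrt (real (k1 m)) \<le> sqrt (real m / x + 1)" using k1(2)[of m] by (intro real_sqrt_le_mono) simp
      also have "\<dots> \<le> sqrt (real m / x) + sqrt 1" using x0 by (intro sqrt_add_le_add_sqrt) auto
      finally have *: "sqrt (real (k1 m)) \<le> 1 / sqrt x * sqrt (real m) + 1" by (simp add: real_sqrt_divide)
      have "(2 + \<epsilon>1) * sqrt (real (k1 m)) \<le> (2 + \<epsilon>1) * (1 / sqrt x * sqrt (real m) + 1)"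
        using * \<epsilon>1 by (intro mult_left_mono) auto
      also have "\<dots> = 2 * (1 / sqrt x * sqrt (real m)) + \<epsilon>1 / sqrt x * sqrt (real m) + 2 + \<epsilon>1"
        by (simp add: algebra_simps add_divide_distrib)
      also have "\<dots> \<le> 2 * ((1 / r + \<epsilon> / 8) * sqrt (real m)) + \<epsilon> / 8 * sqrt (real m) + 2 + 1"
        using inv_sx \<epsilon>1 by (intro add_mono mult_left_mono mult_right_mono) auto
      also have "\<dots> < (2 / r + \<epsilon>) * sqrt (real m)"
        using s8 by (simp add: algebra_simps)
      finally show ?thesis by (simp add: r_def)
    qed
    show ?case
      using m(1) eventually_gt_at_top[of "0::nat"]
    proof (eventually_elim, intro allI impI)
      fix R \<zeta> and K
      assume tail0: "1 - \<epsilon>0 \<le> lds_tail (k0 m) R ((2 - \<epsilon>0) * sqrt (real (k0 m)))" and R: "0 < R"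
        and "\<theta>' \<le> \<zeta> \<and> \<zeta> \<le> 1 \<and> comparable \<zeta> R K"
      then have \<zeta>: "x + g \<le> \<zeta>" "0 \<le> \<zeta>" "\<zeta> \<le> 1" and cmp: "comparable \<zeta> R K"
        using g x0 by auto
      define a0 where "a0 = (2 * sqrt \<theta> - \<epsilon>) * sqrt (real m)"
      define a1 where "a1 = (2 + \<epsilon>1) * sqrt (real (k1 m))"
      define P where "P = kernel_seq m K []"
      have "(1 - 1 / (real m * g\<^sup>2)) * (1 - \<epsilon>0) \<le>
          measure_pmf.prob (binomial_pmf m \<zeta>) {j. k0 m \<le> j} * lds_tail (k0 m) R a0"
      proof (rule mult_mono)
        show "1 - 1 / (real m * g\<^sup>2) \<le> measure_pmf.prob (binomial_pmf m \<zeta>) {j. k0 m \<le> j}"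
          using m0 g \<zeta> k0(1) by (intro prob_binomial_ge) auto
        show "1 - \<epsilon>0 \<le> lds_tail (k0 m) R a0"
          using tail0 lds_tail_antimono[OF thr0] unfolding a0_def by (rule order_trans)
      qed (use \<epsilon>0 in auto)
      also have "\<dots> \<le> measure_pmf.prob P {xs. a0 < real (lds xs)}"
        unfolding P_def using cmp \<zeta> R by (intro comparable_lower) auto
      finally have prod: "(1 - 1 / (real m * g\<^sup>2)) * (1 - \<epsilon>0) \<le> measure_pmf.prob P {xs. a0 < real (lds xs)}" .
      have "1 - u - \<epsilon>0 \<le> (1 - u) * (1 - \<epsilon>0)" if "0 \<le> u" for u
        using mult_nonneg_nonneg[OF that, of \<epsilon>0] \<epsilon>0 by (simp add: algebra_simps)
      from this[of "1 / (real m * g\<^sup>2)"] prod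
      have "1 - 1 / (real m * g\<^sup>2) - \<epsilon>0 \<le> measure_pmf.prob P {xs. a0 < real (lds xs)}"
        using m0 by (meson order_trans zero_le_divide_1_iff zero_le_mult_iff zero_le_power2 less_imp_le)
      moreover have "measure_pmf.prob P {xs. real (lds xs) \<le> a0} = 1 - measure_pmf.prob P {xs. a0 < real (lds xs)}"
        using measure_pmf.prob_compl[of "{xs. a0 < real (lds xs)}" P] by (simp add: not_less set_diff_eq)
      ultimately have "measure_pmf.prob P {xs. real (lds xs) \<le> a0} \<le> \<delta>" using mg(2) \<epsilon>0(4) \<open>0 < \<delta>\<close> by linarith
      moreover have "measure_pmf.prob P {xs. (2 / sqrt \<theta> + \<epsilon>) * sqrt (real m) \<le> real (lds xs)} \<le> \<delta>"
      proof -
        have "1 / 2 \<le> measure_pmf.prob (binomial_pmf (k1 m) \<zeta>) {j. m \<le> j}"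
        proof -
          have "1 / (real (k1 m) * g\<^sup>2) \<le> 1 / (real m * g\<^sup>2)"
            using k1_ge[of m] m0 g by (intro divide_left_mono mult_right_mono) (auto intro!: mult_pos_pos)
          moreover have "1 - 1 / (real (k1 m) * g\<^sup>2) \<le> measure_pmf.prob (binomial_pmf (k1 m) \<zeta>) {j. m \<le> j}"
            using k1_ge[of m] m0 g \<zeta> k1(1)[of m] x0 by (intro prob_binomial_ge) (auto simp: field_simps)
          ultimately show ?thesis using mg(1) by linarith
        qed
        then have "1 / 2 * measure_pmf.prob P {xs. a1 < real (lds xs)} \<le>
            measure_pmf.prob (binomial_pmf (k1 m) \<zeta>) {j. m \<le> j} * measure_pmf.prob P {xs. a1 < real (lds xs)}"
          by (intro mult_right_mono) auto
        also have "\<dots> \<le> lds_tail (k1 m) R a1"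
          unfolding P_def using cmp \<zeta> R by (intro comparable_upper) auto
        also have "\<dots> \<le> \<delta> / 2" using m(2) R by (simp add: a1_def)
        finally have "measure_pmf.prob P {xs. a1 < real (lds xs)} \<le> \<delta>" by simp
        moreover have "measure_pmf.prob P {xs. (2 / sqrt \<theta> + \<epsilon>) * sqrt (real m) \<le> real (lds xs)} \<le>
            measure_pmf.prob P {xs. a1 < real (lds xs)}"
          using thr1 unfolding a1_def by (intro measure_pmf.finite_measure_mono) auto
        ultimately show ?thesis by linarith
      qed
      ultimately show "measure_pmf.prob (kernel_seq m K []) {xs. real (lds xs) \<le> (2 * sqrt \<theta> - \<epsilon>) * sqrt (real m)} \<le> \<delta> \<and>
          measure_pmf.prob (kernel_seq m K []) {xs. (2 / sqrt \<theta> + \<epsilon>) * sqrt (real m) \<le> real (lds xs)} \<le> \<delta>"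
        unfolding P_def a0_def by blast
    qed
  qed
  then show ?thesis using g(2) by blast
qed

section \<open>The Mallows measure as a law on words\<close>

text \<open>Only the pairs that contain the position \<open>i\<close> can become inversions.\<close>

lemma inv_number_update:
  assumes "i \<in> {1..n}"
  shows "inv_number n (y(i := t)) \<le> inv_number n y + n"
proof -
  let ?I = "\<lambda>y. {(a, b). a \<in> {1..n} \<and> b \<in> {1..n} \<and> a < b \<and> y a > (y b :: nat)}"
  have fin: "finite (?I y)" for y
    by (rule finite_subset[of _ "{1..n} \<times> {1..n}"]) auto
  have "?I (y(i := t)) \<subseteq> ?I y \<union> (\<lambda>j. (min i j, max i j)) ` {1..n}"
  proof
    fix ab assume *: "ab \<in> ?I (y(i := t))"
    obtain a b where ab: "ab = (a, b)" by force
    have "a \<in> {1..n}" "b \<in> {1..n}" "a < b" using * ab by auto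
    show "ab \<in> ?I y \<union> (\<lambda>j. (min i j, max i j)) ` {1..n}"
    proof (cases "a = i \<or> b = i")
      case True
      then have "ab = (\<lambda>j. (min i j, max i j)) (if a = i then b else a)" using \<open>a < b\<close> ab by auto
      then show ?thesis using \<open>a \<in> {1..n}\<close> \<open>b \<in> {1..n}\<close> by auto
    next
      case False
      then show ?thesis using * ab by auto
    qed
  qed
  then have "card (?I (y(i := t))) \<le> card (?I y \<union> (\<lambda>j. (min i j, max i j)) ` {1..n})"
    using fin by (intro card_mono) auto
  also have "\<dots> \<le> card (?I y) + card ((\<lambda>j. (min i j, max i j)) ` {1..n})" by (rule card_Un_le)
  also have "card ((\<lambda>j. (min i j, max i j)) ` {1..n}) \<le> n"
    using card_image_le[of "{1..n}" "\<lambda>j. (min i j, max i j)"] by simp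
  finally show ?thesis by (simp add: inv_number_def)
qed

text \<open>The largest factor by which \<open>n\<close> additional or missing inversions change a weight.\<close>

definition site_ratio :: "nat \<Rightarrow> real \<Rightarrow> real" where
  "site_ratio n q = max q (1 / q) ^ n"

lemma site_ratio_ge_1: "0 < q \<Longrightarrow> 1 \<le> site_ratio n q"
proof -
  assume q: "0 < q"
  have "1 \<le> q \<or> 1 \<le> 1 / q" using q by (auto simp: pos_le_divide_eq)
  then have "1 \<le> max q (1 / q)" by (simp add: le_max_iff_disj)
  then show ?thesis unfolding site_ratio_def by (rule one_le_power)
qed

lemma power_le_site_ratio:
  assumes q: "0 < q" and "a \<le> b + n" "b \<le> a + n"
  shows "q ^ a \<le> site_ratio n q * q ^ b"
proof (cases "1 \<le> q")
  case True
  have "q ^ a \<le> q ^ (n + b)" using True assms by (intro power_increasing) auto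
  also have "\<dots> = q ^ n * q ^ b" by (simp add: power_add)
  also have "\<dots> \<le> site_ratio n q * q ^ b"
    unfolding site_ratio_def using q by (intro mult_right_mono power_mono) auto
  finally show ?thesis .
next
  case False
  have "q ^ (n + a) \<le> q ^ b" using False assms by (intro power_decreasing) auto
  then have "q ^ n * q ^ a \<le> q ^ b" by (simp add: power_add)
  then have "q ^ a \<le> (1 / q) ^ n * q ^ b" using q by (simp add: field_simps)
  also have "\<dots> \<le> site_ratio n q * q ^ b"
    unfolding site_ratio_def using q by (intro mult_right_mono power_mono) auto
  finally show ?thesis .
qed

lemma weight_update:
  assumes "0 < q" "i \<in> {1..n}"
  shows "q ^ inv_number n y \<le> site_ratio n q * q ^ inv_number n (y(i := t))"
  using assms inv_number_update[of i n y t] inv_number_update[of i n "y(i := t)" "y i"]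
  by (intro power_le_site_ratio) auto

definition words :: "nat \<Rightarrow> nat \<Rightarrow> (nat \<Rightarrow> nat) set" where
  "words n R = {1..n} \<rightarrow>\<^sub>E {1..R}"

definition weight :: "nat \<Rightarrow> real \<Rightarrow> (nat \<Rightarrow> nat) set \<Rightarrow> real" where
  "weight n q A = (\<Sum>y\<in>A. q ^ inv_number n y)"

lemma finite_words [simp]: "finite (words n R)"
  by (simp add: words_def finite_PiE)

lemma words_update: "y \<in> words n R \<Longrightarrow> i \<in> {1..n} \<Longrightarrow> t \<in> {1..R} \<Longrightarrow> y(i := t) \<in> words n R"
  unfolding words_def by (auto simp: PiE_iff extensional_def)

lemma weight_words_pos:
  assumes "0 < q" "0 < R"
  shows "0 < weight n q (words n R)"
proof -
  have "words n R \<noteq> {}" using assms(2) by (simp add: words_def PiE_eq_empty_iff)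
  then show ?thesis unfolding weight_def using assms(1) by (intro sum_pos) auto
qed

lemma weight_mono: "0 < q \<Longrightarrow> A \<subseteq> B \<Longrightarrow> finite B \<Longrightarrow> weight n q A \<le> weight n q B"
  unfolding weight_def by (intro sum_mono2) auto

definition word_pmf :: "nat \<Rightarrow> real \<Rightarrow> nat \<Rightarrow> (nat \<Rightarrow> nat) pmf" where
  "word_pmf n q R =
    embed_pmf (\<lambda>y. if y \<in> words n R then q ^ inv_number n y / weight n q (words n R) else 0)"

lemma pmf_word_pmf:
  assumes "0 < q" "0 < R"
  shows "pmf (word_pmf n q R) y =
    (if y \<in> words n R then q ^ inv_number n y / weight n q (words n R) else 0)"
  unfolding word_pmf_def
proof (rule pmf_embed_pmf)
  note pos = weight_words_pos[OF assms, of n]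
  let ?f = "\<lambda>y. if y \<in> words n R then q ^ inv_number n y / weight n q (words n R) else 0"
  show "0 \<le> ?f y" for y using assms pos by simp
  have "(\<integral>\<^sup>+y. ennreal (?f y) \<partial>count_space UNIV) = (\<Sum>y\<in>words n R. ennreal (?f y))"
    by (rule nn_integral_count_space'[OF finite_words]) auto
  also have "\<dots> = ennreal (\<Sum>y\<in>words n R. ?f y)" using assms pos by (intro sum_ennreal) auto
  also have "(\<Sum>y\<in>words n R. ?f y) = 1"
    using pos by (simp add: weight_def flip: sum_divide_distrib)
  finally show "(\<integral>\<^sup>+y. ennreal (?f y) \<partial>count_space UNIV) = 1" by simp
qed

lemma set_word_pmf: "0 < q \<Longrightarrow> 0 < R \<Longrightarrow> set_pmf (word_pmf n q R) = words n R"
  using weight_words_pos[of q R n] by (auto simp: set_pmf_eq pmf_word_pmf)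

lemma prob_word_pmf:
  assumes "0 < q" "0 < R"
  shows "measure_pmf.prob (word_pmf n q R) A = weight n q (words n R \<inter> A) / weight n q (words n R)"
proof -
  have "measure_pmf.prob (word_pmf n q R) A = measure_pmf.prob (word_pmf n q R) (words n R \<inter> A)"
    unfolding set_word_pmf[OF assms, symmetric] Int_commute[of _ A] measure_Int_set_pmf ..
  also have "\<dots> = (\<Sum>y\<in>words n R \<inter> A. q ^ inv_number n y / weight n q (words n R))"
    by (simp add: measure_measure_pmf_finite pmf_word_pmf[OF assms])
  finally show ?thesis by (simp add: weight_def sum_divide_distrib)
qed

primrec subword :: "(nat \<Rightarrow> nat) \<Rightarrow> nat \<Rightarrow> (nat \<Rightarrow> nat) \<Rightarrow> nat list" where
  "subword b 0 y = []"
| "subword b (Suc j) y = y (b (Suc j)) # subword b j y"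

lemma length_subword [simp]: "length (subword b j y) = j"
  by (induction j) auto

lemma subword_map: "subword b j y = map (\<lambda>i. y (b i)) (rev [1..<Suc j])"
  by (induction j) auto

lemma incr_tuples_inj: "b \<in> incr_tuples n m \<Longrightarrow> i \<in> {1..m} \<Longrightarrow> j \<in> {1..m} \<Longrightarrow> b i = b j \<longleftrightarrow> i = j"
  by (rule inj_on_eq_iff[of b "{1..m}"]) (auto simp: incr_tuples_def intro: strict_mono_on_imp_inj_on)

lemma incr_tuples_range: "b \<in> incr_tuples n m \<Longrightarrow> i \<in> {1..m} \<Longrightarrow> b i \<in> {1..n}"
  by (auto simp: incr_tuples_def)

text \<open>Overwriting the next letter \<open>t\<close> by \<open>t'\<close> is injective on the words that continue the history \<open>ys\<close>
  with \<open>t\<close>, and it changes each weight by a bounded factor.\<close>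

lemma weight_next_letter:
  assumes q: "0 < q" and b: "b \<in> incr_tuples n m" and j: "j < m" and t: "t' \<in> {1..R}"
  shows "weight n q (words n R \<inter> {y. subword b (Suc j) y = t # ys}) \<le>
    site_ratio n q * weight n q (words n R \<inter> {y. subword b (Suc j) y = t' # ys})"
proof -
  define i where "i = b (Suc j)"
  define S where "S = (\<lambda>t. words n R \<inter> {y. subword b (Suc j) y = t # ys})"
  have i: "i \<in> {1..n}" unfolding i_def using j by (intro incr_tuples_range[OF b]) auto
  have sub: "subword b j (y(i := u)) = subword b j y" for y u
    unfolding subword_map i_def using j incr_tuples_inj[OF b] by (intro map_cong) auto
  have S: "y i = t" if "y \<in> S t" for y t using that by (auto simp: S_def i_def)
  have inj: "inj_on (\<lambda>y. y(i := t')) (S t)"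
  proof (rule inj_onI)
    fix y z assume "y \<in> S t" "z \<in> S t" and eq: "y(i := t') = z(i := t')"
    then have "y i = z i" using S[of y t] S[of z t] by simp
    then show "y = z" using eq by (metis fun_upd_triv fun_upd_upd)
  qed
  have img: "(\<lambda>y. y(i := t')) ` S t \<subseteq> S t'"
  proof
    fix z assume "z \<in> (\<lambda>y. y(i := t')) ` S t"
    then obtain y where y: "y \<in> S t" "z = y(i := t')" by blast
    then have "z \<in> words n R" using words_update[OF _ i t] by (simp add: S_def)
    moreover have "subword b (Suc j) z = t' # ys"
      using y sub by (simp add: S_def i_def)
    ultimately show "z \<in> S t'" by (simp add: S_def)
  qed
  have "weight n q (S t) \<le> (\<Sum>y\<in>S t. site_ratio n q * q ^ inv_number n (y(i := t')))"
    unfolding weight_def by (intro sum_mono weight_update q i)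
  also have "\<dots> = site_ratio n q * weight n q ((\<lambda>y. y(i := t')) ` S t)"
    unfolding weight_def sum.reindex[OF inj] by (simp add: sum_distrib_left)
  also have "\<dots> \<le> site_ratio n q * weight n q (S t')"
    using site_ratio_ge_1[OF q, of n]
    by (intro mult_left_mono weight_mono[OF q] img) (auto simp: S_def)
  finally show ?thesis unfolding S_def .
qed

text \<open>Histories that cannot occur get the uniform law, so that the bounds below hold for all histories.\<close>

definition letter_kernel :: "nat \<Rightarrow> real \<Rightarrow> nat \<Rightarrow> nat \<Rightarrow> (nat \<Rightarrow> nat) \<Rightarrow> nat list \<Rightarrow> nat pmf" where
  "letter_kernel n q R m b ys =
    (if length ys < m \<and> set_pmf (word_pmf n q R) \<inter> {y. subword b (length ys) y = ys} \<noteq> {}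
     then map_pmf (\<lambda>y. y (b (Suc (length ys)))) (cond_pmf (word_pmf n q R) {y. subword b (length ys) y = ys})
     else pmf_of_set {1..R})"

lemma prob_cond_pmf:
  assumes "set_pmf p \<inter> S \<noteq> {}"
  shows "measure_pmf.prob (cond_pmf p S) A = measure_pmf.prob p (S \<inter> A) / measure_pmf.prob p S"
proof -
  have "emeasure p S \<noteq> 0"
    using measure_measure_pmf_not_zero[OF assms] by (simp add: measure_pmf.emeasure_eq_measure)
  then show ?thesis
    unfolding cond_pmf.rep_eq[OF assms]
    by (intro measure_uniform_measure) (auto simp: measure_pmf.emeasure_eq_measure)
qed

text \<open>By the previous comparison, all possible next letters have the same conditional probability up to the
  factor \<open>site_ratio n q\<close>. Letters at positions that are not read are summed over, which is why the bound does
  not depend on \<open>b\<close>.\<close>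

lemma letter_kernel_bounds:
  assumes q: "0 < q" and R: "0 < R" and b: "b \<in> incr_tuples n m"
  shows "set_pmf (letter_kernel n q R m b ys) \<subseteq> {1..R}"
    and "pmf (pmf_of_set {1..R}) t \<le> site_ratio n q * pmf (letter_kernel n q R m b ys) t"
    and "pmf (letter_kernel n q R m b ys) t \<le> site_ratio n q * pmf (pmf_of_set {1..R}) t"
proof -
  let ?M = "word_pmf n q R" and ?c = "site_ratio n q" and ?K = "letter_kernel n q R m b ys"
  define j where "j = length ys"
  have c: "1 \<le> ?c" by (rule site_ratio_ge_1[OF q])
  have "set_pmf ?K \<subseteq> {1..R} \<and> (\<forall>t. pmf (pmf_of_set {1..R}) t \<le> ?c * pmf ?K t \<and>
      pmf ?K t \<le> ?c * pmf (pmf_of_set {1..R}) t)"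
  proof (cases "j < m \<and> set_pmf ?M \<inter> {y. subword b j y = ys} \<noteq> {}")
    case False
    then have "?K = pmf_of_set {1..R}" by (auto simp: letter_kernel_def j_def)
    moreover have "pmf (pmf_of_set {1..R}) t \<le> ?c * pmf (pmf_of_set {1..R}) t" for t
      using mult_right_mono[OF c, of "pmf (pmf_of_set {1..R}) t"] by simp
    moreover have "set_pmf (pmf_of_set {1..R}) = {1..R}" using R by (intro set_pmf_of_set) auto
    ultimately show ?thesis by simp
  next
    case True
    define S where "S = {y. subword b j y = ys}"
    define W where "W = (\<lambda>t. weight n q (words n R \<inter> {y. subword b (Suc j) y = t # ys}))"
    define W0 where "W0 = weight n q (words n R \<inter> S)"
    have K: "?K = map_pmf (\<lambda>y. y (b (Suc j))) (cond_pmf ?M S)"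
      using True by (auto simp: letter_kernel_def j_def S_def)
    have ne: "set_pmf ?M \<inter> S \<noteq> {}" using True by (simp add: S_def)
    have range: "b (Suc j) \<in> {1..n}" using True by (intro incr_tuples_range[OF b]) auto
    then have letter: "y (b (Suc j)) \<in> {1..R}" if "y \<in> words n R" for y
      using that by (auto simp: words_def)
    have supp: "set_pmf ?K \<subseteq> {1..R}"
      unfolding K using ne letter by (auto simp: set_word_pmf[OF q R])
    have W: "W t \<le> ?c * W t'" if "t' \<in> {1..R}" for t t'
      unfolding W_def using True that by (intro weight_next_letter[OF q b]) auto
    have sum_W: "(\<Sum>t\<in>{1..R}. W t) = W0"
    proof -
      have "words n R \<inter> S = (\<Union>t\<in>{1..R}. words n R \<inter> {y. subword b (Suc j) y = t # ys})"
        using letter by (auto simp: S_def)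
      then have "W0 = (\<Sum>y\<in>(\<Union>t\<in>{1..R}. words n R \<inter> {y. subword b (Suc j) y = t # ys}). q ^ inv_number n y)"
        by (simp only: W0_def weight_def)
      also have "\<dots> = (\<Sum>t\<in>{1..R}. W t)"
        unfolding W_def weight_def by (rule sum.UNION_disjoint) auto
      finally show ?thesis ..
    qed
    have W0: "0 < W0"
    proof -
      have "words n R \<inter> S \<noteq> {}" using ne by (simp add: set_word_pmf[OF q R])
      then show ?thesis unfolding W0_def weight_def using q by (intro sum_pos) auto
    qed
    have pmf_K: "pmf ?K t = W t / W0" for t
    proof -
      have "pmf ?K t = measure_pmf.prob (cond_pmf ?M S) ((\<lambda>y. y (b (Suc j))) -` {t})"
        unfolding K by (simp add: pmf_map)
      also have "\<dots> = W t / W0"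
      proof -
        have "words n R \<inter> (S \<inter> (\<lambda>y. y (b (Suc j))) -` {t}) =
            words n R \<inter> {y. subword b (Suc j) y = t # ys}"
          by (auto simp: S_def)
        then show ?thesis
          unfolding prob_cond_pmf[OF ne] prob_word_pmf[OF q R] W_def W0_def
          using weight_words_pos[OF q R, of n] by simp
      qed
      finally show ?thesis .
    qed
    have lower: "1 / real R \<le> ?c * pmf ?K t" if t: "t \<in> {1..R}" for t
    proof -
      have "W0 \<le> (\<Sum>t'\<in>{1..R}. ?c * W t)" unfolding sum_W[symmetric] by (intro sum_mono W t)
      also have "\<dots> = real R * (?c * W t)" by simp
      finally have "W0 / (real R * W0) \<le> real R * (?c * W t) / (real R * W0)"
        using W0 by (intro divide_right_mono) auto
      then show ?thesis using W0 R by (simp add: pmf_K)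
    qed
    have upper: "pmf ?K t \<le> ?c / real R" for t
    proof -
      have "real R * W t = (\<Sum>t'\<in>{1..R}. W t)" by simp
      also have "\<dots> \<le> (\<Sum>t'\<in>{1..R}. ?c * W t')" by (intro sum_mono W)
      also have "\<dots> = ?c * W0" unfolding sum_W[symmetric] by (rule sum_distrib_left[symmetric])
      finally have "real R * W t / (real R * W0) \<le> ?c * W0 / (real R * W0)"
        using W0 by (intro divide_right_mono) auto
      then show ?thesis using W0 R by (simp add: pmf_K)
    qed
    show ?thesis
    proof (intro conjI allI supp)
      fix t
      show "pmf (pmf_of_set {1..R}) t \<le> ?c * pmf ?K t"
      proof (cases "t \<in> {1..R}")
        case True
        then show ?thesis using lower[OF True] R by simp
      next
        case False
        then have "pmf (pmf_of_set {1..R}) t = 0" using R by (auto simp: indicator_def)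
        moreover have "0 \<le> ?c * pmf ?K t" using c by (intro mult_nonneg_nonneg) auto
        ultimately show ?thesis by simp
      qed
      show "pmf ?K t \<le> ?c * pmf (pmf_of_set {1..R}) t"
      proof (cases "t \<in> {1..R}")
        case False
        then have "pmf ?K t = 0" using supp by (auto simp: pmf_eq_0_set_pmf)
        then show ?thesis using c by simp
      next
        case True
        then show ?thesis using upper[of t] R by simp
      qed
    qed
  qed
  then show "set_pmf ?K \<subseteq> {1..R}" "pmf (pmf_of_set {1..R}) t \<le> ?c * pmf ?K t"
    "pmf ?K t \<le> ?c * pmf (pmf_of_set {1..R}) t" by blast+
qed

lemma kernel_seq_letter_kernel:
  assumes q: "0 < q" and R: "0 < R" and "j \<le> m"
  shows "kernel_seq j (letter_kernel n q R m b) [] = map_pmf (subword b j) (word_pmf n q R)"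
  using \<open>j \<le> m\<close>
proof (induction j)
  case 0
  then show ?case by (simp add: map_pmf_const)
next
  case (Suc j)
  let ?M = "word_pmf n q R"
  define C where "C = (\<lambda>zs. cond_pmf ?M {y. subword b j y = zs})"
  have "kernel_seq (Suc j) (letter_kernel n q R m b) [] =
      map_pmf (subword b j) ?M \<bind> (\<lambda>zs. map_pmf (\<lambda>t. t # zs) (letter_kernel n q R m b zs))"
    using Suc by (simp only: kernel_seq_Suc_last)
  also have "\<dots> = map_pmf (subword b j) ?M \<bind> (\<lambda>zs. map_pmf (subword b (Suc j)) (C zs))"
  proof (rule bind_pmf_cong[OF refl])
    fix zs assume "zs \<in> set_pmf (map_pmf (subword b j) ?M)"
    then have len: "length zs = j" and ne: "set_pmf ?M \<inter> {y. subword b j y = zs} \<noteq> {}" by auto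
    then have K: "letter_kernel n q R m b zs = map_pmf (\<lambda>y. y (b (Suc j))) (C zs)"
      using Suc.prems unfolding letter_kernel_def C_def by simp
    show "map_pmf (\<lambda>t. t # zs) (letter_kernel n q R m b zs) = map_pmf (subword b (Suc j)) (C zs)"
      unfolding K C_def map_pmf_comp
      by (intro map_pmf_cong refl) (simp add: set_cond_pmf[OF ne])
  qed
  also have "\<dots> = map_pmf (subword b (Suc j)) (map_pmf (subword b j) ?M \<bind> C)"
    by (simp add: map_bind_pmf)
  also have "map_pmf (subword b j) ?M \<bind> C = ?M"
    unfolding C_def by (rule bind_cond_pmf_cancel) (auto simp: vimage_def)
  finally show ?case .
qed

lemma comparable_letter_kernel:
  assumes "0 < q" "0 < R" "b \<in> incr_tuples n m"
  shows "comparable (1 / site_ratio n q) R (letter_kernel n q R m b)"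
proof -
  have c: "0 < site_ratio n q" using site_ratio_ge_1[OF assms(1), of n] by linarith
  have div: "1 / site_ratio n q * x \<le> y" if "x \<le> site_ratio n q * y" for x y
    using that c by (simp add: pos_divide_le_eq mult.commute)
  show ?thesis
    unfolding comparable_def using letter_kernel_bounds[OF assms] by (blast intro: div)
qed

text \<open>Forgetting the actual letters, a word without repetitions is a permutation.\<close>

definition words_of_pattern :: "nat \<Rightarrow> nat \<Rightarrow> (nat \<Rightarrow> nat) \<Rightarrow> (nat \<Rightarrow> nat) set" where
  "words_of_pattern n R p = {y \<in> words n R. \<forall>i\<in>{1..n}. \<forall>j\<in>{1..n}. y i < y j \<longleftrightarrow> p i < p j}"

lemma inv_number_pattern:
  assumes "y \<in> words_of_pattern n R p"
  shows "inv_number n y = inv_number n p"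
  unfolding inv_number_def using assms
  by (intro arg_cong[where f = card] Collect_cong) (auto simp: words_of_pattern_def)

lemma card_words_of_pattern:
  assumes p: "p permutes {1..n}"
  shows "card (words_of_pattern n R p) = card (words_of_pattern n R id)"
proof -
  have in_n: "p i \<in> {1..n} \<longleftrightarrow> i \<in> {1..n}" for i using p by (rule permutes_in_image)
  have inv_n: "inv p i \<in> {1..n} \<longleftrightarrow> i \<in> {1..n}" for i
    using permutes_inv[OF p] by (rule permutes_in_image)
  have pi: "p (inv p i) = i" "inv p (p i) = i" for i using permutes_inverses[OF p] by auto
  have comp: "y \<circ> r \<in> words n R" if y: "y \<in> words n R" and r: "\<And>i. r i \<in> {1..n} \<longleftrightarrow> i \<in> {1..n}" for y r
    unfolding words_def
  proof (rule PiE_I)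
    fix i assume "i \<in> {1..n}"
    then have "r i \<in> {1..n}" using r by blast
    then show "(y \<circ> r) i \<in> {1..R}" using y unfolding words_def o_apply by (rule PiE_mem[rotated])
  next
    fix i assume "i \<notin> {1..n}"
    then have "r i \<notin> {1..n}" using r by blast
    then show "(y \<circ> r) i = undefined" using y unfolding words_def o_apply by (rule PiE_arb[rotated])
  qed
  \<comment> \<open>Permuting the positions turns increasing words into words of pattern \<open>p\<close>.\<close>
  have "bij_betw (\<lambda>y. y \<circ> p) (words_of_pattern n R id) (words_of_pattern n R p)"
  proof (rule bij_betwI[where g = "\<lambda>y. y \<circ> inv p"])
    show "(\<lambda>y. y \<circ> p) \<in> words_of_pattern n R id \<rightarrow> words_of_pattern n R p"
      using comp[of _ p] in_n by (auto simp: words_of_pattern_def)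
    show "(\<lambda>y. y \<circ> inv p) \<in> words_of_pattern n R p \<rightarrow> words_of_pattern n R id"
      using comp[of _ "inv p"] inv_n pi by (auto simp: words_of_pattern_def)
  qed (auto simp: fun_eq_iff pi)
  then show ?thesis by (rule bij_betw_same_card[symmetric])
qed

lemma pattern_of_injective:
  assumes y: "y \<in> words n R" "inj_on y {1..n}"
  shows "\<exists>p. p permutes {1..n} \<and> y \<in> words_of_pattern n R p"
proof -
  define p where "p = induced_perm n y id"
  have less: "p i < p j \<longleftrightarrow> y i < y j" if "i \<in> {1..n}" "j \<in> {1..n}" for i j
    using induced_perm_less_iff[of i n j y id] that by (simp add: p_def)
  have inj: "inj_on p {1..n}"
  proof (rule inj_onI)
    fix i j assume ij: "i \<in> {1..n}" "j \<in> {1..n}" "p i = p j"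
    then have "y i = y j" using less[of i j] less[of j i] by simp
    then show "i = j" using ij inj_onD[OF y(2)] by blast
  qed
  have "p i \<in> {1..n}" if "i \<in> {1..n}" for i
  proof -
    let ?S = "{k \<in> {1..n}. y k \<le> y i}"
    have "card ?S \<le> card {1..n}" by (intro card_mono) auto
    moreover have "card {i} \<le> card ?S" using that by (intro card_mono) auto
    ultimately show ?thesis using that by (auto simp: p_def induced_perm_def)
  qed
  then have "bij_betw p {1..n} {1..n}"
    unfolding bij_betw_def using inj endo_inj_surj[OF finite_atLeastAtMost, of p] by blast
  then have "p permutes {1..n}"
    by (rule bij_imp_permutes) (auto simp: p_def induced_perm_def)
  then show ?thesis using y(1) less by (auto simp: words_of_pattern_def)
qed

text \<open>A permutation is determined by its order relation, because its values are the ranks.\<close>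

lemma words_of_pattern_disjoint:
  assumes p: "p permutes {1..n}" "p' permutes {1..n}" and y: "y \<in> words_of_pattern n R p" "y \<in> words_of_pattern n R p'"
  shows "p = p'"
proof -
  have less: "p i < p j \<longleftrightarrow> p' i < p' j" if "i \<in> {1..n}" "j \<in> {1..n}" for i j
    using y that by (auto simp: words_of_pattern_def)
  have rank: "r i = card {j \<in> {1..n}. r j < r i} + 1" if r: "r permutes {1..n}" and i: "i \<in> {1..n}" for r i
  proof -
    have ri: "r i \<in> {1..n}" using permutes_in_image[OF r] i by blast
    have "r ` {j \<in> {1..n}. r j < r i} = {1..<r i}"
    proof (intro equalityI subsetI)
      fix x assume x: "x \<in> {1..<r i}"
      then have "x \<in> r ` {1..n}" using permutes_image[OF r] ri by auto
      then show "x \<in> r ` {j \<in> {1..n}. r j < r i}" using x by auto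
    next
      fix x assume "x \<in> r ` {j \<in> {1..n}. r j < r i}"
      then show "x \<in> {1..<r i}" using permutes_in_image[OF r] by force
    qed
    moreover have "card (r ` {j \<in> {1..n}. r j < r i}) = card {j \<in> {1..n}. r j < r i}"
      by (intro card_image inj_on_subset[OF permutes_inj[OF r]]) auto
    ultimately have "card {j \<in> {1..n}. r j < r i} = r i - 1" by (metis card_atLeastLessThan)
    then show ?thesis unfolding \<open>card {j \<in> {1..n}. r j < r i} = r i - 1\<close> using ri by simp
  qed
  show ?thesis
  proof
    fix i
    show "p i = p' i"
    proof (cases "i \<in> {1..n}")
      case True
      have "{j \<in> {1..n}. p j < p i} = {j \<in> {1..n}. p' j < p' i}" using less True by auto
      then show ?thesis using rank[OF p(1) True] rank[OF p(2) True] by simp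
    qed (use p in \<open>auto simp: permutes_def\<close>)
  qed
qed

lemma sorted_wrt_subseq: "subseq xs ys \<Longrightarrow> sorted_wrt P ys \<Longrightarrow> sorted_wrt P xs"
proof (induction rule: list_emb.induct)
  case (list_emb_Cons2 x y xs ys)
  have "set xs \<subseteq> set ys"
    using list_emb_Cons2.hyps(2) set_nths_subset unfolding subseq_conv_nths by fast
  then show ?case using list_emb_Cons2 by auto
qed auto

lemma LIS_eq_lds:
  assumes less: "\<And>i j. i \<in> {1..m} \<Longrightarrow> j \<in> {1..m} \<Longrightarrow> s i < s j \<longleftrightarrow> f i < (f j :: nat)"
  shows "LIS m s = lds (map f (rev [1..<Suc m]))"
proof (rule antisym)
  let ?L = "rev [1..<Suc m]"
  let ?F = "{card A | A. A \<subseteq> {1..m} \<and> strict_mono_on A s}"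
  have sorted: "sorted_wrt (>) ?L" by (simp add: sorted_wrt_rev del: upt_Suc)
  have fin: "finite ?F"
    by (rule finite_subset[of _ "card ` Pow {1..m}"]) auto
  have "?F \<noteq> {}" by (auto intro!: exI[of _ "{}"])
  then have "LIS m s \<in> ?F" unfolding LIS_def by (intro Max_in fin)
  then obtain A where A: "LIS m s = card A" "A \<subseteq> {1..m}" "strict_mono_on A s" by blast
  define l where "l = filter (\<lambda>i. i \<in> A) ?L"
  have set_l: "set l = A" using A(2) by (auto simp: l_def)
  have "sorted_wrt (>) l" unfolding l_def by (intro sorted_wrt_filter sorted)
  then have "sorted_wrt (\<lambda>i j. f i > f j) l"
  proof (rule sorted_wrt_mono_rel[rotated])
    fix i j assume "i \<in> set l" "j \<in> set l" "i > j"
    then have "i \<in> {1..m}" "j \<in> {1..m}" "s j < s i"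
      using A(2) set_l strict_mono_onD[OF A(3)] by blast+
    then show "f i > f j" using less by blast
  qed
  then have "sorted_wrt (>) (map f l)" by (simp add: sorted_wrt_map)
  moreover have "subseq (map f l) (map f ?L)" unfolding l_def by (intro subseq_map subseq_filter_left)
  ultimately have "length (map f l) \<le> lds (map f ?L)" by (intro length_le_lds)
  moreover have "length l = card A"
    using distinct_card[of l] set_l by (simp add: l_def)
  ultimately show "LIS m s \<le> lds (map f ?L)" using A(1) by simp
  obtain ys where ys: "subseq ys (map f ?L)" "sorted_wrt (>) ys" "length ys = lds (map f ?L)"
    by (rule lds_attained)
  then obtain N where N: "ys = map f (nths ?L N)" by (auto simp: subseq_conv_nths nths_map)
  define k where "k = nths ?L N"
  have k: "sorted_wrt (>) k" unfolding k_def by (rule sorted_wrt_subseq[OF _ sorted]) (auto simp: subseq_conv_nths)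
  have k': "sorted_wrt (\<lambda>i j. f i > f j) k" using ys(2) by (simp add: N k_def sorted_wrt_map)
  have sub: "set k \<subseteq> {1..m}" using set_nths_subset[of ?L N] by (auto simp: k_def)
  have "strict_mono_on (set k) s"
  proof (rule strict_mono_onI)
    fix i j assume ij: "i \<in> set k" "j \<in> set k" "i < j"
    then obtain a c where ac: "a < length k" "k ! a = i" "c < length k" "k ! c = j" by (auto simp: in_set_conv_nth)
    have "c < a"
    proof (rule ccontr)
      assume "\<not> c < a"
      then have "a < c \<or> a = c" by auto
      then show False using sorted_wrt_nth_less[OF k, of a c] ac ij by auto
    qed
    then have "f j > f i" using sorted_wrt_nth_less[OF k', of c a] ac by simp
    then show "s i < s j" using less[of i j] sub ij by blast
  qed
  then have "card (set k) \<in> ?F" using sub by blast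
  then have "card (set k) \<le> LIS m s" unfolding LIS_def by (intro Max_ge fin)
  moreover have "card (set k) = length k"
    by (intro distinct_card) (simp add: k_def distinct_nthsI)
  ultimately show "lds (map f ?L) \<le> LIS m s" using ys(3) by (simp add: N k_def)
qed

lemma LIS_induced_perm:
  assumes "y \<in> words_of_pattern n R p" "b \<in> incr_tuples n m"
  shows "LIS m (induced_perm m p b) = lds (subword b m y)"
  unfolding subword_map
proof (rule LIS_eq_lds)
  fix i j assume ij: "i \<in> {1..m}" "j \<in> {1..m}"
  then have "b i \<in> {1..n}" "b j \<in> {1..n}" using incr_tuples_range[OF assms(2)] by auto
  then show "induced_perm m p b i < induced_perm m p b j \<longleftrightarrow> y (b i) < y (b j)"
    using assms(1) induced_perm_less_iff[OF ij] by (auto simp: words_of_pattern_def)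
qed

text \<open>Given \<open>y j\<close>, the letter \<open>y i\<close> hits it with conditional probability at most \<open>site_ratio n q / R\<close>. In terms of
  weights, a word with \<open>y i = y j\<close> is compared with the \<open>R\<close> words obtained by changing \<open>y i\<close>.\<close>

lemma prob_repetition:
  assumes q: "0 < q" and R: "0 < R" and ij: "i \<in> {1..n}" "j \<in> {1..n}" "i \<noteq> j"
  shows "measure_pmf.prob (word_pmf n q R) {y. y i = y j} \<le> site_ratio n q / real R"
proof -
  define S where "S = words n R \<inter> {y. y i = y j}"
  define \<phi> where "\<phi> = (\<lambda>(y, t). (y::nat \<Rightarrow> nat)(i := t))"
  have inj: "inj_on \<phi> (S \<times> {1..R})"
  proof (rule inj_onI, clarify)
    fix y t z u assume yz: "y \<in> S" "z \<in> S" and eq: "\<phi> (y, t) = \<phi> (z, u)"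
    have upd: "y(i := t) = z(i := u)" using eq by (simp add: \<phi>_def)
    then have tu: "t = u" by (metis fun_upd_same)
    have "y j = z j" using upd ij(3) by (metis fun_upd_other)
    then have "y i = z i" using yz by (simp add: S_def)
    then show "y = z \<and> t = u" using upd tu by (metis fun_upd_triv fun_upd_upd)
  qed
  have img: "\<phi> ` (S \<times> {1..R}) \<subseteq> words n R"
    using words_update ij(1) by (auto simp: \<phi>_def S_def)
  have "real R * weight n q S = (\<Sum>y\<in>S. \<Sum>t\<in>{1..R}. q ^ inv_number n y)"
    by (simp add: weight_def sum_distrib_left)
  also have "\<dots> \<le> (\<Sum>y\<in>S. \<Sum>t\<in>{1..R}. site_ratio n q * q ^ inv_number n (y(i := t)))"
    by (intro sum_mono weight_update q ij)
  also have "\<dots> = (\<Sum>x\<in>S \<times> {1..R}. site_ratio n q * q ^ inv_number n (\<phi> x))"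
    by (simp add: sum.cartesian_product \<phi>_def case_prod_unfold)
  also have "\<dots> = site_ratio n q * weight n q (\<phi> ` (S \<times> {1..R}))"
    unfolding weight_def sum.reindex[OF inj] by (simp add: sum_distrib_left)
  also have "\<dots> \<le> site_ratio n q * weight n q (words n R)"
    using site_ratio_ge_1[OF q, of n] by (intro mult_left_mono weight_mono[OF q] img) auto
  finally have "real R * weight n q S / (real R * weight n q (words n R)) \<le>
      site_ratio n q * weight n q (words n R) / (real R * weight n q (words n R))"
    using weight_words_pos[OF q R, of n] by (intro divide_right_mono) auto
  then show ?thesis
    unfolding prob_word_pmf[OF q R] S_def[symmetric]
    using weight_words_pos[OF q R, of n] R by simp
qed

lemma prob_injective:
  assumes q: "0 < q" and R: "0 < R" "2 * (real n)\<^sup>2 * site_ratio n q \<le> real R"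
  shows "1 / 2 \<le> measure_pmf.prob (word_pmf n q R) {y. inj_on y {1..n}}"
proof -
  let ?M = "word_pmf n q R"
  define I where "I = {(i, j) \<in> {1..n} \<times> {1..n}. i \<noteq> j}"
  have finI: "finite I" unfolding I_def by (rule finite_subset[of _ "{1..n} \<times> {1..n}"]) auto
  have c: "0 \<le> site_ratio n q" using site_ratio_ge_1[OF q, of n] by linarith
  have "card I \<le> card ({1..n} \<times> {1..n})" unfolding I_def by (intro card_mono) auto
  then have cardI: "real (card I) \<le> (real n)\<^sup>2"
    by (simp add: power2_eq_square flip: of_nat_mult)
  have "measure_pmf.prob ?M (- {y. inj_on y {1..n}}) \<le> measure_pmf.prob ?M (\<Union>x\<in>I. {y. y (fst x) = y (snd x)})"
  proof (rule measure_pmf.finite_measure_mono)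
    show "- {y. inj_on y {1..n}} \<subseteq> (\<Union>x\<in>I. {y. y (fst x) = y (snd x)})"
      by (force simp: inj_on_def I_def)
  qed simp
  also have "\<dots> \<le> (\<Sum>x\<in>I. measure_pmf.prob ?M {y. y (fst x) = y (snd x)})"
    by (intro measure_UNION_le finI) auto
  also have "\<dots> \<le> (\<Sum>x\<in>I. site_ratio n q / real R)"
    by (intro sum_mono prob_repetition q R) (auto simp: I_def)
  also have "\<dots> = real (card I) * (site_ratio n q / real R)" by simp
  also have "\<dots> \<le> (real n)\<^sup>2 * (site_ratio n q / real R)"
    using cardI c by (intro mult_right_mono) auto
  also have "\<dots> \<le> 1 / 2" using R by (simp add: field_simps)
  finally show ?thesis
    using measure_pmf.prob_compl[of "{y. inj_on y {1..n}}" ?M] by (simp add: Compl_eq_Diff_UNIV)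
qed

lemma weight_of_patterns:
  assumes "A \<subseteq> {p. p permutes {1..n}}"
  shows "weight n q (\<Union>p\<in>A. words_of_pattern n R p) =
    real (card (words_of_pattern n R id)) * (\<Sum>p\<in>A. q ^ inv_number n p)"
proof -
  have finA: "finite A" using assms finite_permutations[of "{1..n}"] finite_subset by blast
  have fin: "finite (words_of_pattern n R p)" for p
    by (rule finite_subset[of _ "words n R"]) (auto simp: words_of_pattern_def)
  have "weight n q (\<Union>p\<in>A. words_of_pattern n R p) = (\<Sum>p\<in>A. weight n q (words_of_pattern n R p))"
    unfolding weight_def using finA fin assms words_of_pattern_disjoint
    by (intro sum.UNION_disjoint) blast+
  also have "\<dots> = (\<Sum>p\<in>A. real (card (words_of_pattern n R id)) * q ^ inv_number n p)"
  proof (rule sum.cong[OF refl])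
    fix p assume "p \<in> A"
    then have "card (words_of_pattern n R p) = card (words_of_pattern n R id)"
      using assms card_words_of_pattern by blast
    then show "weight n q (words_of_pattern n R p) = real (card (words_of_pattern n R id)) * q ^ inv_number n p"
      using inv_number_pattern[of _ n R p] by (simp add: weight_def)
  qed
  finally show ?thesis by (simp add: sum_distrib_left)
qed

lemma measure_mallows:
  assumes "0 < q" "A \<subseteq> {p. p permutes {1..n}}"
  shows "measure (mallows n q) A = (\<Sum>p\<in>A. q ^ inv_number n p) / mallows_Z n q"
proof -
  interpret prob_space "mallows n q" by (rule prob_space_mallows[OF assms(1)])
  have "finite A" using assms finite_permutations[of "{1..n}"] finite_subset by blast
  moreover have "{p} \<in> sets (mallows n q)" if "p \<in> A" for p
    using assms that by (auto simp: mallows_def sets_point_measure)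
  ultimately have "measure (mallows n q) A = (\<Sum>p\<in>A. measure (mallows n q) {p})"
    by (rule finite_measure_eq_sum_singleton)
  also have "\<dots> = (\<Sum>p\<in>A. q ^ inv_number n p / mallows_Z n q)"
    using assms by (intro sum.cong refl measure_mallows_singleton) auto
  finally show ?thesis by (simp add: sum_divide_distrib)
qed

text \<open>All patterns are realised by equally many words, so conditioning a random word on having no
  repetition gives the Mallows measure, and this conditioning costs at most a factor \<open>2\<close>.\<close>

lemma mallows_le_kernel_seq:
  assumes q: "0 < q" and R: "0 < R" "2 * (real n)\<^sup>2 * site_ratio n q \<le> real R" and b: "b \<in> incr_tuples n m"
  shows "measure (mallows n q) {p. p permutes {1..n} \<and> P (LIS m (induced_perm m p b))} \<le>
    2 * measure_pmf.prob (kernel_seq m (letter_kernel n q R m b) []) {xs. P (lds xs)}"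
proof -
  let ?M = "word_pmf n q R" and ?S = "{p. p permutes {1..n}}"
  define A where "A = {p. p permutes {1..n} \<and> P (LIS m (induced_perm m p b))}"
  define U where "U = (\<lambda>A. \<Union>p\<in>A. words_of_pattern n R p)"
  define C where "C = real (card (words_of_pattern n R id))"
  define W where "W = weight n q (words n R)"
  have Wpos: "0 < W" unfolding W_def by (rule weight_words_pos[OF q R(1)])
  have U_words: "words n R \<inter> U A = U A" for A by (auto simp: U_def words_of_pattern_def)
  have prob_U: "measure_pmf.prob ?M (U A) = C * (\<Sum>p\<in>A. q ^ inv_number n p) / W" if "A \<subseteq> ?S" for A
    unfolding prob_word_pmf[OF q R(1)] U_words W_def[symmetric] using weight_of_patterns[OF that, of q R]
    by (simp add: U_def C_def)
  have "1 / 2 \<le> measure_pmf.prob ?M {y. inj_on y {1..n}}" by (rule prob_injective[OF q R])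
  also have "\<dots> \<le> measure_pmf.prob ?M (U ?S)"
    using pattern_of_injective by (intro measure_pmf.finite_measure_mono_AE)
      (auto simp: AE_measure_pmf_iff set_word_pmf[OF q R(1)] U_def)
  finally have half: "1 / 2 \<le> C * mallows_Z n q / W"
    using prob_U[of ?S] by (simp add: mallows_Z_def)
  have Z: "0 < mallows_Z n q" by (rule mallows_Z_pos[OF q])
  have subA: "A \<subseteq> ?S" by (auto simp: A_def)
  have mu: "0 \<le> measure (mallows n q) A" by simp
  have "measure (mallows n q) A * mallows_Z n q = (\<Sum>p\<in>A. q ^ inv_number n p)"
    using measure_mallows[OF q subA] Z by simp
  then have "measure (mallows n q) A * (C * mallows_Z n q / W) = measure_pmf.prob ?M (U A)"
    using prob_U[OF subA] by (simp add: mult_ac)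
  moreover have "measure (mallows n q) A * (1 / 2) \<le> measure (mallows n q) A * (C * mallows_Z n q / W)"
    using half mu by (rule mult_left_mono)
  moreover have "measure_pmf.prob ?M (U A) \<le> measure_pmf.prob ?M {y. P (lds (subword b m y))}"
  proof (rule measure_pmf.finite_measure_mono)
    show "U A \<subseteq> {y. P (lds (subword b m y))}"
      using LIS_induced_perm[OF _ b] by (auto simp: U_def A_def)
  qed simp
  moreover have "measure_pmf.prob ?M {y. P (lds (subword b m y))} =
      measure_pmf.prob (kernel_seq m (letter_kernel n q R m b) []) {xs. P (lds xs)}"
    unfolding kernel_seq_letter_kernel[OF q R(1) order_refl] by (simp add: vimage_def)
  ultimately show ?thesis unfolding A_def[symmetric] by linarith
qed

section \<open>The longest increasing subsequence under the Mallows measure\<close>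

text \<open>Since \<open>1 - 1 / q \<le> ln q \<le> q - 1\<close>, the assumption says that \<open>n * ln (q n)\<close> tends to \<open>- \<beta>\<close>, and
  \<open>site_ratio n (q n) = exp \<bar>n * ln (q n)\<bar>\<close>.\<close>

lemma site_ratio_limit:
  assumes pos: "\<And>n. n \<ge> 1 \<Longrightarrow> q n > 0" and lim: "(\<lambda>n. real n * (1 - q n)) \<longlonglongrightarrow> \<beta>"
  shows "(\<lambda>n. 1 / site_ratio n (q n)) \<longlonglongrightarrow> exp (- \<bar>\<beta>\<bar>)"
proof -
  have q1: "q \<longlonglongrightarrow> 1"
  proof -
    have "(\<lambda>n. inverse (real n) * (real n * (1 - q n))) \<longlonglongrightarrow> 0 * \<beta>"
      by (intro tendsto_mult lim tendsto_inverse_0_at_top filterlim_real_sequentially)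
    moreover have "\<forall>\<^sub>F n in sequentially. inverse (real n) * (real n * (1 - q n)) = 1 - q n"
      using eventually_gt_at_top[of 0] by eventually_elim simp
    ultimately have "(\<lambda>n. 1 - q n) \<longlonglongrightarrow> 0 * \<beta>" by (rule Lim_transform_eventually)
    then show ?thesis using tendsto_diff[OF tendsto_const[of 1], of "\<lambda>n. 1 - q n" 0] by simp
  qed
  have "(\<lambda>n. - (real n * (1 - q n)) / q n) \<longlonglongrightarrow> - \<beta> / 1"
    by (intro tendsto_divide tendsto_minus lim q1) simp
  then have lower: "(\<lambda>n. - (real n * (1 - q n)) / q n) \<longlonglongrightarrow> - \<beta>" by simp
  have upper: "(\<lambda>n. - (real n * (1 - q n))) \<longlonglongrightarrow> - \<beta>" by (intro tendsto_minus lim)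
  have "(\<lambda>n. real n * ln (q n)) \<longlonglongrightarrow> - \<beta>"
  proof (rule tendsto_sandwich[OF _ _ lower upper])
    show "\<forall>\<^sub>F n in sequentially. - (real n * (1 - q n)) / q n \<le> real n * ln (q n)"
      using eventually_ge_at_top[of 1]
    proof eventually_elim
      case (elim n)
      have "ln (1 / q n) \<le> 1 / q n - 1" using pos[OF elim] by (intro ln_le_minus_one) simp
      then have "1 - 1 / q n \<le> ln (q n)" using pos[OF elim] by (simp add: ln_div)
      then have "real n * (1 - 1 / q n) \<le> real n * ln (q n)" by (intro mult_left_mono) auto
      then show ?case using pos[OF elim] by (simp add: field_simps)
    qed
    show "\<forall>\<^sub>F n in sequentially. real n * ln (q n) \<le> - (real n * (1 - q n))"
      using eventually_ge_at_top[of 1]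
    proof eventually_elim
      case (elim n)
      have "real n * ln (q n) \<le> real n * (q n - 1)"
        using pos[OF elim] by (intro mult_left_mono ln_le_minus_one) auto
      then show ?case by (simp add: algebra_simps)
    qed
  qed
  then have "(\<lambda>n. exp (- \<bar>real n * ln (q n)\<bar>)) \<longlonglongrightarrow> exp (- \<bar>- \<beta>\<bar>)"
    by (intro tendsto_exp tendsto_minus tendsto_rabs)
  moreover have "\<forall>\<^sub>F n in sequentially. exp (- \<bar>real n * ln (q n)\<bar>) = 1 / site_ratio n (q n)"
    using eventually_ge_at_top[of 1]
  proof eventually_elim
    case (elim n)
    note q = pos[OF elim]
    have "max (q n) (1 / q n) = exp \<bar>ln (q n)\<bar>"
    proof (cases "1 \<le> q n")
      case True
      then have "1 / q n \<le> q n" using q by (simp add: pos_divide_le_eq) (metis mult_mono' mult_1 order_trans zero_le_one)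
      then show ?thesis using True q by simp
    next
      case False
      then have "q n \<le> 1 / q n" using q by (simp add: pos_le_divide_eq mult_le_one)
      then show ?thesis using False q by (simp add: exp_minus inverse_eq_divide)
    qed
    then have "site_ratio n (q n) = exp (real n * \<bar>ln (q n)\<bar>)"
      by (simp add: site_ratio_def exp_of_nat_mult)
    then show ?case by (simp add: exp_minus abs_mult inverse_eq_divide)
  qed
  ultimately show ?thesis using Lim_transform_eventually by fastforce
qed

theorem lemma4p2:
  fixes q :: "nat \<Rightarrow> real" and \<beta> \<epsilon> :: real and k :: "nat \<Rightarrow> nat"
  assumes "\<And>n. n \<ge> 1 \<Longrightarrow> q n > 0"
    and "(\<lambda>n. real n * (1 - q n)) \<longlonglongrightarrow> \<beta>"
    and "\<bar>\<beta>\<bar> < ln 2"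
    and "\<And>n. n \<ge> 1 \<Longrightarrow> k n \<in> {1..n}"
    and "filterlim k at_top sequentially"
    and "\<epsilon> > 0"
  shows "(\<lambda>n. MAX b\<in>incr_tuples n (k n).
            measure (mallows n (q n))
              {p. p permutes {1..n} \<and>
                  real (LIS (k n) (induced_perm (k n) p b)) / sqrt (real (k n))
                    \<notin> {2 * exp (- \<bar>\<beta>\<bar> / 2) - \<epsilon> <..< 2 * exp (\<bar>\<beta>\<bar> / 2) + \<epsilon>}})
         \<longlonglongrightarrow> 0"
proof (rule LIMSEQ_I)
  fix r :: real assume "0 < r"
  define \<theta> where "\<theta> = exp (- \<bar>\<beta>\<bar>)"
  have \<theta>: "0 < \<theta>" "\<theta> \<le> 1" by (auto simp: \<theta>_def)
  have s\<theta>: "sqrt \<theta> = exp (- \<bar>\<beta>\<bar> / 2)"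
    by (intro real_sqrt_unique) (simp_all add: \<theta>_def power2_eq_square flip: exp_add)
  have inv_s\<theta>: "2 / sqrt \<theta> = 2 * exp (\<bar>\<beta>\<bar> / 2)"
    unfolding s\<theta> by (simp add: exp_minus field_simps)
  obtain \<theta>' where \<theta>': "\<theta>' < \<theta>" and ev: "\<forall>\<^sub>F m in sequentially. \<forall>\<^sub>F R in sequentially. \<forall>\<zeta> K.
    \<theta>' \<le> \<zeta> \<and> \<zeta> \<le> 1 \<and> comparable \<zeta> R K \<longrightarrow>
    measure_pmf.prob (kernel_seq m K []) {xs. real (lds xs) \<le> (2 * sqrt \<theta> - \<epsilon>) * sqrt (real m)} \<le> r / 8 \<and>
    measure_pmf.prob (kernel_seq m K []) {xs. (2 / sqrt \<theta> + \<epsilon>) * sqrt (real m) \<le> real (lds xs)} \<le> r / 8"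
    using lds_comparable[OF \<theta> assms(6), of "r / 8"] \<open>0 < r\<close> by auto
  have "\<forall>\<^sub>F n in sequentially. \<theta>' < 1 / site_ratio n (q n)"
    using order_tendstoD(1)[OF site_ratio_limit[OF assms(1,2)] \<theta>'[unfolded \<theta>_def]] by simp
  with eventually_compose_filterlim[OF ev assms(5)] eventually_ge_at_top[of 1]
  have "\<forall>\<^sub>F n in sequentially. norm ((MAX b\<in>incr_tuples n (k n).
            measure (mallows n (q n))
              {p. p permutes {1..n} \<and>
                  real (LIS (k n) (induced_perm (k n) p b)) / sqrt (real (k n))
                    \<notin> {2 * exp (- \<bar>\<beta>\<bar> / 2) - \<epsilon> <..< 2 * exp (\<bar>\<beta>\<bar> / 2) + \<epsilon>}}) - 0) < r"
  proof eventually_elim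
    case n: (elim n)
    define m where "m = k n"
    have m: "1 \<le> m" "m \<le> n" using assms(4)[OF n(2)] by (auto simp: m_def)
    have q: "0 < q n" using assms(1)[OF n(2)] .
    define \<zeta> where "\<zeta> = 1 / site_ratio n (q n)"
    have \<zeta>: "\<theta>' \<le> \<zeta>" "\<zeta> \<le> 1"
      using n(3) site_ratio_ge_1[OF q, of n] by (auto simp: \<zeta>_def)
    define bad where "bad = (\<lambda>l. real l / sqrt (real m) \<notin> {2 * exp (- \<bar>\<beta>\<bar> / 2) - \<epsilon> <..< 2 * exp (\<bar>\<beta>\<bar> / 2) + \<epsilon>})"
    define F where "F = (\<lambda>b. measure (mallows n (q n)) {p. p permutes {1..n} \<and> bad (LIS m (induced_perm m p b))})"
    \<comment> \<open>The alphabet size is auxiliary and may depend on \<open>n\<close>.\<close>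
    obtain R where R: "0 < R" "2 * (real n)\<^sup>2 * site_ratio n (q n) \<le> real R"
      and tail: "\<And>K. comparable \<zeta> R K \<Longrightarrow>
        measure_pmf.prob (kernel_seq m K []) {xs. real (lds xs) \<le> (2 * sqrt \<theta> - \<epsilon>) * sqrt (real m)} \<le> r / 8 \<and>
        measure_pmf.prob (kernel_seq m K []) {xs. (2 / sqrt \<theta> + \<epsilon>) * sqrt (real m) \<le> real (lds xs)} \<le> r / 8"
      using eventually_happens'[OF sequentially_bot eventually_conj[OF n(1) eventually_conj[OF
          eventually_gt_at_top[of 0] eventually_ge_real[of "2 * (real n)\<^sup>2 * site_ratio n (q n)"]]]] \<zeta>
      unfolding m_def by blast
    have F: "F b \<le> r / 2" if b: "b \<in> incr_tuples n m" for b
    proof -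
      define P where "P = kernel_seq m (letter_kernel n (q n) R m b) []"
      have cmp: "comparable \<zeta> R (letter_kernel n (q n) R m b)"
        unfolding \<zeta>_def by (rule comparable_letter_kernel[OF q R(1) b])
      have "F b \<le> 2 * measure_pmf.prob P {xs. bad (lds xs)}"
        unfolding F_def P_def by (rule mallows_le_kernel_seq[OF q R b])
      also have "measure_pmf.prob P {xs. bad (lds xs)} \<le>
          measure_pmf.prob P ({xs. real (lds xs) \<le> (2 * sqrt \<theta> - \<epsilon>) * sqrt (real m)} \<union>
            {xs. (2 / sqrt \<theta> + \<epsilon>) * sqrt (real m) \<le> real (lds xs)})"
      proof (rule measure_pmf.finite_measure_mono)
        show "{xs. bad (lds xs)} \<subseteq> {xs. real (lds xs) \<le> (2 * sqrt \<theta> - \<epsilon>) * sqrt (real m)} \<union>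
            {xs. (2 / sqrt \<theta> + \<epsilon>) * sqrt (real m) \<le> real (lds xs)}"
          using m unfolding bad_def inv_s\<theta> unfolding s\<theta>
          by (auto simp: pos_le_divide_eq pos_divide_le_eq not_less)
      qed simp
      also have "\<dots> \<le> measure_pmf.prob P {xs. real (lds xs) \<le> (2 * sqrt \<theta> - \<epsilon>) * sqrt (real m)} +
          measure_pmf.prob P {xs. (2 / sqrt \<theta> + \<epsilon>) * sqrt (real m) \<le> real (lds xs)}"
        by (rule measure_Un_le) auto
      also have "\<dots> \<le> r / 8 + r / 8" using tail[OF cmp] unfolding P_def by (intro add_mono) auto
      finally show ?thesis by simp
    qed
    have fin: "finite (F ` incr_tuples n m)" and ne: "incr_tuples n m \<noteq> {}"
      using finite_incr_tuples incr_tuples_nonempty[OF m(2)] by auto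
    then have "Max (F ` incr_tuples n m) \<in> F ` incr_tuples n m" by (intro Max_in) auto
    then obtain b where b: "b \<in> incr_tuples n m" "Max (F ` incr_tuples n m) = F b" by auto
    have "0 \<le> F b" by (simp add: F_def)
    then have "norm (Max (F ` incr_tuples n m) - 0) < r" using F[OF b(1)] b(2) \<open>0 < r\<close> by simp
    then show ?case unfolding F_def bad_def m_def .
  qed
  then show "\<exists>no. \<forall>n\<ge>no. norm ((MAX b\<in>incr_tuples n (k n).
            measure (mallows n (q n))
              {p. p permutes {1..n} \<and>
                  real (LIS (k n) (induced_perm (k n) p b)) / sqrt (real (k n))
                    \<notin> {2 * exp (- \<bar>\<beta>\<bar> / 2) - \<epsilon> <..< 2 * exp (\<bar>\<beta>\<bar> / 2) + \<epsilon>}}) - 0) < r"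
    by (simp only: eventually_sequentially)
qed

end
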